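(* There exist, up to scale, two one-parameter families of constant scalar curvature Kähler metrics on $\mathbb P(\mathcal O_{\mathbb CP^1\times\mathbb CP^1}\oplus\mathcal O_{\mathbb CP^1\times\mathbb CP^1}(1,-1))$: one for every value of $a>0$ and $c>0$ such that $a=c$ or $a=\frac1c$.
   Context: The manifold $M=\mathbb P(\mathcal O\oplus\mathcal O(1,-1))$ over $\mathbb CP^1\times\mathbb CP^1$ is a six-dimensional (real) toric manifold. The parameters $a,c>0$ describe its symplectic structures: up to scale the moment polytope is $$\{(x,y,z)\in\mathbb R^3:\ -1\le x\le1,\ y\ge-1,\ z\ge-1,\ x+y\le a,\ z-x\le c\}.$$ In symplectic coordinates $(x_1,x_2,x_3,\phi_1,\phi_2,\phi_3)$, $(x_1,x_2,x_3)=(x,y,z)$, a $T^3$-invariant Kähler metric with this polytope has the form $g=\sum h^{ij}dx_idx_j+\sum h_{ij}d\phi_id\phi_j$ with $(h^{ij})=(h_{ij})^{-1}=\big(\frac{\partial^2\Phi}{\partial x_i\partial x_j}\big)$ and $\Phi=\Phi_0+f$, where $\Phi_0=\frac12[(1+x)\log(1+x)+(1-x)\log(1-x)+(1+y)\log(1+y)+(1+z)\log(1+z)+(a-x-y)\log(a-x-y)+(c+x-z)\log(c+x-z)]$ and the second derivatives of $f$ are smooth on the polytope. The metrics of the families are of cohomogeneity one, with $f=f(x)$. *)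

theory Defs
  imports "HOL-Analysis.Analysis"
begin

definition partial :: "'n::finite \<Rightarrow> (real^'n \<Rightarrow> real) \<Rightarrow> real^'n \<Rightarrow> real" where
  "partial i f x = deriv (\<lambda>t. f (x + t *\<^sub>R axis i 1)) 0"

text \<open>\<open>Ck_on k S f\<close> is meant for open \<open>S\<close>, where differentiability within \<open>S\<close> is
  differentiability.\<close>

fun Ck_on :: "nat \<Rightarrow> (real^'n) set \<Rightarrow> (real^'n::finite \<Rightarrow> real) \<Rightarrow> bool" where
  "Ck_on 0 S f = continuous_on S f"
| "Ck_on (Suc k) S f = (f differentiable_on S \<and> (\<forall>i. Ck_on k S (partial i f)))"

definition smooth_on :: "(real^'n) set \<Rightarrow> (real^'n::finite \<Rightarrow> real) \<Rightarrow> bool" where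
  "smooth_on S f \<longleftrightarrow> (\<forall>k. Ck_on k S f)"

definition hessian :: "(real^'n::finite \<Rightarrow> real) \<Rightarrow> real^'n \<Rightarrow> real^'n^'n" where
  "hessian f x = (\<chi> i j. partial i (partial j f) x)"

text \<open>A metric is given by its matrix of components \<open>g x $ i $ j\<close>.\<close>

definition riemannian_metric_on ::
    "(real^'n) set \<Rightarrow> (real^'n::finite \<Rightarrow> real^'n^'n) \<Rightarrow> bool" where
  "riemannian_metric_on S g \<longleftrightarrow>
     (\<forall>i j. smooth_on S (\<lambda>x. g x $ i $ j)) \<and>
     (\<forall>x\<in>S. transpose (g x) = g x \<and> (\<forall>v. v \<noteq> 0 \<longrightarrow> 0 < v \<bullet> (g x *v v)))"

text \<open>\<open>christoffel g i j k\<close> is $\Gamma^i_{jk}$, and \<open>riemann g i j k l\<close> is $R^i{}_{jkl}$, i.e.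
  $R(\partial_k, \partial_l) \partial_j = \sum_i R^i{}_{jkl} \partial_i$.\<close>

definition christoffel ::
    "(real^'n::finite \<Rightarrow> real^'n^'n) \<Rightarrow> 'n \<Rightarrow> 'n \<Rightarrow> 'n \<Rightarrow> real^'n \<Rightarrow> real" where
  "christoffel g i j k x =
     (\<Sum>l\<in>UNIV. matrix_inv (g x) $ i $ l *
        (partial j (\<lambda>y. g y $ l $ k) x + partial k (\<lambda>y. g y $ l $ j) x
          - partial l (\<lambda>y. g y $ j $ k) x)) / 2"

definition riemann ::
    "(real^'n::finite \<Rightarrow> real^'n^'n) \<Rightarrow> 'n \<Rightarrow> 'n \<Rightarrow> 'n \<Rightarrow> 'n \<Rightarrow> real^'n \<Rightarrow> real" where
  "riemann g i j k l x =
     partial k (christoffel g i l j) x - partial l (christoffel g i k j) x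
     + (\<Sum>m\<in>UNIV. christoffel g i k m x * christoffel g m l j x
                 - christoffel g i l m x * christoffel g m k j x)"

definition ricci :: "(real^'n::finite \<Rightarrow> real^'n^'n) \<Rightarrow> 'n \<Rightarrow> 'n \<Rightarrow> real^'n \<Rightarrow> real" where
  "ricci g j l x = (\<Sum>i\<in>UNIV. riemann g i j i l x)"

definition scalar_curvature :: "(real^'n::finite \<Rightarrow> real^'n^'n) \<Rightarrow> real^'n \<Rightarrow> real" where
  "scalar_curvature g x = (\<Sum>j\<in>UNIV. \<Sum>l\<in>UNIV. matrix_inv (g x) $ j $ l * ricci g j l x)"

text \<open>For a constant symplectic form $\omega(u,v) = u^T \Omega v$, the equation
  $\omega(u,v) = g(Ju,v)$ means $J = -g^{-1}\Omega$. The metric is Kaehler with Kaehler form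
  $\omega$ iff $J^2 = -1$ and $\nabla J = 0$. Column \<open>j\<close> of \<open>J\<close> is the image of the \<open>j\<close>-th
  coordinate vector.\<close>

definition complex_structure ::
    "real^'n^'n \<Rightarrow> (real^'n::finite \<Rightarrow> real^'n^'n) \<Rightarrow> real^'n \<Rightarrow> real^'n^'n" where
  "complex_structure \<Omega> g x = - (matrix_inv (g x) ** \<Omega>)"

definition kaehler_metric_on ::
    "(real^'n) set \<Rightarrow> real^'n^'n \<Rightarrow> (real^'n::finite \<Rightarrow> real^'n^'n) \<Rightarrow> bool" where
  "kaehler_metric_on S \<Omega> g \<longleftrightarrow>
     riemannian_metric_on S g \<and>
     (\<forall>x\<in>S.
        complex_structure \<Omega> g x ** complex_structure \<Omega> g x = - mat 1 \<and>
        (\<forall>i j k.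
           partial k (\<lambda>y. complex_structure \<Omega> g y $ i $ j) x
           + (\<Sum>l\<in>UNIV. christoffel g i k l x * complex_structure \<Omega> g x $ l $ j
                       - christoffel g l k j x * complex_structure \<Omega> g x $ i $ l) = 0))"

definition polytope_M :: "real \<Rightarrow> real \<Rightarrow> (real^3) set" where
  "polytope_M a c = {x. -1 \<le> x$1 \<and> x$1 \<le> 1 \<and> x$2 \<ge> -1 \<and> x$3 \<ge> -1 \<and>
                        x$1 + x$2 \<le> a \<and> x$3 - x$1 \<le> c}"

definition Phi0 :: "real \<Rightarrow> real \<Rightarrow> real^3 \<Rightarrow> real" where
  "Phi0 a c x =
     ((1 + x$1) * ln (1 + x$1) + (1 - x$1) * ln (1 - x$1)
      + (1 + x$2) * ln (1 + x$2) + (1 + x$3) * ln (1 + x$3)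
      + (a - x$1 - x$2) * ln (a - x$1 - x$2) + (c + x$1 - x$3) * ln (c + x$1 - x$3)) / 2"

text \<open>A point of \<open>real^(3+3)\<close> is $(x_1,x_2,x_3,\phi_1,\phi_2,\phi_3)$ on the open orbit, and
  $(p_1,p_2,p_3,q_1,q_2,q_3)$ in the vertex charts below. The symplectic form is
  $\sum_i dx_i \wedge d\phi_i$, respectively $\sum_i dp_i \wedge dq_i$.\<close>

definition moment_part :: "real^(3+3) \<Rightarrow> real^3" where
  "moment_part X = (\<chi> i. X $ Inl i)"

definition angle_part :: "real^(3+3) \<Rightarrow> real^3" where
  "angle_part X = (\<chi> i. X $ Inr i)"

definition omega_std :: "real^(3+3)^(3+3)" where
  "omega_std = (\<chi> i j. case (i, j) of
      (Inl k, Inr l) \<Rightarrow> (if k = l then 1 else 0)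
    | (Inr k, Inl l) \<Rightarrow> (if k = l then -1 else 0)
    | _ \<Rightarrow> 0)"

text \<open>The part of the manifold over the interior of the polytope, with the angles unrolled
  from the torus to $\mathbb{R}^3$.\<close>

definition open_orbit :: "real \<Rightarrow> real \<Rightarrow> (real^(3+3)) set" where
  "open_orbit a c = {X. moment_part X \<in> interior (polytope_M a c)}"

definition toric_metric :: "(real^3 \<Rightarrow> real) \<Rightarrow> real^(3+3) \<Rightarrow> real^(3+3)^(3+3)" where
  "toric_metric \<Phi> X = (\<chi> i j. case (i, j) of
      (Inl k, Inl l) \<Rightarrow> hessian \<Phi> (moment_part X) $ k $ l
    | (Inr k, Inr l) \<Rightarrow> matrix_inv (hessian \<Phi> (moment_part X)) $ k $ l
    | _ \<Rightarrow> 0)"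

text \<open>The polytope is a combinatorial cube whose pairs of opposite facets are
  $1 \pm x = 0$; $1 + y = 0$, $a - x - y = 0$; $1 + z = 0$, $c + x - z = 0$. A vertex is a choice
  \<open>b\<close> of one facet from each pair, and \<open>facets a c b\<close> lists the three affine functions
  vanishing there; their linear parts, the rows of \<open>normals b\<close>, form a basis of $\mathbb{Z}^3$.\<close>

definition normals :: "(3 \<Rightarrow> bool) \<Rightarrow> real^3^3" where
  "normals b = vector [if b 1 then vector [-1, 0, 0] else vector [1, 0, 0],
                       if b 2 then vector [-1, -1, 0] else vector [0, 1, 0],
                       if b 3 then vector [1, 0, -1] else vector [0, 0, 1]]"

definition facets :: "real \<Rightarrow> real \<Rightarrow> (3 \<Rightarrow> bool) \<Rightarrow> real^3 \<Rightarrow> real^3" where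
  "facets a c b x =
     normals b *v x + vector [1, if b 2 then a else 1, if b 3 then c else 1]"

text \<open>The compact toric manifold $M$ is covered by eight Darboux charts, one for each vertex,
  centred at the fixed point over it. With $u = $ \<open>facets a c b x\<close> and angles $\psi$
  determined by $\sum_i du_i \wedge d\psi_i = \sum_i dx_i \wedge d\phi_i$, i.e. $\phi = N^T \psi$
  for $N = $ \<open>normals b\<close>, the complex chart coordinate is
  $p_i + \mathrm{i} q_i = \sqrt{2 u_i} e^{\mathrm{i}\psi_i}$.
  The chart domain is the part of $M$ over the points of the polytope that lie on none of the
  three facets opposite to the chosen ones.\<close>

definition vertex_chart :: "real \<Rightarrow> real \<Rightarrow> (3 \<Rightarrow> bool) \<Rightarrow> real^(3+3) \<Rightarrow> real^(3+3)" where
  "vertex_chart a c b X =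
     (let u = facets a c b (moment_part X);
          \<psi> = matrix_inv (transpose (normals b)) *v angle_part X
      in \<chi> j. case j of Inl i \<Rightarrow> sqrt (2 * u $ i) * cos (\<psi> $ i)
                      | Inr i \<Rightarrow> sqrt (2 * u $ i) * sin (\<psi> $ i))"

definition chart_domain :: "real \<Rightarrow> real \<Rightarrow> (3 \<Rightarrow> bool) \<Rightarrow> (real^(3+3)) set" where
  "chart_domain a c b = {Z. \<exists>x\<in>polytope_M a c.
      facets a c b x = (\<chi> i. ((Z $ Inl i)\<^sup>2 + (Z $ Inr i)\<^sup>2) / 2) \<and>
      (\<forall>i. 0 < facets a c (\<lambda>k. \<not> b k) x $ i)}"

text \<open>A metric on the open orbit extends to $M$ if in every vertex chart it is the pullback of a
  smooth Riemannian metric on the whole chart domain. The extension is unique because the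
  orbit is dense, so the extensions agree on overlaps. For the same reason the Kaehler
  condition and constancy of the scalar curvature, which are closed conditions, hold on all of
  $M$ once they hold on the orbit.\<close>

definition extends_to_M ::
    "real \<Rightarrow> real \<Rightarrow> (real^(3+3) \<Rightarrow> real^(3+3)^(3+3)) \<Rightarrow> bool" where
  "extends_to_M a c g \<longleftrightarrow>
     (\<forall>b. \<exists>G. riemannian_metric_on (chart_domain a c b) G \<and>
        (\<forall>X\<in>open_orbit a c.
           g X = transpose (jacobian (vertex_chart a c b) (at X))
                 ** G (vertex_chart a c b X)
                 ** jacobian (vertex_chart a c b) (at X)))"

definition kaehler_metric_on_M ::
    "real \<Rightarrow> real \<Rightarrow> (real^(3+3) \<Rightarrow> real^(3+3)^(3+3)) \<Rightarrow> bool" where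
  "kaehler_metric_on_M a c g \<longleftrightarrow>
     kaehler_metric_on (open_orbit a c) omega_std g \<and> extends_to_M a c g"

text \<open>The second derivatives of \<open>f\<close> are smooth on the closed polytope, in the sense of having
  smooth extensions to an open neighbourhood of it.\<close>

definition smooth_second_derivatives :: "(real^3) set \<Rightarrow> (real^3 \<Rightarrow> real) \<Rightarrow> bool" where
  "smooth_second_derivatives P f \<longleftrightarrow>
     smooth_on (interior P) f \<and>
     (\<forall>i j. \<exists>U h. open U \<and> P \<subseteq> U \<and> smooth_on U h \<and>
        (\<forall>x\<in>interior P. hessian f x $ i $ j = h x))"

definition constant_scalar_curvature_on ::
    "(real^'n) set \<Rightarrow> (real^'n::finite \<Rightarrow> real^'n^'n) \<Rightarrow> bool" where
  "constant_scalar_curvature_on S g \<longleftrightarrow> (\<exists>s. \<forall>x\<in>S. scalar_curvature g x = s)"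

end

theory Submission
  imports Defs
begin

text \<open>Let \<open>A = a + 1 - x\<close> and \<open>C = c + 1 + x\<close> be the lengths of the polytope in the directions of
  \<open>y\<close> and \<open>z\<close>. Put \<open>1 / h = 1 / (1 - x\<^sup>2) + f'' + 1 / (2 A) + 1 / (2 C)\<close>. The inverse Hessian \<open>G\<close> of the
  potential is polynomial in \<open>y, z\<close> with coefficients built from \<open>h, A, C\<close>, and Abreu's formula
  \<open>s = - \<Sum> \<partial>\<^sub>i \<partial>\<^sub>j G\<^sub>i\<^sub>j\<close> becomes the linear equation \<open>(A C h)'' = 4 (A + C) - s A C\<close>, in which \<open>A + C\<close> is
  constant. Smoothness at \<open>x = \<plusminus>1\<close> prescribes the values and first derivatives of \<open>A C h\<close> there: four
  conditions on \<open>s\<close> and two constants of integration. They are compatible iff \<open>a = c\<close>, or \<open>s = 6\<close> and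
  \<open>a c = 1\<close>. The solution is \<open>A C h = (1 - x\<^sup>2) P\<close> with \<open>P = A C + \<mu> (1 - x\<^sup>2)\<close> and \<open>s = 12 (1 + \<mu>)\<close>; here
  \<open>P\<close> is positive on \<open>[-1, 1]\<close> because \<open>\<mu> > -1\<close>. In the vertex charts the singular parts of the metric
  combine to the flat metric, and what remains is rational without poles.\<close>

section \<open>Smooth functions\<close>

text \<open>This is Calabi's ansatz in toric coordinates: \<open>x\<close> is the moment map of the
  circle acting on the projective fibres, \<open>h\<close> is the momentum profile, and the base
  carries two round spheres whose areas are affine in \<open>x\<close>. The right side of the
  equation for \<open>A C h\<close> is quadratic, so \<open>A C h\<close> is a quartic. A quartic
  with zeros at -1 and 1 and prescribed slopes there is determined up to a multiple of
  \<open>(1 - x\<^sup>2)\<^sup>2\<close>: this is the origin of \<open>P\<close>, with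
  \<open>\<mu>\<close> as the free coefficient. In the equation the coefficient of
  \<open>x\<^sup>2\<close> then fixes \<open>s\<close>, the constant one fixes \<open>\<mu>\<close>,
  and that of \<open>x\<close> leaves \<open>(a - c) (s - 6) = 0\<close>. For \<open>s = 6\<close>
  the constant one reads \<open>(a + 1) (c + 1) = a + c + 2\<close>. Two obstacles shape the work.
  Curvature is given by the coordinate expression in six dimensions, so Abreu's formula has to be
  derived by index calculus. And the matrix of the metric degenerates at the facets, so the
  extension is not obtained by limits: a formula without poles is written down in each chart and
  compared with the toric metric over the orbit as a quadratic form.\<close>

abbreviation has_partial :: "'n::finite \<Rightarrow> (real^'n \<Rightarrow> real) \<Rightarrow> real \<Rightarrow> real^'n \<Rightarrow> bool" where
  "has_partial i f D x \<equiv> ((\<lambda>t. f (x + t *\<^sub>R axis i 1)) has_real_derivative D) (at 0)"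

text \<open>\<open>partial\<close> rests on \<open>deriv\<close>, an arbitrary number where no
  derivative exists. Calculations therefore carry \<open>has_partial\<close>, which includes
  existence, and pass to \<open>partial\<close> only at the end.\<close>

lemma partial_eqI: "has_partial i f D x \<Longrightarrow> partial i f x = D"
  unfolding partial_def by (rule DERIV_imp_deriv)

lemma has_partial_partial:
  assumes "f differentiable (at x)"
  shows "has_partial i f (partial i f x) x"
proof -
  have "(\<lambda>t::real. x + t *\<^sub>R axis i 1) differentiable (at 0)"
    by simp
  moreover have "f differentiable (at (x + 0 *\<^sub>R axis i 1))" using assms by simp
  ultimately have "(f \<circ> (\<lambda>t::real. x + t *\<^sub>R axis i 1)) differentiable (at 0)"
    by (intro differentiable_chain_at) auto
  then show ?thesis
    unfolding partial_def o_def by (simp add: DERIV_deriv_iff_real_differentiable)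
qed

lemma eventually_line_in_open:
  assumes "open S" "x \<in> S"
  shows "\<forall>\<^sub>F t in nhds (0::real). x + t *\<^sub>R v \<in> (S :: 'a::real_normed_vector set)"
proof -
  have "((\<lambda>t::real. x + t *\<^sub>R v) \<longlongrightarrow> x + 0 *\<^sub>R v) (nhds 0)"
    by (intro tendsto_intros) (simp add: filterlim_ident)
  then show ?thesis using assms by (auto dest: topological_tendstoD)
qed

lemma partial_cong:
  assumes "open S" "x \<in> S" "\<And>y. y \<in> S \<Longrightarrow> f y = g y"
  shows "partial i f x = partial i g x"
  unfolding partial_def
  by (intro deriv_cong_ev eventually_mono[OF eventually_line_in_open[OF assms(1,2)]] assms(3) refl)

lemma has_partial_cong:
  assumes "open S" "x \<in> S" "\<And>y. y \<in> S \<Longrightarrow> f y = g y" "has_partial i g D x"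
  shows "has_partial i f D x"
proof -
  have "\<forall>\<^sub>F t in nhds 0. f (x + t *\<^sub>R axis i 1) = g (x + t *\<^sub>R axis i 1)"
    by (rule eventually_mono[OF eventually_line_in_open[OF assms(1,2)]]) (rule assms(3))
  then show ?thesis using assms(4) by (subst DERIV_cong_ev[OF refl _ refl]) auto
qed

lemma differentiable_on_cong_open:
  assumes "open S" "\<And>y. y \<in> S \<Longrightarrow> f y = g y" "f differentiable_on S"
  shows "g differentiable_on S"
  using assms unfolding differentiable_on_def differentiable_def
  by (metis (no_types, lifting) has_derivative_transform)

lemma differentiable_onD_open:
  "f differentiable_on S \<Longrightarrow> open S \<Longrightarrow> x \<in> S \<Longrightarrow> f differentiable (at x)"
  by (metis differentiable_on_def at_within_open)

lemma Ck_on_cong: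
  assumes "open S" "\<And>y. y \<in> S \<Longrightarrow> f y = g y"  "Ck_on k S f"
  shows "Ck_on k S g"
  using assms(2,3)
proof (induction k arbitrary: f g)
  case 0
  then show ?case by (metis Ck_on.simps(1) continuous_on_cong)
next
  case (Suc k)
  have "Ck_on k S (partial i g)" for i
    by (rule Suc.IH[of "partial i f"]) (use Suc.prems(2) in \<open>auto intro: partial_cong[OF assms(1) _ Suc.prems(1)]\<close>)
  then show ?case using Suc.prems differentiable_on_cong_open[OF assms(1), of f g] by auto
qed

lemma Ck_on_Suc_imp: "Ck_on (Suc k) S f \<Longrightarrow> Ck_on k S f"
  by (induction k arbitrary: f) (auto intro: differentiable_imp_continuous_on)

lemma Ck_on_const: "Ck_on k S (\<lambda>x. c)"
proof (induction k arbitrary: c)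
  case (Suc k)
  have "partial i (\<lambda>x. c) = (\<lambda>x. 0)" for i :: 'a
    by (rule ext, rule partial_eqI) auto
  then show ?case using Suc by (simp add: differentiable_on_const)
qed auto

lemma Ck_on_add:
  assumes "open S"
  shows "Ck_on k S f \<Longrightarrow> Ck_on k S g \<Longrightarrow> Ck_on k S (\<lambda>x. f x + g x)"
proof (induction k arbitrary: f g)
  case (Suc k)
  have d: "f differentiable at x" "g differentiable at x" if "x \<in> S" for x
    using Suc.prems assms that differentiable_onD_open by auto
  have "Ck_on k S (partial i (\<lambda>x. f x + g x))" for i
    by (rule Ck_on_cong[OF assms _ Suc.IH[of "partial i f" "partial i g"]])
       (use Suc.prems in \<open>auto intro!: partial_eqI[symmetric] DERIV_add has_partial_partial d\<close>)
  then show ?case using Suc.prems by (auto intro: differentiable_on_add)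
qed (simp add: continuous_on_add)

lemma Ck_on_mult:
  assumes "open S"
  shows "Ck_on k S f \<Longrightarrow> Ck_on k S g \<Longrightarrow> Ck_on k S (\<lambda>x. f x * g x)"
proof (induction k arbitrary: f g)
  case (Suc k)
  have d: "f differentiable at x" "g differentiable at x" if "x \<in> S" for x
    using Suc.prems assms that differentiable_onD_open by auto
  have "Ck_on k S (partial i (\<lambda>x. f x * g x))" for i
  proof (rule Ck_on_cong[OF assms])
    show "partial i f x * g x + partial i g x * f x = partial i (\<lambda>x. f x * g x) x" if "x \<in> S" for x
      using DERIV_mult[OF has_partial_partial[OF d(1)[OF that]] has_partial_partial[OF d(2)[OF that]], of i i]
      by (intro partial_eqI[symmetric]) simp
    show "Ck_on k S (\<lambda>x. partial i f x * g x + partial i g x * f x)"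
      using Suc.prems Ck_on_Suc_imp[OF Suc.prems(1)] Ck_on_Suc_imp[OF Suc.prems(2)]
      by (intro Ck_on_add assms Suc.IH) simp_all
  qed
  then show ?case using Suc.prems by (auto intro: differentiable_on_mult)
qed (simp add: continuous_on_mult)

text \<open>The derivative of \<open>1 / f\<close> involves only \<open>f'\<close> and
  \<open>1 / f\<close> itself, so the induction closes with \<open>f\<close> fixed, given closure
  under products.\<close>

lemma Ck_on_inverse:
  assumes "open S" "\<And>x. x \<in> S \<Longrightarrow> f x \<noteq> 0"
  shows "Ck_on k S f \<Longrightarrow> Ck_on k S (\<lambda>x. inverse (f x))"
proof (induction k)
  case (Suc k)
  have d: "f differentiable at x" if "x \<in> S" for x
    using Suc.prems assms that differentiable_onD_open by auto
  have f: "Ck_on k S (\<lambda>x. inverse (f x))" using Suc.IH Ck_on_Suc_imp[OF Suc.prems] by blast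
  have "Ck_on k S (partial i (\<lambda>x. inverse (f x)))" for i
  proof (rule Ck_on_cong[OF assms(1)])
    show "(-1) * (partial i f x * (inverse (f x) * inverse (f x))) = partial i (\<lambda>x. inverse (f x)) x" if "x \<in> S" for x
      using DERIV_inverse_fun[OF has_partial_partial[OF d[OF that]], of i] assms(2)[OF that]
      by (intro partial_eqI[symmetric]) (simp add: power2_eq_square)
    show "Ck_on k S (\<lambda>x. (-1) * (partial i f x * (inverse (f x) * inverse (f x))))"
      using Suc.prems by (intro Ck_on_mult Ck_on_const assms(1) f) simp
  qed
  moreover have "(\<lambda>x. inverse (f x)) differentiable_on S"
    using Suc.prems assms by (auto intro: differentiable_on_inverse)
  ultimately show ?case by auto
qed (use assms in \<open>auto intro!: continuous_on_inverse\<close>)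

lemma Ck_on_component: "Ck_on k S (\<lambda>x. x $ j)"
proof (cases k)
  case (Suc k)
  have "partial i (\<lambda>x. x $ j) = (\<lambda>x. if i = j then 1 else 0)" for i
    by (rule ext, rule partial_eqI) (auto intro!: derivative_eq_intros simp: axis_def)
  moreover have "(\<lambda>x::real^'a. x $ j) differentiable_on S"
    by (intro linear_imp_differentiable_on) (auto simp: linear_iff)
  ultimately show ?thesis using Suc by (auto intro: Ck_on_const)
qed (simp add: continuous_on_component)

lemma smooth_on_cong:
  "open S \<Longrightarrow> (\<And>y. y \<in> S \<Longrightarrow> f y = g y) \<Longrightarrow> smooth_on S g \<Longrightarrow> smooth_on S f"
  unfolding smooth_on_def using Ck_on_cong[of S g f] by auto

named_theorems smooth_intros

lemma smooth_on_const [smooth_intros]: "smooth_on S (\<lambda>x. c)"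
  by (simp add: smooth_on_def Ck_on_const)

lemma smooth_on_component [smooth_intros]: "smooth_on S (\<lambda>x. x $ j)"
  by (simp add: smooth_on_def Ck_on_component)

lemma smooth_on_add [smooth_intros]:
  "open S \<Longrightarrow> smooth_on S f \<Longrightarrow> smooth_on S g \<Longrightarrow> smooth_on S (\<lambda>x. f x + g x)"
  by (simp add: smooth_on_def Ck_on_add)

lemma smooth_on_mult [smooth_intros]:
  "open S \<Longrightarrow> smooth_on S f \<Longrightarrow> smooth_on S g \<Longrightarrow> smooth_on S (\<lambda>x. f x * g x)"
  by (simp add: smooth_on_def Ck_on_mult)

lemma smooth_on_minus [smooth_intros]:
  "open S \<Longrightarrow> smooth_on S f \<Longrightarrow> smooth_on S (\<lambda>x. - f x)"
  using smooth_on_mult[OF _ smooth_on_const[of S "-1"], of f] by simp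

lemma smooth_on_diff [smooth_intros]:
  "open S \<Longrightarrow> smooth_on S f \<Longrightarrow> smooth_on S g \<Longrightarrow> smooth_on S (\<lambda>x. f x - g x)"
  using smooth_on_add[OF _ _ smooth_on_minus, of S f g] by simp

lemma smooth_on_divide [smooth_intros]:
  "open S \<Longrightarrow> smooth_on S f \<Longrightarrow> smooth_on S g \<Longrightarrow> (\<And>x. x \<in> S \<Longrightarrow> g x \<noteq> 0) \<Longrightarrow> smooth_on S (\<lambda>x. f x / g x)"
  unfolding divide_inverse by (rule smooth_on_mult) (simp_all add: smooth_on_def Ck_on_inverse)

lemma smooth_on_power [smooth_intros]:
  "open S \<Longrightarrow> smooth_on S f \<Longrightarrow> smooth_on S (\<lambda>x. f x ^ n)"
  by (induction n) (auto intro: smooth_on_const smooth_on_mult)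

lemma smooth_on_sum [smooth_intros]:
  "open S \<Longrightarrow> (\<And>i. i \<in> I \<Longrightarrow> smooth_on S (f i)) \<Longrightarrow> smooth_on S (\<lambda>x. \<Sum>i\<in>I. f i x)"
  by (induction I rule: infinite_finite_induct) (auto intro: smooth_on_const smooth_on_add)

lemma smooth_on_partial: "smooth_on S f \<Longrightarrow> smooth_on S (partial i f)"
  unfolding smooth_on_def by (metis Ck_on.simps(2))

text \<open>Serves functions known only through their derivatives, such as the integrals that define
  the correction term of the potential.\<close>

lemma smooth_onI:
  assumes "f differentiable_on S" "\<And>i. smooth_on S (partial i f)"
  shows "smooth_on S f"
  unfolding smooth_on_def
proof
  fix k show "Ck_on k S f"
    using assms by (cases k) (auto simp: smooth_on_def differentiable_imp_continuous_on)
qed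

lemma smooth_on_imp_differentiable:
  assumes "smooth_on S f" "open S" "x \<in> S"
  shows "f differentiable (at x)"
proof -
  have "Ck_on (Suc 0) S f" using assms(1) unfolding smooth_on_def by blast
  then show ?thesis using assms(2,3) differentiable_onD_open by auto
qed

lemma smooth_on_has_partial:
  "smooth_on S f \<Longrightarrow> open S \<Longrightarrow> x \<in> S \<Longrightarrow> has_partial i f (partial i f x) x"
  by (intro has_partial_partial smooth_on_imp_differentiable)

section \<open>Toric metrics\<close>

text \<open>\<open>matrix_inv\<close> chooses a two-sided inverse; for square matrices a one-sided
  inverse is two-sided and unique, so one product identifies it.\<close>

lemma matrix_inv_eqI:
  fixes A B :: "real^'n^'n"
  assumes "A ** B = mat 1"
  shows "matrix_inv A = B"
proof -
  have BA: "B ** A = mat 1" using assms matrix_left_right_inverse by blast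
  have "\<exists>A'. A ** A' = mat 1 \<and> A' ** A = mat 1" using assms BA by blast
  then have "A ** matrix_inv A = mat 1"
    unfolding matrix_inv_def by (rule someI2_ex) simp
  then have "B ** (A ** matrix_inv A) = B ** mat 1" by simp
  then show ?thesis by (simp add: matrix_mul_assoc BA)
qed

lemma sum_UNIV_sum_type:
  "(\<Sum>s\<in>(UNIV :: ('a::finite + 'b::finite) set). f s) = (\<Sum>i\<in>UNIV. f (Inl i)) + (\<Sum>i\<in>UNIV. f (Inr i))"
  using sum.Plus[of UNIV UNIV f] by (simp add: UNIV_Plus_UNIV)

lemma moment_part_line_Inl: "moment_part (X + t *\<^sub>R axis (Inl k) 1) = moment_part X + t *\<^sub>R axis k 1"
  by (simp add: moment_part_def vec_eq_iff axis_def)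

lemma moment_part_line_Inr: "moment_part (X + t *\<^sub>R axis (Inr k) 1) = moment_part X"
  by (simp add: moment_part_def vec_eq_iff axis_def)

lemma partial_moment_part_Inl: "partial (Inl k) (\<lambda>Y. F (moment_part Y)) X = partial k F (moment_part X)"
  by (simp add: partial_def moment_part_line_Inl)

lemma partial_moment_part_Inr: "partial (Inr k) (\<lambda>Y. F (moment_part Y)) X = 0"
  by (simp add: partial_def moment_part_line_Inr)

lemma partial_const: "partial i (\<lambda>x. c) X = 0"
  by (simp add: partial_def)

lemma bounded_linear_moment_part: "bounded_linear moment_part"
proof -
  have "linear moment_part"
    by (auto simp: linear_iff moment_part_def vec_eq_iff)
  then show ?thesis by (rule linear_conv_bounded_linear[THEN iffD1])
qed

lemma open_moment_part_vimage:
  assumes "open U" shows "open {X. moment_part X \<in> U}"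
proof -
  have "continuous_on UNIV moment_part"
    using bounded_linear_moment_part linear_continuous_on by blast
  then show ?thesis using open_vimage[OF assms] by (simp add: vimage_def)
qed

text \<open>A partial derivative of a pulled back function is again a pull-back, or zero in the
  angular directions; hence the induction lets \<open>F\<close> vary.\<close>

lemma smooth_on_moment_part:
  assumes "open U" "smooth_on U F"
  shows "smooth_on {X. moment_part X \<in> U} (\<lambda>X. F (moment_part X))"
proof -
  have "Ck_on k {X. moment_part X \<in> U} (\<lambda>X. F (moment_part X))" if "smooth_on U F" for k F
    using that
  proof (induction k arbitrary: F)
    case 0
    then have "continuous_on U F" by (simp add: smooth_on_def) (metis Ck_on.simps(1))
    moreover have "continuous_on {X. moment_part X \<in> U} moment_part"
      using bounded_linear_moment_part linear_continuous_on by blast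
    ultimately show ?case
      by (auto intro: continuous_on_compose2)
  next
    case (Suc k)
    have "(\<lambda>X. F (moment_part X)) differentiable (at X)" if "moment_part X \<in> U" for X
      using differentiable_chain_at[of moment_part X F] bounded_linear_imp_differentiable[OF bounded_linear_moment_part]
        smooth_on_imp_differentiable[OF Suc.prems assms(1) that] by (simp add: o_def)
    then have "(\<lambda>X. F (moment_part X)) differentiable_on {X. moment_part X \<in> U}"
      by (intro differentiable_at_imp_differentiable_on) simp
    moreover have "Ck_on k {X. moment_part X \<in> U} (partial i (\<lambda>X. F (moment_part X)))" for i
    proof (cases i)
      case (Inl l)
      then have "partial i (\<lambda>X. F (moment_part X)) = (\<lambda>X. partial l F (moment_part X))"
        by (simp add: fun_eq_iff partial_moment_part_Inl)
      then show ?thesis using Suc smooth_on_partial by metis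
    next
      case (Inr l)
      then have "partial i (\<lambda>X. F (moment_part X)) = (\<lambda>X. 0)"
        by (simp add: fun_eq_iff partial_moment_part_Inr)
      then show ?thesis by (simp add: Ck_on_const)
    qed
    ultimately show ?case by simp
  qed
  then show ?thesis using assms(2) by (simp add: smooth_on_def)
qed

section \<open>Index calculus of a Hessian metric at a point\<close>

text \<open>\<open>hess_gamma\<close> is the Christoffel symbol of a Hessian metric with inverse \<open>G\<close> and third
  derivatives \<open>T\<close> of the potential; \<open>hess_gamma_up\<close> has all indices raised.\<close>

lemma sum_rotate3: "(\<Sum>a\<in>A. \<Sum>b\<in>B. \<Sum>c\<in>C. f a b c) = (\<Sum>b\<in>B. \<Sum>c\<in>C. \<Sum>a\<in>A. f a b c)"
  by (subst sum.swap, rule sum.cong[OF refl], rule sum.swap)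

lemma sum_rotate4:
  "(\<Sum>a\<in>A. \<Sum>b\<in>B. \<Sum>c\<in>C. \<Sum>d\<in>D. f a b c d) = (\<Sum>b\<in>B. \<Sum>c\<in>C. \<Sum>d\<in>D. \<Sum>a\<in>A. f a b c d)"
  by (subst sum.swap, rule sum.cong[OF refl], rule sum_rotate3)

definition hess_gamma :: "(3 \<Rightarrow> 3 \<Rightarrow> real) \<Rightarrow> (3 \<Rightarrow> 3 \<Rightarrow> 3 \<Rightarrow> real) \<Rightarrow> 3 \<Rightarrow> 3 \<Rightarrow> 3 \<Rightarrow> real" where
  "hess_gamma G T i j k = (\<Sum>l\<in>UNIV. G i l * T l j k) / 2"

definition hess_gamma_up :: "(3 \<Rightarrow> 3 \<Rightarrow> real) \<Rightarrow> (3 \<Rightarrow> 3 \<Rightarrow> 3 \<Rightarrow> real) \<Rightarrow> 3 \<Rightarrow> 3 \<Rightarrow> 3 \<Rightarrow> real" where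
  "hess_gamma_up G T i j k = (\<Sum>l\<in>UNIV. \<Sum>q\<in>UNIV. G i l * G k q * hess_gamma G T j l q)"

text \<open>Data at one point: the Hessian, its inverse and the totally symmetric third derivatives.
  The identities below are tensor algebra without differentiation and are interpreted at each point
  separately.\<close>

locale hessian_tensors =
  fixes H G :: "3 \<Rightarrow> 3 \<Rightarrow> real" and T :: "3 \<Rightarrow> 3 \<Rightarrow> 3 \<Rightarrow> real"
  assumes HG: "(\<Sum>k\<in>UNIV. H i k * G k j) = (if i = j then 1 else 0)"
    and H_sym: "H i j = H j i" and G_sym: "G i j = G j i"
    and T_sym12: "T i j k = T j i k" and T_sym23: "T i j k = T i k j"
begin

abbreviation "M \<equiv> hess_gamma G T"
abbreviation "K \<equiv> hess_gamma_up G T"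

lemma M_sym: "M i j k = M i k j"
  unfolding hess_gamma_def using T_sym23 by simp

lemma T_eq_M: "T i j k = 2 * (\<Sum>p\<in>UNIV. H i p * M p j k)"
proof -
  have "2 * (\<Sum>p\<in>UNIV. H i p * M p j k) = (\<Sum>l\<in>UNIV. (\<Sum>p\<in>UNIV. H i p * G p l) * T l j k)"
  proof -
    have "2 * (\<Sum>p\<in>UNIV. H i p * M p j k) = (\<Sum>p\<in>UNIV. \<Sum>l\<in>UNIV. H i p * G p l * T l j k)"
      unfolding hess_gamma_def by (simp add: sum_distrib_left mult.assoc sum_divide_distrib)
    also have "\<dots> = (\<Sum>l\<in>UNIV. \<Sum>p\<in>UNIV. H i p * G p l * T l j k)" by (rule sum.swap)
    finally show ?thesis by (simp add: sum_distrib_right)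
  qed
  also have "\<dots> = T i j k" by (simp add: HG mult_delta_left)
  finally show ?thesis by simp
qed

text \<open>Each side is half of \<open>T\<close> with two indices raised, and \<open>T\<close> is
  totally symmetric.\<close>

lemma MG_swap: "(\<Sum>q\<in>UNIV. M i l q * G q j) = (\<Sum>q\<in>UNIV. M j l q * G q i)"
proof -
  have e: "(\<Sum>q\<in>UNIV. M i l q * G q j) = (\<Sum>q\<in>UNIV. \<Sum>p\<in>UNIV. G i p * G j q * T p l q) / 2" for i j
  proof -
    have "M i l q * G q j = (\<Sum>p\<in>UNIV. G i p * G j q * T p l q) / 2" for q
      unfolding hess_gamma_def G_sym[of q j] by (simp add: sum_distrib_right sum_distrib_left mult_ac)
    then show ?thesis by (simp add: sum_divide_distrib)
  qed
  have "(\<Sum>q\<in>UNIV. \<Sum>p\<in>UNIV. G i p * G j q * T p l q) = (\<Sum>p\<in>UNIV. \<Sum>q\<in>UNIV. G i p * G j q * T p l q)"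
    by (rule sum.swap)
  also have "\<dots> = (\<Sum>p\<in>UNIV. \<Sum>q\<in>UNIV. G j q * G i p * T q l p)"
  proof (intro sum.cong refl)
    show "G i p * G j q * T p l q = G j q * G i p * T q l p" for p q
      using T_sym12[of p l q] T_sym23[of l p q] T_sym12[of l q p] by simp
  qed
  finally show ?thesis unfolding e by simp
qed

lemma K_sym13: "K i j k = K k j i"
proof -
  have "K i j k = (\<Sum>q\<in>UNIV. \<Sum>l\<in>UNIV. G i l * G k q * M j l q)"
    unfolding hess_gamma_up_def by (rule sum.swap)
  also have "\<dots> = (\<Sum>q\<in>UNIV. \<Sum>l\<in>UNIV. G k q * G i l * M j q l)"
    by (intro sum.cong refl arg_cong2[where f = "(*)"] mult.commute M_sym)
  finally show ?thesis unfolding hess_gamma_up_def .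
qed

text \<open>\<open>K\<close> is half of \<open>T\<close> with all indices raised. Together with
  \<open>K_sym13\<close> this transposition generates all permutations.\<close>

lemma K_sym23: "K i j k = K i k j"
proof -
  have K: "K i j k = (\<Sum>l\<in>UNIV. G i l * (\<Sum>q\<in>UNIV. M j l q * G q k))" for j k
  proof -
    have "(\<Sum>q\<in>UNIV. G i l * G k q * M j l q) = G i l * (\<Sum>q\<in>UNIV. M j l q * G q k)" for l
      unfolding sum_distrib_left by (intro sum.cong refl) (subst G_sym, simp)
    then show ?thesis unfolding hess_gamma_up_def by simp
  qed
  show ?thesis unfolding K MG_swap[of j _ k] ..
qed

text \<open>Contraction with \<open>H\<close> undoes one raising of an index.\<close>

lemma lower_K: "(\<Sum>k\<in>UNIV. H a k * K i j k) = (\<Sum>l\<in>UNIV. G i l * M j l a)"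
proof -
  have "(\<Sum>k\<in>UNIV. H a k * K i j k) = (\<Sum>l\<in>UNIV. \<Sum>q\<in>UNIV. G i l * M j l q * (\<Sum>k\<in>UNIV. H a k * G k q))"
    unfolding hess_gamma_up_def sum_distrib_left by (subst sum_rotate3) (simp only: mult_ac)
  also have "\<dots> = (\<Sum>l\<in>UNIV. G i l * M j l a)"
    by (simp add: HG mult_delta_right)
  finally show ?thesis .
qed

text \<open>Two expressions for one vector field. Differentiating the one or the other yields the
  angular or the moment half of the scalar curvature.\<close>

lemma trace_K: "(\<Sum>j\<in>UNIV. \<Sum>l\<in>UNIV. H j l * K i j l) = (\<Sum>j\<in>UNIV. \<Sum>l\<in>UNIV. G j l * M i j l)"
proof -
  have "(\<Sum>j\<in>UNIV. \<Sum>l\<in>UNIV. H j l * K i j l) = (\<Sum>j\<in>UNIV. \<Sum>l\<in>UNIV. H j l * K j i l)"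
    by (intro sum.cong refl) (subst K_sym13, subst K_sym23, subst K_sym13, simp)
  also have "\<dots> = (\<Sum>j\<in>UNIV. \<Sum>l\<in>UNIV. G j l * M i l j)"
    by (simp add: lower_K)
  also have "\<dots> = (\<Sum>j\<in>UNIV. \<Sum>l\<in>UNIV. G j l * M i j l)" by (subst M_sym) (rule refl)
  finally show ?thesis .
qed

text \<open>A quarter of the squared norm of \<open>T\<close>. Up to a constant factor, every
  quadratic contraction in the curvature computation equals it; the lemmas below only reorder sums
  and move indices.\<close>

definition normK where
  "normK = (\<Sum>j\<in>UNIV. \<Sum>l\<in>UNIV. \<Sum>i\<in>UNIV. \<Sum>m\<in>UNIV. G j l * M i l m * M m i j)"

lemma normK_order_jiml: "(\<Sum>j\<in>UNIV. \<Sum>i\<in>UNIV. \<Sum>m\<in>UNIV. \<Sum>l\<in>UNIV. G j l * M i l m * M m i j) = normK"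
  unfolding normK_def by (intro sum.cong refl sum_rotate3[symmetric])

lemma normK_order_mijl: "(\<Sum>m\<in>UNIV. \<Sum>i\<in>UNIV. \<Sum>j\<in>UNIV. \<Sum>l\<in>UNIV. G j l * M i l m * M m i j) = normK"
proof -
  have "(\<Sum>m\<in>UNIV. \<Sum>i\<in>UNIV. \<Sum>j\<in>UNIV. \<Sum>l\<in>UNIV. G j l * M i l m * M m i j)
    = (\<Sum>i\<in>UNIV. \<Sum>j\<in>UNIV. \<Sum>l\<in>UNIV. \<Sum>m\<in>UNIV. G j l * M i l m * M m i j)"
    by (rule sum_rotate4)
  also have "\<dots> = normK" unfolding normK_def by (rule sum_rotate3)
  finally show ?thesis .
qed

lemma H_contract_K_M: "(\<Sum>j\<in>UNIV. \<Sum>l\<in>UNIV. H j l * (\<Sum>i\<in>UNIV. \<Sum>m\<in>UNIV. K i l m * M j m i)) = normK"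
proof -
  have "(\<Sum>j\<in>UNIV. \<Sum>l\<in>UNIV. H j l * (\<Sum>i\<in>UNIV. \<Sum>m\<in>UNIV. K i l m * M j m i))
      = (\<Sum>j\<in>UNIV. \<Sum>l\<in>UNIV. \<Sum>i\<in>UNIV. \<Sum>m\<in>UNIV. H j l * K i m l * M j m i)"
    unfolding sum_distrib_left mult.assoc[symmetric]
    by (intro sum.cong refl arg_cong2[where f = "(*)"] K_sym23)
  also have "\<dots> = (\<Sum>j\<in>UNIV. \<Sum>i\<in>UNIV. \<Sum>m\<in>UNIV. \<Sum>l\<in>UNIV. H j l * K i m l * M j m i)"
    by (intro sum.cong refl sum_rotate3)
  also have "\<dots> = (\<Sum>i\<in>UNIV. \<Sum>m\<in>UNIV. \<Sum>j\<in>UNIV. \<Sum>l\<in>UNIV. H j l * K i m l * M j m i)"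
    by (rule sum_rotate3)
  also have "\<dots> = (\<Sum>i\<in>UNIV. \<Sum>m\<in>UNIV. \<Sum>j\<in>UNIV. \<Sum>l\<in>UNIV. G i l * M m l j * M j m i)"
    unfolding sum_distrib_right[symmetric] lower_K ..
  also have "\<dots> = normK" by (rule normK_order_jiml)
  finally show ?thesis .
qed

lemma H_contract_M_K: "(\<Sum>j\<in>UNIV. \<Sum>l\<in>UNIV. H j l * (\<Sum>i\<in>UNIV. \<Sum>m\<in>UNIV. M l i m * K m i j)) = normK"
proof -
  have "(\<Sum>j\<in>UNIV. \<Sum>l\<in>UNIV. H j l * (\<Sum>i\<in>UNIV. \<Sum>m\<in>UNIV. M l i m * K m i j))
      = (\<Sum>j\<in>UNIV. \<Sum>l\<in>UNIV. \<Sum>i\<in>UNIV. \<Sum>m\<in>UNIV. H l j * K m i j * M l i m)"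
    unfolding sum_distrib_left by (intro sum.cong refl) (subst H_sym, simp)
  also have "\<dots> = (\<Sum>l\<in>UNIV. \<Sum>i\<in>UNIV. \<Sum>m\<in>UNIV. \<Sum>j\<in>UNIV. H l j * K m i j * M l i m)"
    by (rule sum_rotate4)
  also have "\<dots> = (\<Sum>l\<in>UNIV. \<Sum>i\<in>UNIV. \<Sum>m\<in>UNIV. \<Sum>j\<in>UNIV. G m j * M i j l * M l i m)"
    unfolding sum_distrib_right[symmetric] lower_K ..
  also have "\<dots> = normK" by (rule normK_order_mijl)
  finally show ?thesis .
qed

text \<open>The first factor is the derivative of \<open>G\<close>, as computed in
  \<open>G_deriv\<close>.\<close>

lemma dG_contract_M: "(\<Sum>i\<in>UNIV. \<Sum>j\<in>UNIV. \<Sum>l\<in>UNIV. (-2 * (\<Sum>q\<in>UNIV. M j i q * G q l)) * M i j l) = -2 * normK"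
proof -
  have "M j i q * G q l * M i j l = G l q * M j q i * M i j l" for i j l q
    using M_sym[of j i q] G_sym[of q l] by (simp add: mult.commute)
  then have "(\<Sum>q\<in>UNIV. M j i q * G q l) * M i j l = (\<Sum>q\<in>UNIV. G l q * M j q i * M i j l)" for i j l
    unfolding sum_distrib_right by (intro sum.cong refl)
  then have "(-2 * (\<Sum>q\<in>UNIV. M j i q * G q l)) * M i j l = -2 * (\<Sum>q\<in>UNIV. G l q * M j q i * M i j l)" for i j l
    by simp
  then show ?thesis by (simp only: normK_order_mijl[symmetric] sum_distrib_left[symmetric])
qed

lemma T_contract_K: "(\<Sum>i\<in>UNIV. \<Sum>j\<in>UNIV. \<Sum>l\<in>UNIV. T i j l * K i j l) = 2 * normK"
proof -
  have T: "T i j l = 2 * (\<Sum>p\<in>UNIV. H p j * M p i l)" for i j l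
    using T_eq_M[of j i l] T_sym12[of i j l] H_sym[of j] by simp
  have "(\<Sum>i\<in>UNIV. \<Sum>j\<in>UNIV. \<Sum>l\<in>UNIV. T i j l * K i j l)
    = 2 * (\<Sum>i\<in>UNIV. \<Sum>j\<in>UNIV. \<Sum>l\<in>UNIV. \<Sum>p\<in>UNIV. H p j * K i l j * M p i l)"
  proof -
    have "T i j l * K i j l = 2 * (\<Sum>p\<in>UNIV. H p j * K i l j * M p i l)" for i j l
      unfolding T[of i j l] K_sym23[of i j l] by (simp add: sum_distrib_left mult_ac)
    then show ?thesis by (simp only: sum_distrib_left[symmetric])
  qed
  also have "(\<Sum>i\<in>UNIV. \<Sum>j\<in>UNIV. \<Sum>l\<in>UNIV. \<Sum>p\<in>UNIV. H p j * K i l j * M p i l)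
    = (\<Sum>i\<in>UNIV. \<Sum>l\<in>UNIV. \<Sum>p\<in>UNIV. \<Sum>j\<in>UNIV. H p j * K i l j * M p i l)"
    by (intro sum.cong refl sum_rotate3)
  also have "\<dots> = (\<Sum>i\<in>UNIV. \<Sum>l\<in>UNIV. \<Sum>p\<in>UNIV. \<Sum>j\<in>UNIV. G i j * M l j p * M p i l)"
    unfolding sum_distrib_right[symmetric] lower_K ..
  also have "\<dots> = (\<Sum>i\<in>UNIV. \<Sum>l\<in>UNIV. \<Sum>p\<in>UNIV. \<Sum>j\<in>UNIV. G i j * M l j p * M p l i)"
    by (intro sum.cong refl arg_cong2[where f = "(*)"] M_sym)
  also have "\<dots> = normK" by (rule normK_order_jiml)
  finally show ?thesis .
qed

lemma G_contract_M_M: "(\<Sum>j\<in>UNIV. \<Sum>l\<in>UNIV. G j l * (\<Sum>i\<in>UNIV. \<Sum>m\<in>UNIV. M i l m * M m i j)) = normK"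
  unfolding normK_def sum_distrib_left mult.assoc ..

lemma G_contract_M_M_swapped: "(\<Sum>j\<in>UNIV. \<Sum>l\<in>UNIV. G j l * (\<Sum>i\<in>UNIV. \<Sum>m\<in>UNIV. M m i l * M i m j)) = normK"
proof -
  have "(\<Sum>i\<in>UNIV. \<Sum>m\<in>UNIV. M m i l * M i m j) = (\<Sum>i\<in>UNIV. \<Sum>m\<in>UNIV. M i l m * M m i j)" for j l
  proof -
    have "(\<Sum>i\<in>UNIV. \<Sum>m\<in>UNIV. M m i l * M i m j) = (\<Sum>i\<in>UNIV. \<Sum>m\<in>UNIV. M i m l * M m i j)"
      by (rule sum.swap)
    also have "\<dots> = (\<Sum>i\<in>UNIV. \<Sum>m\<in>UNIV. M i l m * M m i j)"
      by (intro sum.cong refl arg_cong2[where f = "(*)"] M_sym)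
    finally show ?thesis .
  qed
  then show ?thesis using G_contract_M_M by simp
qed

end

section \<open>Toric metrics: Christoffel symbols, curvature and complex structure\<close>

text \<open>Symmetry of the second and third derivatives and smoothness of the inverse Hessian are
  taken as assumptions because for the potential in question they can be read off closed
  formulas.\<close>

locale toric_potential =
  fixes U :: "(real^3) set" and \<Phi> :: "real^3 \<Rightarrow> real"
  assumes open_U: "open U"
    and smooth_H: "smooth_on U (\<lambda>x. hessian \<Phi> x $ i $ j)"
    and smooth_G: "smooth_on U (\<lambda>x. matrix_inv (hessian \<Phi> x) $ i $ j)"
    and HG_mat: "x \<in> U \<Longrightarrow> hessian \<Phi> x ** matrix_inv (hessian \<Phi> x) = mat 1"
    and H_sym_on: "x \<in> U \<Longrightarrow> hessian \<Phi> x $ i $ j = hessian \<Phi> x $ j $ i"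
    and H_pos: "x \<in> U \<Longrightarrow> v \<noteq> 0 \<Longrightarrow> 0 < v \<bullet> (hessian \<Phi> x *v v)"
    and T_sym_on: "x \<in> U \<Longrightarrow> partial i (\<lambda>y. hessian \<Phi> y $ j $ k) x = partial j (\<lambda>y. hessian \<Phi> y $ i $ k) x"
begin

definition H where "H x i j = hessian \<Phi> x $ i $ j"
definition G where "G x i j = matrix_inv (hessian \<Phi> x) $ i $ j"
definition T where "T x i j k = partial i (\<lambda>y. H y j k) x"
definition Gam where "Gam x = hess_gamma (G x) (T x)"
definition Kup where "Kup x = hess_gamma_up (G x) (T x)"

lemma GH_mat: "x \<in> U \<Longrightarrow> matrix_inv (hessian \<Phi> x) ** hessian \<Phi> x = mat 1"
  using HG_mat matrix_left_right_inverse by blast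

lemma hessian_tensors_at: 
  assumes x: "x \<in> U"
  shows "hessian_tensors (H x) (G x) (T x)"
proof
  show "(\<Sum>k\<in>UNIV. H x i k * G x k j) = (if i = j then 1 else 0)" for i j
  proof -
    have "(hessian \<Phi> x ** matrix_inv (hessian \<Phi> x)) $ i $ j = mat 1 $ i $ j" by (simp only: HG_mat[OF x])
    then show ?thesis by (simp add: matrix_matrix_mult_def mat_def H_def G_def)
  qed
  show "H x i j = H x j i" for i j unfolding H_def by (rule H_sym_on[OF x])
  show "G x i j = G x j i" for i j
  proof -
    have "transpose (hessian \<Phi> x) = hessian \<Phi> x"
      using H_sym_on[OF x] by (simp add: vec_eq_iff transpose_def)
    then have "hessian \<Phi> x ** transpose (matrix_inv (hessian \<Phi> x)) = mat 1"
      by (metis GH_mat[OF x] matrix_transpose_mul transpose_mat)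
    then have "matrix_inv (hessian \<Phi> x) = transpose (matrix_inv (hessian \<Phi> x))"
      by (rule matrix_inv_eqI)
    then have "matrix_inv (hessian \<Phi> x) $ i $ j = transpose (matrix_inv (hessian \<Phi> x)) $ i $ j" by simp
    then show ?thesis by (simp add: transpose_def G_def)
  qed
  show "T x i j k = T x j i k" for i j k unfolding T_def H_def by (rule T_sym_on[OF x])
  show "T x i j k = T x i k j" for i j k unfolding T_def H_def
    by (rule partial_cong[OF open_U x]) (rule H_sym_on)
qed

lemma smooth_H_entry: "smooth_on U (\<lambda>x. H x i j)" unfolding H_def by (rule smooth_H)
lemma smooth_G_entry: "smooth_on U (\<lambda>x. G x i j)" unfolding G_def by (rule smooth_G)
lemma smooth_T: "smooth_on U (\<lambda>x. T x i j k)" unfolding T_def by (intro smooth_on_partial smooth_H_entry)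
lemma smooth_Gam: "smooth_on U (\<lambda>x. Gam x i j k)"
  unfolding Gam_def hess_gamma_def by (intro smooth_intros open_U smooth_G_entry smooth_T) simp
lemma smooth_Kup: "smooth_on U (\<lambda>x. Kup x i j k)"
  unfolding Kup_def hess_gamma_up_def Gam_def[symmetric] by (intro smooth_intros open_U smooth_G_entry smooth_Gam)

lemmas component_has_partial = smooth_on_has_partial[OF smooth_H_entry open_U] smooth_on_has_partial[OF smooth_G_entry open_U]
  smooth_on_has_partial[OF smooth_Gam open_U] smooth_on_has_partial[OF smooth_Kup open_U]

text \<open>Differentiating \<open>H G = 1\<close> gives \<open>dG = - G (dH) G\<close>, and
  \<open>G dH\<close> is twice the Christoffel symbol.\<close>

lemma G_deriv: 
  assumes x: "x \<in> U"
  shows "partial m (\<lambda>y. G y i j) x = -2 * (\<Sum>q\<in>UNIV. Gam x i m q * G x q j)"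
proof -
  interpret hessian_tensors "H x" "G x" "T x" by (rule hessian_tensors_at[OF x])
  let ?D = "\<lambda>i j. partial m (\<lambda>y. G y i j) x"
  have eq: "(\<Sum>k\<in>UNIV. H x p k * ?D k j) = - (\<Sum>k\<in>UNIV. T x m p k * G x k j)" for p
  proof -
    have "has_partial m (\<lambda>y. \<Sum>k\<in>UNIV. H y p k * G y k j) (\<Sum>k\<in>UNIV. T x m p k * G x k j + H x p k * ?D k j) x"
      unfolding T_def by (rule DERIV_sum, rule DERIV_cong, rule DERIV_mult, rule component_has_partial(1)[OF x], rule component_has_partial(2)[OF x]) simp
    moreover have "has_partial m (\<lambda>y. \<Sum>k\<in>UNIV. H y p k * G y k j) 0 x"
      by (rule has_partial_cong[OF open_U x, where g = "\<lambda>_. if p = j then 1 else 0"])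
         (use hessian_tensors.HG[OF hessian_tensors_at] in auto)
    ultimately have "(\<Sum>k\<in>UNIV. T x m p k * G x k j + H x p k * ?D k j) = 0"
      by (rule DERIV_unique)
    then show ?thesis by (simp add: sum.distrib)
  qed
  have GH: "(\<Sum>p\<in>UNIV. G x i p * H x p k) = (if i = k then 1 else 0)" for k
    using HG[of k i] by (simp add: G_sym[of i] H_sym[of _ k] mult.commute)
  have "?D i j = (\<Sum>k\<in>UNIV. (\<Sum>p\<in>UNIV. G x i p * H x p k) * ?D k j)"
    by (simp add: GH mult_delta_left)
  also have "\<dots> = (\<Sum>p\<in>UNIV. G x i p * (\<Sum>k\<in>UNIV. H x p k * ?D k j))"
    unfolding sum_distrib_left sum_distrib_right mult.assoc by (rule sum.swap)
  also have "\<dots> = - (\<Sum>p\<in>UNIV. \<Sum>k\<in>UNIV. G x i p * T x m p k * G x k j)"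
    unfolding eq by (simp add: sum_distrib_left sum_negf mult.assoc)
  also have "(\<Sum>p\<in>UNIV. \<Sum>k\<in>UNIV. G x i p * T x m p k * G x k j) = (\<Sum>k\<in>UNIV. \<Sum>p\<in>UNIV. G x i p * T x p m k * G x k j)"
    by (subst sum.swap) (simp only: T_sym12[of m])
  also have "\<dots> = 2 * (\<Sum>q\<in>UNIV. Gam x i m q * G x q j)"
    unfolding Gam_def hess_gamma_def by (simp add: sum_distrib_left sum_distrib_right sum_divide_distrib)
  finally show ?thesis by simp
qed

abbreviation "g \<equiv> toric_metric \<Phi>"
abbreviation "S \<equiv> {X. moment_part X \<in> U}"

lemma open_S: "open S" by (rule open_moment_part_vimage[OF open_U])

lemma g_component [simp]:
  "g X $ Inl i $ Inl j = H (moment_part X) i j"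
  "g X $ Inr i $ Inr j = G (moment_part X) i j"
  "g X $ Inl i $ Inr j = 0" "g X $ Inr i $ Inl j = 0"
  by (simp_all add: toric_metric_def H_def G_def)

definition ginv :: "real^(3+3) \<Rightarrow> real^(3+3)^(3+3)" where
  "ginv X = (\<chi> i j. case (i, j) of
      (Inl k, Inl l) \<Rightarrow> G (moment_part X) k l
    | (Inr k, Inr l) \<Rightarrow> H (moment_part X) k l
    | _ \<Rightarrow> 0)"

lemma ginv_component [simp]:
  "ginv X $ Inl i $ Inl j = G (moment_part X) i j"
  "ginv X $ Inr i $ Inr j = H (moment_part X) i j"
  "ginv X $ Inl i $ Inr j = 0" "ginv X $ Inr i $ Inl j = 0"
  by (simp_all add: ginv_def)

lemma GH_sum: "x \<in> U \<Longrightarrow> (\<Sum>k\<in>UNIV. G x i k * H x k j) = (if i = j then 1 else 0)"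
proof -
  assume x: "x \<in> U"
  have "(matrix_inv (hessian \<Phi> x) ** hessian \<Phi> x) $ i $ j = mat 1 $ i $ j" by (simp only: GH_mat[OF x])
  then show ?thesis by (simp add: matrix_matrix_mult_def mat_def H_def G_def)
qed

lemma matrix_inv_g:
  assumes "X \<in> S" shows "matrix_inv (g X) = ginv X"
proof (rule matrix_inv_eqI)
  have x: "moment_part X \<in> U" using assms by simp
  have "(g X ** ginv X) $ i $ j = mat 1 $ i $ j" for i j
    by (cases i; cases j)
       (simp_all add: matrix_matrix_mult_def mat_def sum_UNIV_sum_type GH_sum[OF x] hessian_tensors.HG[OF hessian_tensors_at[OF x]])
  then show "g X ** ginv X = mat 1" by (simp add: vec_eq_iff)
qed

lemma partial_g [simp]:
  "partial (Inl m) (\<lambda>Y. H (moment_part Y) i j) X = T (moment_part X) m i j"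
  "partial (Inl m) (\<lambda>Y. G (moment_part Y) i j) X = partial m (\<lambda>y. G y i j) (moment_part X)"
  "partial (Inr m) (\<lambda>Y. H (moment_part Y) i j) X = 0"
  "partial (Inr m) (\<lambda>Y. G (moment_part Y) i j) X = 0"
  "partial (Inl m) (\<lambda>Y. Gam (moment_part Y) i j k) X = partial m (\<lambda>y. Gam y i j k) (moment_part X)"
  "partial (Inr m) (\<lambda>Y. Gam (moment_part Y) i j k) X = 0"
  "partial (Inl m) (\<lambda>Y. Kup (moment_part Y) i j k) X = partial m (\<lambda>y. Kup y i j k) (moment_part X)"
  "partial (Inr m) (\<lambda>Y. Kup (moment_part Y) i j k) X = 0"
  unfolding T_def
  using partial_moment_part_Inl[of m "\<lambda>y. H y i j"] partial_moment_part_Inl[of m "\<lambda>y. G y i j"]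
   partial_moment_part_Inr[of m "\<lambda>y. H y i j"] partial_moment_part_Inr[of m "\<lambda>y. G y i j"]
   partial_moment_part_Inl[of m "\<lambda>y. Gam y i j k"] partial_moment_part_Inr[of m "\<lambda>y. Gam y i j k"]
   partial_moment_part_Inl[of m "\<lambda>y. Kup y i j k"] partial_moment_part_Inr[of m "\<lambda>y. Kup y i j k"]
  by simp_all

text \<open>The metric is block diagonal, \<open>H\<close> on moments and \<open>G\<close> on
  angles, and depends on the moments only. Symbols with an odd number of angular indices therefore
  vanish; the others are derivatives of \<open>H\<close> or \<open>G\<close> with indices
  moved.\<close>

lemma christoffel_toric:
  assumes X: "X \<in> S"
  shows "christoffel g (Inl i) (Inl j) (Inl k) X = Gam (moment_part X) i j k"
    "christoffel g (Inl i) (Inr j) (Inr k) X = Kup (moment_part X) i j k"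
    "christoffel g (Inr i) (Inl j) (Inr k) X = - Gam (moment_part X) k i j"
    "christoffel g (Inr i) (Inr j) (Inl k) X = - Gam (moment_part X) j i k"
    "christoffel g (Inr i) (Inl j) (Inl k) X = 0"
    "christoffel g (Inl i) (Inr j) (Inl k) X = 0"
    "christoffel g (Inl i) (Inl j) (Inr k) X = 0"
    "christoffel g (Inr i) (Inr j) (Inr k) X = 0"
proof -
  let ?x = "moment_part X"
  have x: "?x \<in> U" using X by simp
  interpret hessian_tensors "H ?x" "G ?x" "T ?x" by (rule hessian_tensors_at[OF x])
  note d = christoffel_def matrix_inv_g[OF X] sum_UNIV_sum_type partial_const
  \<comment> \<open>Total symmetry of \<open>T\<close> collapses the three terms of the Levi-Civita
    formula to one.\<close>
  have T: "T ?x j l k + T ?x k l j - T ?x l j k = T ?x l j k" for j l k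
    using T_sym12[of j l k] T_sym12[of k l j] T_sym23[of l k j] by simp
  show "christoffel g (Inl i) (Inl j) (Inl k) X = Gam ?x i j k"
    by (simp add: d T Gam_def hess_gamma_def)
  have "- (\<Sum>l\<in>UNIV. G ?x i l * partial l (\<lambda>y. G y j k) ?x) / 2 = Kup ?x i j k"
    by (simp add: G_deriv[OF x] Kup_def hess_gamma_up_def Gam_def sum_distrib_left sum_negf[symmetric] sum_divide_distrib G_sym[of _ k] mult_ac)
  then show "christoffel g (Inl i) (Inr j) (Inr k) X = Kup ?x i j k"
    by (simp add: d sum_negf)
  have R: "(\<Sum>l\<in>UNIV. H ?x i l * partial j (\<lambda>y. G y l k) ?x) / 2 = - Gam ?x k i j" for i j k
  proof -
    have "(\<Sum>l\<in>UNIV. H ?x i l * partial j (\<lambda>y. G y l k) ?x) / 2 = - (\<Sum>l\<in>UNIV. \<Sum>q\<in>UNIV. H ?x i l * Gam ?x l j q * G ?x q k)"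
      by (simp add: G_deriv[OF x] sum_distrib_left sum_negf[symmetric] sum_divide_distrib mult_ac)
    also have "(\<Sum>l\<in>UNIV. \<Sum>q\<in>UNIV. H ?x i l * Gam ?x l j q * G ?x q k) = (\<Sum>q\<in>UNIV. G ?x k q * T ?x q i j) / 2"
      apply (subst sum.swap)
      by (simp add: T_eq_M[of i j] T_sym12[of _ i] T_sym23[of i _ j] Gam_def sum_distrib_left sum_divide_distrib G_sym[of k] mult_ac)
    also have "\<dots> = Gam ?x k i j" unfolding Gam_def hess_gamma_def ..
    finally show ?thesis .
  qed
  show "christoffel g (Inr i) (Inl j) (Inr k) X = - Gam ?x k i j"
    using R by (simp add: d)
  show "christoffel g (Inr i) (Inr j) (Inl k) X = - Gam (moment_part X) j i k"
    using R by (simp add: d)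
qed (simp_all add: christoffel_def matrix_inv_g[OF X] sum_UNIV_sum_type partial_const)

lemma partial_christoffel:
  assumes X: "X \<in> S"
  shows "partial (Inl m) (christoffel g (Inl i) (Inl j) (Inl k)) X = partial m (\<lambda>y. Gam y i j k) (moment_part X)"
    "partial (Inl m) (christoffel g (Inl i) (Inr j) (Inr k)) X = partial m (\<lambda>y. Kup y i j k) (moment_part X)"
    "partial (Inl m) (christoffel g (Inr i) (Inl j) (Inr k)) X = - partial m (\<lambda>y. Gam y k i j) (moment_part X)"
    "partial (Inl m) (christoffel g (Inr i) (Inr j) (Inl k)) X = - partial m (\<lambda>y. Gam y j i k) (moment_part X)"
    "partial (Inr m) (christoffel g (Inl i) (Inl j) (Inl k)) X = 0"
    "partial (Inr m) (christoffel g (Inl i) (Inr j) (Inr k)) X = 0"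
    "partial s (christoffel g (Inr i) (Inl j) (Inl k)) X = 0"
    "partial s (christoffel g (Inl i) (Inr j) (Inl k)) X = 0"
    "partial s (christoffel g (Inl i) (Inl j) (Inr k)) X = 0"
    "partial s (christoffel g (Inr i) (Inr j) (Inr k)) X = 0"
proof -
  have x: "moment_part X \<in> U" using X by simp
  have m: "partial n (\<lambda>y. - Gam y i j k) (moment_part X) = - partial n (\<lambda>y. Gam y i j k) (moment_part X)" for n i j k
    by (rule partial_eqI, rule DERIV_minus, rule component_has_partial(3)[OF x])
  have c: "partial s (christoffel g (Inl i) (Inl j) (Inl k)) X = partial s (\<lambda>Y. Gam (moment_part Y) i j k) X"
    "partial s (christoffel g (Inl i) (Inr j) (Inr k)) X = partial s (\<lambda>Y. Kup (moment_part Y) i j k) X"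
    "partial s (christoffel g (Inr i) (Inl j) (Inr k)) X = partial s (\<lambda>Y. - Gam (moment_part Y) k i j) X"
    "partial s (christoffel g (Inr i) (Inr j) (Inl k)) X = partial s (\<lambda>Y. - Gam (moment_part Y) j i k) X"
    "partial s (christoffel g (Inr i) (Inl j) (Inl k)) X = partial s (\<lambda>Y. 0) X"
    "partial s (christoffel g (Inl i) (Inr j) (Inl k)) X = partial s (\<lambda>Y. 0) X"
    "partial s (christoffel g (Inl i) (Inl j) (Inr k)) X = partial s (\<lambda>Y. 0) X"
    "partial s (christoffel g (Inr i) (Inr j) (Inr k)) X = partial s (\<lambda>Y. 0) X" for s i j k
    by (rule partial_cong[OF open_S X], erule christoffel_toric)+
  show "partial (Inl m) (christoffel g (Inl i) (Inl j) (Inl k)) X = partial m (\<lambda>y. Gam y i j k) (moment_part X)"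
    by (simp add: c)
  show "partial (Inl m) (christoffel g (Inl i) (Inr j) (Inr k)) X = partial m (\<lambda>y. Kup y i j k) (moment_part X)"
    by (simp add: c)
  show "partial (Inl m) (christoffel g (Inr i) (Inl j) (Inr k)) X = - partial m (\<lambda>y. Gam y k i j) (moment_part X)"
    using partial_moment_part_Inl[of m "\<lambda>y. - Gam y k i j" X] by (simp add: c m)
  show "partial (Inl m) (christoffel g (Inr i) (Inr j) (Inl k)) X = - partial m (\<lambda>y. Gam y j i k) (moment_part X)"
    using partial_moment_part_Inl[of m "\<lambda>y. - Gam y j i k" X] by (simp add: c m)
  show "partial (Inr m) (christoffel g (Inl i) (Inl j) (Inl k)) X = 0"
    by (simp add: c)
  show "partial (Inr m) (christoffel g (Inl i) (Inr j) (Inr k)) X = 0"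
    by (simp add: c)
  show "partial s (christoffel g (Inr i) (Inl j) (Inl k)) X = 0"
    "partial s (christoffel g (Inl i) (Inr j) (Inl k)) X = 0"
    "partial s (christoffel g (Inl i) (Inl j) (Inr k)) X = 0"
    "partial s (christoffel g (Inr i) (Inr j) (Inr k)) X = 0"
    by (simp_all add: c partial_const)
qed

text \<open>Since \<open>det g = det H * det G = 1\<close>, the trace of the Christoffel symbols
  over the upper and a lower index vanishes: its moment and angular parts cancel. Only the
  divergence and one product of symbols survive in the Ricci tensor, here and in the angular
  directions.\<close>

lemma ricci_toric_Inl:
  assumes X: "X \<in> S"
  shows "ricci g (Inl j) (Inl l) X = (\<Sum>i\<in>UNIV. partial i (\<lambda>y. Gam y i l j) (moment_part X))
    - (\<Sum>i\<in>UNIV. \<Sum>m\<in>UNIV. Gam (moment_part X) i l m * Gam (moment_part X) m i j)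
    - (\<Sum>i\<in>UNIV. \<Sum>m\<in>UNIV. Gam (moment_part X) m i l * Gam (moment_part X) i m j)"
  unfolding ricci_def riemann_def
  by (simp add: sum_UNIV_sum_type christoffel_toric[OF X] partial_christoffel[OF X, simplified]
      sum.distrib sum_subtractf sum_negf)

lemma ricci_toric_Inr:
  assumes X: "X \<in> S"
  shows "ricci g (Inr j) (Inr l) X = (\<Sum>i\<in>UNIV. partial i (\<lambda>y. Kup y i l j) (moment_part X))
    + (\<Sum>i\<in>UNIV. \<Sum>m\<in>UNIV. Kup (moment_part X) i l m * Gam (moment_part X) j m i)
    + (\<Sum>i\<in>UNIV. \<Sum>m\<in>UNIV. Gam (moment_part X) l i m * Kup (moment_part X) m i j)"
  unfolding ricci_def riemann_def
  by (simp add: sum_UNIV_sum_type christoffel_toric[OF X] partial_christoffel[OF X, simplified]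
      sum.distrib sum_subtractf sum_negf)

text \<open>Abreu's formula.\<close>

lemma scalar_curvature_toric:
  assumes X: "X \<in> S"
  shows "scalar_curvature g X =
    - (\<Sum>i\<in>UNIV. partial i (\<lambda>y. \<Sum>j\<in>UNIV. partial j (\<lambda>z. matrix_inv (hessian \<Phi> z) $ i $ j) y) (moment_part X))"
proof -
  define x where "x = moment_part X"
  have x: "x \<in> U" using X by (simp add: x_def)
  interpret hessian_tensors "H x" "G x" "T x" by (rule hessian_tensors_at[OF x])
  \<comment> \<open>The divergence of \<open>G\<close> is \<open>-2 * V\<close>. Differentiating
    \<open>V\<close> in terms of \<open>G\<close> and \<open>Gam\<close> gives the moment trace of
    the Ricci tensor, and in terms of \<open>H\<close> and \<open>Kup\<close> the angular trace,
    with matching multiples of \<open>normK\<close>. So the scalar curvature is twice the divergence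
    of \<open>V\<close>.\<close>
  define V where "V i y = (\<Sum>j\<in>UNIV. \<Sum>l\<in>UNIV. G y j l * Gam y i j l)" for i y
  have V_K: "V i y = (\<Sum>j\<in>UNIV. \<Sum>l\<in>UNIV. H y j l * Kup y i j l)" if "y \<in> U" for i y
    unfolding V_def Gam_def Kup_def using hessian_tensors.trace_K[OF hessian_tensors_at[OF that]] by simp
  have V_div: "(\<Sum>j\<in>UNIV. partial j (\<lambda>z. matrix_inv (hessian \<Phi> z) $ i $ j) y) = -2 * V i y" if "y \<in> U" for i y
  proof -
    interpret y: hessian_tensors "H y" "G y" "T y" by (rule hessian_tensors_at[OF that])
    show ?thesis using G_deriv[OF that, of _ i]
      by (simp add: G_def[symmetric] V_def sum_distrib_left sum_negf[symmetric] mult.commute y.G_sym)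
  qed
  have dV: "has_partial m (V i) (\<Sum>j\<in>UNIV. \<Sum>l\<in>UNIV. partial m (\<lambda>y. G y j l) x * Gam x i j l + G x j l * partial m (\<lambda>y. Gam y i j l) x) x" for m i
    unfolding V_def
    by (rule DERIV_sum, rule DERIV_sum, rule DERIV_cong, rule DERIV_mult, rule component_has_partial(2)[OF x], rule component_has_partial(3)[OF x]) simp
  have dV': "has_partial m (V i) (\<Sum>j\<in>UNIV. \<Sum>l\<in>UNIV. T x m j l * Kup x i j l + H x j l * partial m (\<lambda>y. Kup y i j l) x) x" for m i
    by (rule has_partial_cong[OF open_U x V_K], assumption, unfold T_def,
        rule DERIV_sum, rule DERIV_sum, rule DERIV_cong, rule DERIV_mult, rule component_has_partial(1)[OF x], rule component_has_partial(4)[OF x]) simp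
  have "partial i (\<lambda>y. \<Sum>j\<in>UNIV. partial j (\<lambda>z. matrix_inv (hessian \<Phi> z) $ i $ j) y) x = -2 * partial i (V i) x" for i
    by (subst partial_cong[OF open_U x V_div], assumption, rule partial_eqI,
        rule DERIV_cmult, unfold partial_eqI[OF dV], rule dV)
  then have S: "- (\<Sum>i\<in>UNIV. partial i (\<lambda>y. \<Sum>j\<in>UNIV. partial j (\<lambda>z. matrix_inv (hessian \<Phi> z) $ i $ j) y) x)
     = (\<Sum>i\<in>UNIV. partial i (V i) x) + (\<Sum>i\<in>UNIV. partial i (V i) x)"
    by (simp add: sum_negf sum_distrib_left[symmetric])
  have A: "(\<Sum>i\<in>UNIV. partial i (V i) x) = -2 * normK + (\<Sum>i\<in>UNIV. \<Sum>j\<in>UNIV. \<Sum>l\<in>UNIV. G x j l * partial i (\<lambda>y. Gam y i j l) x)"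
    unfolding partial_eqI[OF dV] sum.distrib G_deriv[OF x] dG_contract_M[folded Gam_def, symmetric] Gam_def[symmetric] ..
  have B: "(\<Sum>i\<in>UNIV. partial i (V i) x) = 2 * normK + (\<Sum>i\<in>UNIV. \<Sum>j\<in>UNIV. \<Sum>l\<in>UNIV. H x j l * partial i (\<lambda>y. Kup y i j l) x)"
    unfolding partial_eqI[OF dV'] sum.distrib T_contract_K[symmetric] Kup_def[symmetric] ..
  have C: "(\<Sum>j\<in>UNIV. \<Sum>l\<in>UNIV. G x j l * ricci g (Inl j) (Inl l) X)
     = (\<Sum>i\<in>UNIV. \<Sum>j\<in>UNIV. \<Sum>l\<in>UNIV. G x j l * partial i (\<lambda>y. Gam y i j l) x) - normK - normK"
  proof -
    have "partial i (\<lambda>y. Gam y i l j) x = partial i (\<lambda>y. Gam y i j l) x" for i j l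
      by (rule partial_cong[OF open_U x]) (unfold Gam_def, rule hessian_tensors.M_sym[OF hessian_tensors_at])
    then have "(\<Sum>j\<in>UNIV. \<Sum>l\<in>UNIV. G x j l * (\<Sum>i\<in>UNIV. partial i (\<lambda>y. Gam y i l j) x))
      = (\<Sum>j\<in>UNIV. \<Sum>l\<in>UNIV. \<Sum>i\<in>UNIV. G x j l * partial i (\<lambda>y. Gam y i j l) x)"
      by (simp only: sum_distrib_left)
    also have "\<dots> = (\<Sum>i\<in>UNIV. \<Sum>j\<in>UNIV. \<Sum>l\<in>UNIV. G x j l * partial i (\<lambda>y. Gam y i j l) x)"
      by (rule sum_rotate3[symmetric])
    finally show ?thesis
      unfolding ricci_toric_Inl[OF X] x_def[symmetric] right_diff_distrib sum_subtractf
        G_contract_M_M[folded Gam_def] G_contract_M_M_swapped[folded Gam_def] by simp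
  qed
  have D: "(\<Sum>j\<in>UNIV. \<Sum>l\<in>UNIV. H x j l * ricci g (Inr j) (Inr l) X)
     = (\<Sum>i\<in>UNIV. \<Sum>j\<in>UNIV. \<Sum>l\<in>UNIV. H x j l * partial i (\<lambda>y. Kup y i j l) x) + normK + normK"
  proof -
    have "partial i (\<lambda>y. Kup y i l j) x = partial i (\<lambda>y. Kup y i j l) x" for i j l
      by (rule partial_cong[OF open_U x]) (unfold Kup_def, rule hessian_tensors.K_sym23[OF hessian_tensors_at])
    then have "(\<Sum>j\<in>UNIV. \<Sum>l\<in>UNIV. H x j l * (\<Sum>i\<in>UNIV. partial i (\<lambda>y. Kup y i l j) x))
      = (\<Sum>j\<in>UNIV. \<Sum>l\<in>UNIV. \<Sum>i\<in>UNIV. H x j l * partial i (\<lambda>y. Kup y i j l) x)"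
      by (simp only: sum_distrib_left)
    also have "\<dots> = (\<Sum>i\<in>UNIV. \<Sum>j\<in>UNIV. \<Sum>l\<in>UNIV. H x j l * partial i (\<lambda>y. Kup y i j l) x)"
      by (rule sum_rotate3[symmetric])
    finally show ?thesis
      unfolding ricci_toric_Inr[OF X] x_def[symmetric] distrib_left sum.distrib
        H_contract_K_M[folded Gam_def Kup_def] H_contract_M_K[folded Gam_def Kup_def] by simp
  qed
  have "scalar_curvature g X = (\<Sum>j\<in>UNIV. \<Sum>l\<in>UNIV. G x j l * ricci g (Inl j) (Inl l) X) + (\<Sum>j\<in>UNIV. \<Sum>l\<in>UNIV. H x j l * ricci g (Inr j) (Inr l) X)"
    unfolding scalar_curvature_def matrix_inv_g[OF X] by (simp add: sum_UNIV_sum_type x_def)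
  then show ?thesis using A B C D S unfolding x_def[symmetric] by linarith
qed

lemma smooth_g: "smooth_on S (\<lambda>X. g X $ i $ j)"
  by (cases i; cases j)
     (simp_all add: smooth_on_const smooth_on_moment_part[OF open_U smooth_H_entry] smooth_on_moment_part[OF open_U smooth_G_entry])

lemma g_quadratic_form:
  "v \<bullet> (g X *v v) = moment_part v \<bullet> (hessian \<Phi> (moment_part X) *v moment_part v)
     + angle_part v \<bullet> (matrix_inv (hessian \<Phi> (moment_part X)) *v angle_part v)"
  by (simp add: inner_vec_def matrix_vector_mult_def sum_UNIV_sum_type moment_part_def angle_part_def H_def G_def)

text \<open>For \<open>w = H v\<close> the form of \<open>G\<close> at \<open>w\<close> is the form
  of \<open>H\<close> at \<open>v\<close>.\<close>

lemma G_pos: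
  assumes x: "x \<in> U" and "w \<noteq> 0"
  shows "0 < w \<bullet> (matrix_inv (hessian \<Phi> x) *v w)"
proof -
  define v where "v = matrix_inv (hessian \<Phi> x) *v w"
  have w: "w = hessian \<Phi> x *v v"
    by (simp add: v_def matrix_vector_mul_assoc HG_mat[OF x])
  then have "v \<noteq> 0" using assms(2) by auto
  then have "0 < v \<bullet> (hessian \<Phi> x *v v)" by (rule H_pos[OF x])
  then show ?thesis unfolding w[symmetric] v_def[symmetric] by (simp add: inner_commute)
qed

lemma riemannian_toric: "riemannian_metric_on S g"
  unfolding riemannian_metric_on_def
proof (intro conjI allI ballI impI)
  show "smooth_on S (\<lambda>X. g X $ i $ j)" for i j by (rule smooth_g)
  fix X assume X: "X \<in> S"
  then have x: "moment_part X \<in> U" by simp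
  interpret hessian_tensors "H (moment_part X)" "G (moment_part X)" "T (moment_part X)" by (rule hessian_tensors_at[OF x])
  have "g X $ j $ i = g X $ i $ j" for i j
    by (cases i; cases j) (simp_all add: H_sym[of _ "_ :: 3"] G_sym)
  then show "transpose (g X) = g X" by (simp add: vec_eq_iff transpose_def)
  fix v :: "real^(3+3)" assume v: "v \<noteq> 0"
  then have "moment_part v \<noteq> 0 \<or> angle_part v \<noteq> 0"
    by (auto simp: vec_eq_iff moment_part_def angle_part_def split_sum_all)
  moreover have "moment_part v \<noteq> 0 \<Longrightarrow> 0 < moment_part v \<bullet> (hessian \<Phi> (moment_part X) *v moment_part v)"
    by (rule H_pos[OF x])
  moreover have "angle_part v \<noteq> 0 \<Longrightarrow> 0 < angle_part v \<bullet> (matrix_inv (hessian \<Phi> (moment_part X)) *v angle_part v)"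
    by (rule G_pos[OF x])
  ultimately show "0 < v \<bullet> (g X *v v)"
    unfolding g_quadratic_form by (cases "moment_part v = 0"; cases "angle_part v = 0") auto
qed

lemma complex_structure_toric:
  assumes X: "X \<in> S"
  shows "complex_structure omega_std g X $ Inl i $ Inl j = 0"
    "complex_structure omega_std g X $ Inr i $ Inr j = 0"
    "complex_structure omega_std g X $ Inl i $ Inr j = - G (moment_part X) i j"
    "complex_structure omega_std g X $ Inr i $ Inl j = H (moment_part X) i j"
  unfolding complex_structure_def matrix_inv_g[OF X] omega_std_def
  by (simp_all add: matrix_matrix_mult_def sum_UNIV_sum_type if_distrib[of "\<lambda>x. _ * x"] cong: if_cong)

lemma partial_complex_structure:
  assumes X: "X \<in> S"
  shows "partial s (\<lambda>Y. complex_structure omega_std g Y $ Inl i $ Inl j) X = 0"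
    "partial s (\<lambda>Y. complex_structure omega_std g Y $ Inr i $ Inr j) X = 0"
    "partial (Inl m) (\<lambda>Y. complex_structure omega_std g Y $ Inl i $ Inr j) X = - partial m (\<lambda>y. G y i j) (moment_part X)"
    "partial (Inl m) (\<lambda>Y. complex_structure omega_std g Y $ Inr i $ Inl j) X = T (moment_part X) m i j"
    "partial (Inr m) (\<lambda>Y. complex_structure omega_std g Y $ Inl i $ Inr j) X = 0"
    "partial (Inr m) (\<lambda>Y. complex_structure omega_std g Y $ Inr i $ Inl j) X = 0"
proof -
  have x: "moment_part X \<in> U" using X by simp
  have c: "partial s (\<lambda>Y. complex_structure omega_std g Y $ Inl i $ Inl j) X = partial s (\<lambda>Y. 0) X"
    "partial s (\<lambda>Y. complex_structure omega_std g Y $ Inr i $ Inr j) X = partial s (\<lambda>Y. 0) X"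
    "partial s (\<lambda>Y. complex_structure omega_std g Y $ Inl i $ Inr j) X = partial s (\<lambda>Y. - G (moment_part Y) i j) X"
    "partial s (\<lambda>Y. complex_structure omega_std g Y $ Inr i $ Inl j) X = partial s (\<lambda>Y. H (moment_part Y) i j) X" for s i j
    by (rule partial_cong[OF open_S X], erule complex_structure_toric)+
  have "partial m (\<lambda>y. - G y i j) (moment_part X) = - partial m (\<lambda>y. G y i j) (moment_part X)"
    by (rule partial_eqI, rule DERIV_minus, rule component_has_partial(2)[OF x])
  then show "partial (Inl m) (\<lambda>Y. complex_structure omega_std g Y $ Inl i $ Inr j) X = - partial m (\<lambda>y. G y i j) (moment_part X)"
    using partial_moment_part_Inl[of m "\<lambda>y. - G y i j" X] by (simp add: c)
  show "partial s (\<lambda>Y. complex_structure omega_std g Y $ Inl i $ Inl j) X = 0"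
    "partial s (\<lambda>Y. complex_structure omega_std g Y $ Inr i $ Inr j) X = 0"
    "partial (Inl m) (\<lambda>Y. complex_structure omega_std g Y $ Inr i $ Inl j) X = T (moment_part X) m i j"
    "partial (Inr m) (\<lambda>Y. complex_structure omega_std g Y $ Inr i $ Inl j) X = 0"
    by (simp_all add: c partial_const)
  show "partial (Inr m) (\<lambda>Y. complex_structure omega_std g Y $ Inl i $ Inr j) X = 0"
    using partial_moment_part_Inr[of m "\<lambda>y. - G y i j" X] by (simp add: c)
qed

text \<open>\<open>J\<close> maps moments to angles by \<open>H\<close> and angles to moments by
  \<open>- G\<close>, so \<open>J\<^sup>2 = -1\<close> is \<open>H G = 1\<close>. Of the eight index
  types of the covariant derivative four vanish by parity; the other four reduce to symmetries of
  the tensors and to raising or lowering one index.\<close>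

lemma kaehler_toric: "kaehler_metric_on S omega_std g"
  unfolding kaehler_metric_on_def
proof (intro conjI ballI allI)
  show "riemannian_metric_on S g" by (rule riemannian_toric)
  fix X assume X: "X \<in> S"
  define x where "x = moment_part X"
  have x: "x \<in> U" using X by (simp add: x_def)
  interpret hessian_tensors "H x" "G x" "T x" by (rule hessian_tensors_at[OF x])
  let ?J = "complex_structure omega_std g"
  have "(?J X ** ?J X) $ i $ j = (- mat 1) $ i $ j" for i j
    by (cases i; cases j)
       (simp_all add: matrix_matrix_mult_def sum_UNIV_sum_type complex_structure_toric[OF X]
         mat_def HG GH_sum[OF x] sum_negf flip: x_def)
  then show "?J X ** ?J X = - mat 1" by (simp add: vec_eq_iff)
  have HM: "(\<Sum>l\<in>UNIV. H x i l * Gam x l j k) = T x i j k / 2" for i j k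
    using T_eq_M[of i j k] by (simp add: Gam_def)
  have MH: "(\<Sum>l\<in>UNIV. Gam x l j k * H x l i) = T x i j k / 2" for i j k
    using HM[of i j k] by (simp add: mult.commute H_sym[of _ i])
  have HK: "(\<Sum>l\<in>UNIV. H x a l * Kup x i j l) = (\<Sum>l\<in>UNIV. G x i l * Gam x j l a)" for a i j
    using lower_K[of a i j] by (simp add: Gam_def Kup_def)
  have HK1: "(\<Sum>l\<in>UNIV. H x l a * Kup x i j l) = (\<Sum>l\<in>UNIV. G x i l * Gam x j l a)" for a i j
    using HK[of a i j] by (simp only: H_sym[of _ a])
  have HK2: "(\<Sum>l\<in>UNIV. H x a l * Kup x l j i) = (\<Sum>l\<in>UNIV. G x l i * Gam x j a l)" for a i j
  proof -
    have "Kup x l j i = Kup x i j l" "Gam x j a l = Gam x j l a" for l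
      unfolding Kup_def Gam_def by (rule K_sym13, rule M_sym)
    then show ?thesis using HK[of a i j] by (simp only: G_sym[of _ i])
  qed
  have MG: "(\<Sum>l\<in>UNIV. Gam x i k l * G x l j) = (\<Sum>l\<in>UNIV. G x i l * Gam x j l k)" for i j k
    using MG_swap[of i k j] M_sym[of j] by (simp add: Gam_def mult.commute G_sym[of _ i])
  show "partial k (\<lambda>y. ?J y $ i $ j) X
         + (\<Sum>l\<in>UNIV. christoffel g i k l X * ?J X $ l $ j - christoffel g l k j X * ?J X $ i $ l) = 0" for i j k
  proof (cases k; cases i; cases j)
    fix k' i' j' assume [simp]: "k = Inl k'" "i = Inl i'" "j = Inl j'"
    show ?thesis by (simp add: sum_UNIV_sum_type complex_structure_toric[OF X] partial_complex_structure[OF X, simplified] christoffel_toric[OF X])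
  next
    fix k' i' j' assume [simp]: "k = Inl k'" "i = Inl i'" "j = Inr j'"
    show ?thesis using MG[of i' k' j']
      by (simp add: sum_UNIV_sum_type complex_structure_toric[OF X] partial_complex_structure[OF X, simplified] christoffel_toric[OF X]
         G_deriv[OF x] sum_negf sum_subtractf mult.commute flip: x_def)
  next
    fix k' i' j' assume [simp]: "k = Inl k'" "i = Inr i'" "j = Inl j'"
    show ?thesis using MH[of i' k' j'] HM[of i' k' j'] T_sym12[of j' i' k'] T_sym12[of k' i' j'] T_sym23[of i' j' k']
      by (simp add: sum_UNIV_sum_type complex_structure_toric[OF X] partial_complex_structure[OF X, simplified] christoffel_toric[OF X]
         sum_negf sum_subtractf mult.commute flip: x_def)
  next
    fix k' i' j' assume [simp]: "k = Inl k'" "i = Inr i'" "j = Inr j'"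
    show ?thesis by (simp add: sum_UNIV_sum_type complex_structure_toric[OF X] partial_complex_structure[OF X, simplified] christoffel_toric[OF X])
  next
    fix k' i' j' assume [simp]: "k = Inr k'" "i = Inl i'" "j = Inl j'"
    show ?thesis using HK1[of j' i' k']
      by (simp add: sum_UNIV_sum_type complex_structure_toric[OF X] partial_complex_structure[OF X, simplified] christoffel_toric[OF X]
         sum_negf sum_subtractf mult.commute flip: x_def)
  next
    fix k' i' j' assume [simp]: "k = Inr k'" "i = Inl i'" "j = Inr j'"
    show ?thesis by (simp add: sum_UNIV_sum_type complex_structure_toric[OF X] partial_complex_structure[OF X, simplified] christoffel_toric[OF X])
  next
    fix k' i' j' assume [simp]: "k = Inr k'" "i = Inr i'" "j = Inl j'"
    show ?thesis by (simp add: sum_UNIV_sum_type complex_structure_toric[OF X] partial_complex_structure[OF X, simplified] christoffel_toric[OF X])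
  next
    fix k' i' j' assume [simp]: "k = Inr k'" "i = Inr i'" "j = Inr j'"
    show ?thesis using HK2[of i' k' j']
      by (simp add: sum_UNIV_sum_type complex_structure_toric[OF X] partial_complex_structure[OF X, simplified] christoffel_toric[OF X]
         sum_negf sum_subtractf mult.commute flip: x_def)
  qed
qed

end

section \<open>The potential\<close>

lemma line_inner: "n \<bullet> (x + t *\<^sub>R axis i 1) = n \<bullet> x + t * n $ i"
  by (simp add: inner_add_right inner_axis)

lemma has_partial_of_component:
  assumes "(f has_real_derivative D) (at (x $ j))"
  shows "has_partial i (\<lambda>x. f (x $ j)) (if i = j then D else 0) x"
proof (cases "i = j")
  case True
  have "((\<lambda>t. f (x $ j + t)) has_real_derivative D) (at 0)"
    using assms by (subst (asm) DERIV_shift[of f D 0 "x $ j", simplified]) (simp add: add.commute)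
  then show ?thesis using True by (simp add: axis_def)
qed (simp add: axis_def)

text \<open>Guillemin's canonical potential for affine functions positive on \<open>U\<close>, plus
  a function of one coordinate. Derivatives up to order three are supplied because the symmetry of
  the third derivatives is read off their formula.\<close>

locale guillemin_potential =
  fixes U :: "(real^'n::finite) set" and I :: "'r set" and n :: "'r \<Rightarrow> real^'n" and l :: "'r \<Rightarrow> real"
    and f f1 f2 f3 :: "real \<Rightarrow> real" and e :: 'n
  assumes open_U: "open U" and pos: "\<And>r x. r \<in> I \<Longrightarrow> x \<in> U \<Longrightarrow> 0 < n r \<bullet> x + l r"
    and f: "\<And>x. x \<in> U \<Longrightarrow> (f has_real_derivative f1 (x $ e)) (at (x $ e))"
    and f1: "\<And>x. x \<in> U \<Longrightarrow> (f1 has_real_derivative f2 (x $ e)) (at (x $ e))"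
    and f2: "\<And>x. x \<in> U \<Longrightarrow> (f2 has_real_derivative f3 (x $ e)) (at (x $ e))"
begin

definition "pot x = (\<Sum>r\<in>I. (n r \<bullet> x + l r) * ln (n r \<bullet> x + l r)) / 2 + f (x $ e)"

lemma partial_pot:
  assumes x: "x \<in> U"
  shows "partial i pot x = (\<Sum>r\<in>I. n r $ i * (ln (n r \<bullet> x + l r) + 1)) / 2 + (if i = e then f1 (x $ e) else 0)"
proof (rule partial_eqI)
  have "has_partial i (\<lambda>x. (n r \<bullet> x + l r) * ln (n r \<bullet> x + l r)) (n r $ i * (ln (n r \<bullet> x + l r) + 1)) x"
    if "r \<in> I" for r
  proof -
    have "((\<lambda>y. y * ln y) has_real_derivative ln y + 1) (at y)" if "0 < y" for y :: real
      using that by (auto intro!: derivative_eq_intros)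
    from this[OF pos[OF that x]]
    have "((\<lambda>y. y * ln y) has_real_derivative ln (n r \<bullet> x + l r) + 1) (at (n r \<bullet> (x + 0 *\<^sub>R axis i 1) + l r))"
      by simp
    moreover have "has_partial i (\<lambda>x. n r \<bullet> x + l r) (n r $ i) x"
      unfolding line_inner by (auto intro!: derivative_eq_intros)
    ultimately show ?thesis
      by (rule DERIV_cong[OF DERIV_chain2]) (rule mult.commute)
  qed
  then show "has_partial i pot ((\<Sum>r\<in>I. n r $ i * (ln (n r \<bullet> x + l r) + 1)) / 2 + (if i = e then f1 (x $ e) else 0)) x"
    unfolding pot_def
    by (intro DERIV_add DERIV_cdivide DERIV_sum has_partial_of_component f x)
qed

lemma hessian_pot:
  assumes x: "x \<in> U"
  shows "hessian pot x $ i $ j = (\<Sum>r\<in>I. n r $ i * n r $ j / (n r \<bullet> x + l r)) / 2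
    + (if i = e \<and> j = e then f2 (x $ e) else 0)"
proof -
  have 1: "has_partial i (\<lambda>x. n r $ j * (ln (n r \<bullet> x + l r) + 1)) (n r $ i * n r $ j / (n r \<bullet> x + l r)) x"
    if "r \<in> I" for r
    unfolding line_inner using pos[OF that x]
    by (auto intro!: derivative_eq_intros simp: field_simps)
  have 2: "has_partial i (\<lambda>x. if j = e then f1 (x $ e) else 0) (if i = e \<and> j = e then f2 (x $ e) else 0) x"
    using has_partial_of_component[OF f1[OF x], of i] by (cases "j = e") simp_all
  have "hessian pot x $ i $ j = partial i (partial j pot) x" by (simp add: hessian_def)
  also have "\<dots> = partial i (\<lambda>x. (\<Sum>r\<in>I. n r $ j * (ln (n r \<bullet> x + l r) + 1)) / 2 + (if j = e then f1 (x $ e) else 0)) x"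
    by (rule partial_cong[OF open_U x partial_pot])
  also have "\<dots> = (\<Sum>r\<in>I. n r $ i * n r $ j / (n r \<bullet> x + l r)) / 2 + (if i = e \<and> j = e then f2 (x $ e) else 0)"
    by (intro partial_eqI DERIV_add DERIV_cdivide DERIV_sum 1 2)
  finally show ?thesis .
qed

lemma partial_hessian_pot:
  assumes x: "x \<in> U"
  shows "partial k (\<lambda>y. hessian pot y $ i $ j) x = (\<Sum>r\<in>I. - (n r $ i * n r $ j * n r $ k / (n r \<bullet> x + l r)\<^sup>2)) / 2
    + (if k = e \<and> i = e \<and> j = e then f3 (x $ e) else 0)"
proof -
  have 1: "has_partial k (\<lambda>x. n r $ i * n r $ j / (n r \<bullet> x + l r)) (- (n r $ i * n r $ j * n r $ k / (n r \<bullet> x + l r)\<^sup>2)) x"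
    if "r \<in> I" for r
    unfolding line_inner using pos[OF that x]
    by (auto intro!: derivative_eq_intros simp: field_simps power2_eq_square)
  have 2: "has_partial k (\<lambda>x. if i = e \<and> j = e then f2 (x $ e) else 0) (if k = e \<and> i = e \<and> j = e then f3 (x $ e) else 0) x"
    using has_partial_of_component[OF f2[OF x], of k] by (cases "i = e \<and> j = e") auto
  have "partial k (\<lambda>y. hessian pot y $ i $ j) x = partial k (\<lambda>x. (\<Sum>r\<in>I. n r $ i * n r $ j / (n r \<bullet> x + l r)) / 2
    + (if i = e \<and> j = e then f2 (x $ e) else 0)) x"
    by (rule partial_cong[OF open_U x hessian_pot])
  also have "\<dots> = (\<Sum>r\<in>I. - (n r $ i * n r $ j * n r $ k / (n r \<bullet> x + l r)\<^sup>2)) / 2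
    + (if k = e \<and> i = e \<and> j = e then f3 (x $ e) else 0)"
    by (intro partial_eqI DERIV_add DERIV_cdivide DERIV_sum 1 2)
  finally show ?thesis .
qed

lemma hessian_pot_sym: "x \<in> U \<Longrightarrow> hessian pot x $ i $ j = hessian pot x $ j $ i"
  unfolding hessian_pot by (auto simp: mult.commute)

lemma partial_hessian_pot_sym:
  "x \<in> U \<Longrightarrow> partial i (\<lambda>y. hessian pot y $ j $ k) x = partial j (\<lambda>y. hessian pot y $ i $ k) x"
  unfolding partial_hessian_pot by (auto simp: mult_ac)

end

text \<open>The metric depends on \<open>f\<close> through \<open>f''\<close> alone, so two
  integrations with arbitrary constants produce it. The auxiliary claim includes continuity up to
  the ends, which permits the second integration.\<close>

lemma real_second_antiderivative:
  fixes r :: "real \<Rightarrow> real"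
  assumes "continuous_on {a..b} r" 
  obtains f f1 where "\<And>x. a < x \<Longrightarrow> x < b \<Longrightarrow> (f has_real_derivative f1 x) (at x)"
    "\<And>x. a < x \<Longrightarrow> x < b \<Longrightarrow> (f1 has_real_derivative r x) (at x)"
proof -
  have I: "\<exists>F. continuous_on {a..b} F \<and> (\<forall>x. a < x \<and> x < b \<longrightarrow> (F has_real_derivative r x) (at x))"
    if r: "continuous_on {a..b} r" for r :: "real \<Rightarrow> real"
  proof (intro exI conjI allI impI)
    have d: "((\<lambda>x. integral {a..x} r) has_real_derivative r x) (at x within {a..b})" if "x \<in> {a..b}" for x
      by (rule integral_has_real_derivative[OF r that])
    show "continuous_on {a..b} (\<lambda>x. integral {a..x} r)"
      using d by (meson DERIV_continuous continuous_on_eq_continuous_within)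
    show "((\<lambda>x. integral {a..x} r) has_real_derivative r x) (at x)" if "a < x \<and> x < b" for x
      using d[of x] that at_within_Icc_at[of a x b] by simp
  qed
  obtain f1 where f1: "continuous_on {a..b} f1" "\<And>x. a < x \<Longrightarrow> x < b \<Longrightarrow> (f1 has_real_derivative r x) (at x)"
    using I[OF assms] by blast
  obtain f where "\<And>x. a < x \<Longrightarrow> x < b \<Longrightarrow> (f has_real_derivative f1 x) (at x)"
    using I[OF f1(1)] by blast
  then show ?thesis using f1(2) that by blast
qed

section \<open>The Hessian and its inverse in block form\<close>

text \<open>Here \<open>p, p'\<close> and \<open>q, q'\<close> are the values of two pairs of
  opposite facet functions. The corner entry makes \<open>1 / h\<close> the Schur complement of the
  diagonal lower block; equivalently, \<open>h\<close> is the corner of the inverse.\<close>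

definition hess_block :: "real \<Rightarrow> real \<Rightarrow> real \<Rightarrow> real \<Rightarrow> real \<Rightarrow> real^3^3" where
  "hess_block h p p' q q' = vector [
     vector [1 / h + p / (2 * p' * (p + p')) + q / (2 * q' * (q + q')), 1 / (2 * p'), - 1 / (2 * q')],
     vector [1 / (2 * p'), (1 / p + 1 / p') / 2, 0],
     vector [- 1 / (2 * q'), 0, (1 / q + 1 / q') / 2]]"

definition hess_inv_block :: "real \<Rightarrow> real \<Rightarrow> real \<Rightarrow> real \<Rightarrow> real \<Rightarrow> real^3^3" where
  "hess_inv_block h p p' q q' = vector [
     vector [h, - h * p / (p + p'), h * q / (q + q')],
     vector [- h * p / (p + p'), 2 * p * p' / (p + p') + h * p\<^sup>2 / (p + p')\<^sup>2, - h * p * q / ((p + p') * (q + q'))],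
     vector [h * q / (q + q'), - h * p * q / ((p + p') * (q + q')), 2 * q * q' / (q + q') + h * q\<^sup>2 / (q + q')\<^sup>2]]"

lemma hess_block_inverse:
  assumes "h > 0" "p > 0" "p' > 0" "q > 0" "q' > 0"
  shows "hess_block h p p' q q' ** hess_inv_block h p p' q q' = mat 1"
proof -
  define s where "s = p + p'"
  define t where "t = q + q'"
  have nz: "h \<noteq> 0" "p \<noteq> 0" "p' \<noteq> 0" "q \<noteq> 0" "q' \<noteq> 0" "s \<noteq> 0" "t \<noteq> 0"
    using assms unfolding s_def t_def by auto
  have *: "(1 / p + 1 / p') / 2 = s / (2 * p * p')" "(1 / q + 1 / q') / 2 = t / (2 * q * q')"
    using nz by (simp_all add: s_def t_def field_simps)
  show ?thesis
    unfolding hess_block_def hess_inv_block_def * unfolding s_def[symmetric] t_def[symmetric]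
    unfolding vec_eq_iff forall_3 matrix_matrix_mult_def sum_3 mat_def
    using nz by (simp add: divide_simps) (simp add: algebra_simps power2_eq_square)
qed

lemma smooth_hess_block:
  assumes S: "open S" and sm: "smooth_on S h" "smooth_on S p" "smooth_on S p'" "smooth_on S q" "smooth_on S q'"
    and pos: "\<And>x. x \<in> S \<Longrightarrow> 0 < h x \<and> 0 < p x \<and> 0 < p' x \<and> 0 < q x \<and> 0 < q' x"
  shows "smooth_on S (\<lambda>x. hess_block (h x) (p x) (p' x) (q x) (q' x) $ i $ j)"
    "smooth_on S (\<lambda>x. hess_inv_block (h x) (p x) (p' x) (q x) (q' x) $ i $ j)"
proof -
  have nz: "h x \<noteq> 0" "p x \<noteq> 0" "p' x \<noteq> 0" "q x \<noteq> 0" "q' x \<noteq> 0" "p x + p' x \<noteq> 0" "q x + q' x \<noteq> 0"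
    if "x \<in> S" for x
    using pos[OF that] by auto
  show "smooth_on S (\<lambda>x. hess_block (h x) (p x) (p' x) (q x) (q' x) $ i $ j)"
    using exhaust_3[of i] exhaust_3[of j] unfolding hess_block_def
    by (elim disjE) (simp_all only: vector_3, (intro smooth_intros S sm; simp add: nz)+)
  show "smooth_on S (\<lambda>x. hess_inv_block (h x) (p x) (p' x) (q x) (q' x) $ i $ j)"
    using exhaust_3[of i] exhaust_3[of j] unfolding hess_inv_block_def
    by (elim disjE) (simp_all only: vector_3, (intro smooth_intros S sm; simp add: nz)+)
qed

text \<open>Completion of squares. With \<open>p + p' = A\<close> and \<open>q + q' = C\<close>, the
  last two squares are those of \<open>A d(p / A)\<close> and \<open>C d(q / C)\<close>: the moment
  parts of two round spheres.\<close>

lemma hess_block_form: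
  assumes "h > 0" "p > 0" "p' > 0" "q > 0" "q' > 0"
  shows "v \<bullet> (hess_block h p p' q q' *v v) = (v $ 1)\<^sup>2 / h
     + (p + p') / (2 * p * p') * (v $ 2 + p / (p + p') * v $ 1)\<^sup>2
     + (q + q') / (2 * q * q') * (v $ 3 - q / (q + q') * v $ 1)\<^sup>2"
proof -
  define s where "s = p + p'"
  define t where "t = q + q'"
  have p': "p' = s - p" "q' = t - q" by (simp_all add: s_def t_def)
  have nz: "h \<noteq> 0" "p \<noteq> 0" "s - p \<noteq> 0" "q \<noteq> 0" "t - q \<noteq> 0" "s \<noteq> 0" "t \<noteq> 0"
    using assms unfolding s_def t_def by auto
  have *: "(1 / p + 1 / (s - p)) / 2 = s / (2 * p * (s - p))" "(1 / q + 1 / (t - q)) / 2 = t / (2 * q * (t - q))"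
    using nz by (simp_all add: field_simps)
  have 1: "x * x * (p / (2 * (s - p) * s)) + 2 * x * y / (2 * (s - p)) + y * y * (s / (2 * p * (s - p)))
     = s / (2 * p * (s - p)) * (y + p / s * x)\<^sup>2" for x y
    using nz by (simp add: divide_simps) (simp add: algebra_simps power2_eq_square)
  have 2: "x * x * (q / (2 * (t - q) * t)) - 2 * x * y / (2 * (t - q)) + y * y * (t / (2 * q * (t - q)))
     = t / (2 * q * (t - q)) * (y - q / t * x)\<^sup>2" for x y
    using nz by (simp add: divide_simps) (simp add: algebra_simps power2_eq_square)
  have "v \<bullet> (hess_block h p p' q q' *v v) = v $ 1 * v $ 1 / h
    + (v $ 1 * v $ 1 * (p / (2 * (s - p) * s)) + 2 * v $ 1 * v $ 2 / (2 * (s - p)) + v $ 2 * v $ 2 * (s / (2 * p * (s - p))))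
    + (v $ 1 * v $ 1 * (q / (2 * (t - q) * t)) - 2 * v $ 1 * v $ 3 / (2 * (t - q)) + v $ 3 * v $ 3 * (t / (2 * q * (t - q))))"
    unfolding hess_block_def p' 
    by (simp add: inner_vec_def matrix_vector_mult_def sum_3 *) (simp add: algebra_simps)
  then show ?thesis unfolding 1 2 p' by (simp add: power2_eq_square)
qed

text \<open>The inverse is a diagonal matrix plus \<open>h\<close> times the square of the vector
  \<open>(1, - p / (p + p'), q / (q + q'))\<close>, whose entries are the coefficients of the
  connection form.\<close>

lemma hess_inv_block_form:
  assumes "p + p' > 0" "q + q' > 0"
  shows "v \<bullet> (hess_inv_block h p p' q q' *v v) = h * (v $ 1 - p / (p + p') * v $ 2 + q / (q + q') * v $ 3)\<^sup>2
     + 2 * p * p' / (p + p') * (v $ 2)\<^sup>2 + 2 * q * q' / (q + q') * (v $ 3)\<^sup>2"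
proof -
  define s where "s = p + p'"
  define t where "t = q + q'"
  have nz: "s \<noteq> 0" "t \<noteq> 0" using assms unfolding s_def t_def by auto
  show ?thesis
    unfolding hess_inv_block_def s_def[symmetric] t_def[symmetric] using nz
    by (simp add: inner_vec_def matrix_vector_mult_def sum_3) (simp add: field_simps power2_eq_square)
qed

lemma hess_block_pos:
  assumes "h > 0" "p > 0" "p' > 0" "q > 0" "q' > 0" "v \<noteq> 0"
  shows "0 < v \<bullet> (hess_block h p p' q q' *v v)"
proof (rule ccontr)
  assume "\<not> ?thesis"
  then have *: "(v $ 1)\<^sup>2 / h + (p + p') / (2 * p * p') * (v $ 2 + p / (p + p') * v $ 1)\<^sup>2
     + (q + q') / (2 * q * q') * (v $ 3 - q / (q + q') * v $ 1)\<^sup>2 \<le> 0"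
    using hess_block_form[OF assms(1-5), of v] by simp
  have nn: "0 \<le> (v $ 1)\<^sup>2 / h" "0 \<le> (p + p') / (2 * p * p') * (v $ 2 + p / (p + p') * v $ 1)\<^sup>2"
     "0 \<le> (q + q') / (2 * q * q') * (v $ 3 - q / (q + q') * v $ 1)\<^sup>2"
    using assms by auto
  have "(v $ 1)\<^sup>2 / h = 0" using * nn by linarith
  then have 1: "v $ 1 = 0" using assms by simp
  have "(p + p') / (2 * p * p') * (v $ 2 + p / (p + p') * v $ 1)\<^sup>2 = 0"
    "(q + q') / (2 * q * q') * (v $ 3 - q / (q + q') * v $ 1)\<^sup>2 = 0" using * nn by linarith+
  then have "v $ 2 = 0" "v $ 3 = 0" using assms 1 by auto
  then have "v = 0" using 1 by (simp add: vec_eq_iff forall_3)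
  then show False using assms by simp
qed

text \<open>The interior of the polytope lies in the interior of each bounding half-space, which is
  the open half-space because the normal is nonzero.\<close>

lemma interior_polytope_M:
  assumes "x \<in> interior (polytope_M a c)"
  shows "-1 < x $ 1" "x $ 1 < 1" "-1 < x $ 2" "-1 < x $ 3" "x $ 1 + x $ 2 < a" "x $ 3 - x $ 1 < c"
proof -
  have half: "n \<bullet> x < b" if "polytope_M a c \<subseteq> {y. n \<bullet> y \<le> b}" "n \<noteq> 0" for n b
    using interior_mono[OF that(1)] interior_halfspace_le[OF that(2), of b] assms by auto
  have i: "vector [p, q, r] \<bullet> y = p * y $ 1 + q * y $ 2 + r * y $ 3" for p q r and y :: "real^3"
    by (simp add: inner_vec_def sum_3)
  have nz: "vector [p, q, r] \<noteq> (0 :: real^3)" if "p \<noteq> 0 \<or> q \<noteq> 0 \<or> r \<noteq> 0" for p q r :: real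
    using that by (auto simp: vec_eq_iff forall_3)
  show "-1 < x $ 1" using half[of "vector [-1, 0, 0]" 1] by (auto simp: i nz polytope_M_def)
  show "x $ 1 < 1" using half[of "vector [1, 0, 0]" 1] by (auto simp: i nz polytope_M_def)
  show "-1 < x $ 2" using half[of "vector [0, -1, 0]" 1] by (auto simp: i nz polytope_M_def)
  show "-1 < x $ 3" using half[of "vector [0, 0, -1]" 1] by (auto simp: i nz polytope_M_def)
  show "x $ 1 + x $ 2 < a" using half[of "vector [1, 1, 0]" a] by (auto simp: i nz polytope_M_def)
  show "x $ 3 - x $ 1 < c" using half[of "vector [-1, 0, 1]" c] by (auto simp: i nz polytope_M_def)
qed

lemma sum_3_bool: "(\<Sum>r\<in>(UNIV :: (3 \<times> bool) set). h r) =
    h (1, False) + h (1, True) + h (2, False) + h (2, True) + h (3, False) + h (3, True)"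
  unfolding UNIV_Times_UNIV[symmetric] sum.cartesian_product' by (simp add: sum_3 UNIV_bool add.assoc)

section \<open>The momentum profile and its potential\<close>

locale profile =
  fixes a c \<mu> :: real
  assumes a_pos: "a > 0" and c_pos: "c > 0" and mu: "\<mu> > -1"
begin

text \<open>\<open>hh\<close> is the entry \<open>G\<^sub>1\<^sub>1\<close> of the inverse Hessian, and \<open>rr\<close> is the second derivative of \<open>f\<close>.\<close>

definition "LA s = a + 1 - s"
definition "LC s = c + 1 + s"
definition "PP s = LA s * LC s + \<mu> * (1 - s\<^sup>2)"
definition "hh s = (1 - s\<^sup>2) * PP s / (LA s * LC s)"
definition "rr s = - \<mu> / PP s - 1 / (2 * LA s) - 1 / (2 * LC s)"

lemma LA_pos: "s \<le> 1 \<Longrightarrow> 0 < LA s" unfolding LA_def using a_pos by simp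
lemma LC_pos: "-1 \<le> s \<Longrightarrow> 0 < LC s" unfolding LC_def using c_pos by simp

lemma PP_pos:
  assumes "-1 \<le> s" "s \<le> 1"
  shows "0 < PP s"
proof -
  \<comment> \<open>\<open>LA s * LC s\<close> has leading coefficient -1, so it is the chord
    through its values at -1 and 1 plus \<open>1 - s\<^sup>2\<close>. This is where
    \<open>\<mu> > -1\<close> enters.\<close>
  have "PP s = (1 + s) / 2 * (a * (c + 2)) + (1 - s) / 2 * ((a + 2) * c) + (1 + \<mu>) * (1 - s\<^sup>2)"
    unfolding PP_def LA_def LC_def by (simp add: field_simps power2_eq_square)
  moreover have "0 \<le> (1 + s) / 2 * (a * (c + 2))" "0 \<le> (1 - s) / 2 * ((a + 2) * c)"
    using assms a_pos c_pos by auto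
  moreover have "0 < (1 + s) / 2 * (a * (c + 2)) \<or> 0 < (1 - s) / 2 * ((a + 2) * c)"
    using assms a_pos c_pos by (cases "s < 1") auto
  moreover have "0 \<le> (1 + \<mu>) * (1 - s\<^sup>2)"
    using assms mu by (simp add: abs_square_le_1)
  ultimately show ?thesis by linarith
qed

lemma hh_pos:
  assumes "-1 < s" "s < 1" shows "0 < hh s"
  unfolding hh_def using assms PP_pos[of s] LA_pos[of s] LC_pos[of s] by (simp add: abs_square_less_1)

text \<open>Because \<open>PP s - \<mu> * (1 - s\<^sup>2) = LA s * LC s\<close>, subtracting
  \<open>\<mu> / PP s\<close> from \<open>1 / (1 - s\<^sup>2)\<close> leaves
  \<open>1 / hh s\<close>. So the poles of \<open>1 / hh\<close> at -1 and 1 are those of the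
  canonical potential, and \<open>rr\<close> has none there.\<close>

lemma rr_eq:
  assumes "-1 < s" "s < 1"
  shows "1 / (1 + s) / 2 + 1 / (1 - s) / 2 + rr s + 1 / (2 * LA s) + 1 / (2 * LC s) = 1 / hh s"
proof -
  have nz: "PP s \<noteq> 0" "LA s \<noteq> 0" "LC s \<noteq> 0" "1 + s \<noteq> 0" "1 - s \<noteq> 0" "1 - s\<^sup>2 \<noteq> 0"
    using assms PP_pos[of s] LA_pos[of s] LC_pos[of s] by (auto simp: power2_eq_1_iff)
  have "1 / (1 + s) / 2 + 1 / (1 - s) / 2 = 1 / (1 - s\<^sup>2)"
    using nz by (simp add: field_simps power2_eq_square)
  moreover have "1 / (1 - s\<^sup>2) - \<mu> / PP s = 1 / hh s"
    unfolding hh_def using nz by (simp add: field_simps) (simp add: PP_def algebra_simps)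
  ultimately show ?thesis unfolding rr_def by simp
qed

abbreviation "U \<equiv> interior (polytope_M a c)"

definition hmat :: "real^3 \<Rightarrow> real^3^3" where
  "hmat x = hess_block (hh (x $ 1)) (1 + x $ 2) (a - x $ 1 - x $ 2) (1 + x $ 3) (c + x $ 1 - x $ 3)"

definition gmat :: "real^3 \<Rightarrow> real^3^3" where
  "gmat x = hess_inv_block (hh (x $ 1)) (1 + x $ 2) (a - x $ 1 - x $ 2) (1 + x $ 3) (c + x $ 1 - x $ 3)"

lemma U_pos:
  assumes "x \<in> U"
  shows "0 < hh (x $ 1)" "0 < 1 + x $ 2" "0 < a - x $ 1 - x $ 2" "0 < 1 + x $ 3" "0 < c + x $ 1 - x $ 3"
    "0 < 1 + x $ 1" "0 < 1 - x $ 1"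
  using interior_polytope_M[OF assms] hh_pos by auto

end

locale profile_potential = profile +
  fixes f f1 :: "real \<Rightarrow> real"
  assumes f_deriv: "-1 < s \<Longrightarrow> s < 1 \<Longrightarrow> (f has_real_derivative f1 s) (at s)"
    and f1_deriv: "-1 < s \<Longrightarrow> s < 1 \<Longrightarrow> (f1 has_real_derivative rr s) (at s)"
begin

definition "rr' s = \<mu> * (LA s - LC s - 2 * \<mu> * s) / (PP s)\<^sup>2 - 1 / (2 * (LA s)\<^sup>2) + 1 / (2 * (LC s)\<^sup>2)"

lemma rr_deriv:
  assumes "-1 < s" "s < 1"
  shows "(rr has_real_derivative rr' s) (at s)"
proof -
  have nz: "PP s \<noteq> 0" "LA s \<noteq> 0" "LC s \<noteq> 0"
    using assms PP_pos[of s] LA_pos[of s] LC_pos[of s] by auto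
  have A: "(LA has_real_derivative -1) (at s)" unfolding LA_def[abs_def] by (auto intro!: derivative_eq_intros)
  have C: "(LC has_real_derivative 1) (at s)" unfolding LC_def[abs_def] by (auto intro!: derivative_eq_intros)
  have P: "(PP has_real_derivative (LA s - LC s - 2 * \<mu> * s)) (at s)"
    unfolding PP_def[abs_def] by (auto intro!: derivative_eq_intros A C)
  have 1: "((\<lambda>s. - \<mu> / PP s) has_real_derivative \<mu> * (LA s - LC s - 2 * \<mu> * s) / (PP s)\<^sup>2) (at s)"
    using nz by (auto intro!: derivative_eq_intros P simp: power2_eq_square)
  have 2: "((\<lambda>s. 1 / (2 * LA s)) has_real_derivative 1 / (2 * (LA s)\<^sup>2)) (at s)"
    using nz by (auto intro!: derivative_eq_intros A simp: power2_eq_square)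
  have 3: "((\<lambda>s. 1 / (2 * LC s)) has_real_derivative - (1 / (2 * (LC s)\<^sup>2))) (at s)"
    using nz by (auto intro!: derivative_eq_intros C simp: power2_eq_square)
  show ?thesis unfolding rr_def[abs_def] rr'_def using DERIV_diff[OF DERIV_diff[OF 1 2] 3] by simp
qed

definition "\<Phi> = (\<lambda>x. Phi0 a c x + f (x $ 1))"
text \<open>The six facets are indexed by direction and side. Row \<open>k\<close> of
  \<open>normals b\<close> depends on \<open>b k\<close> only, so constant choices reach every
  facet.\<close>

definition nvec :: "3 \<times> bool \<Rightarrow> real^3" where "nvec = (\<lambda>(k, b). normals (\<lambda>_. b) $ k)"
definition lvec :: "3 \<times> bool \<Rightarrow> real" where "lvec = (\<lambda>(k, b). facets a c (\<lambda>_. b) 0 $ k)"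

lemma facet_values:
  "nvec (1, False) \<bullet> x + lvec (1, False) = 1 + x $ 1" "nvec (1, True) \<bullet> x + lvec (1, True) = 1 - x $ 1"
  "nvec (2, False) \<bullet> x + lvec (2, False) = 1 + x $ 2" "nvec (2, True) \<bullet> x + lvec (2, True) = a - x $ 1 - x $ 2"
  "nvec (3, False) \<bullet> x + lvec (3, False) = 1 + x $ 3" "nvec (3, True) \<bullet> x + lvec (3, True) = c + x $ 1 - x $ 3"
  by (simp_all add: nvec_def lvec_def facets_def normals_def inner_vec_def sum_3)

sublocale pot: guillemin_potential U UNIV nvec lvec f f1 rr rr' 1
proof
  show "open U" by simp
  fix x assume x: "x \<in> U"
  note i = interior_polytope_M[OF x]
  show "(f has_real_derivative f1 (x $ 1)) (at (x $ 1))" using i by (intro f_deriv)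
  show "(f1 has_real_derivative rr (x $ 1)) (at (x $ 1))" using i by (intro f1_deriv)
  show "(rr has_real_derivative rr' (x $ 1)) (at (x $ 1))" using i by (intro rr_deriv)
  fix r :: "3 \<times> bool"
  obtain k b where r: "r = (k, b)" by fastforce
  show "0 < nvec r \<bullet> x + lvec r"
    using U_pos[OF x] exhaust_3[of k] unfolding r by (cases b) (auto simp: facet_values)
qed

lemma pot_eq: "pot.pot = \<Phi>"
  unfolding pot.pot_def[abs_def] \<Phi>_def Phi0_def sum_3_bool facet_values by (simp add: add_ac)

lemma hessian_eq:
  assumes x: "x \<in> U"
  shows "hessian \<Phi> x = hmat x"
proof -
  note p = U_pos[OF x]
  have LA: "LA (x $ 1) = 1 + x $ 2 + (a - x $ 1 - x $ 2)" and LC: "LC (x $ 1) = 1 + x $ 3 + (c + x $ 1 - x $ 3)"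
    by (simp_all add: LA_def LC_def)
  \<comment> \<open>Partial fractions split the pole at the facet \<open>p' = 0\<close> from
    \<open>1 / (2 * (p + p'))\<close>, a function of \<open>x $ 1\<close> alone that
    \<open>rr_eq\<close> absorbs into \<open>1 / hh\<close>.\<close>
  have *: "1 / p' / 2 = p / (2 * p' * (p + p')) + 1 / (2 * (p + p'))" if "p > 0" "p' > 0" for p p' :: real
    using that by (simp add: divide_simps) (simp add: algebra_simps)
  have **: "(u + v + 1 / p' + 1 / q') / 2 + r = k + p / (2 * p' * (p + p')) + q / (2 * q' * (q + q'))"
    if "u / 2 + v / 2 + r + 1 / (2 * (p + p')) + 1 / (2 * (q + q')) = k" "p > 0" "p' > 0" "q > 0" "q' > 0"
    for u v r k p p' q q' :: real
    using that(1) *[OF that(2,3)] *[OF that(4,5)] by (simp add: add_divide_distrib)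
  have 11: "(1 / (1 + x $ 1) + 1 / (1 - x $ 1) + 1 / (a - x $ 1 - x $ 2) + 1 / (c + x $ 1 - x $ 3)) / 2 + rr (x $ 1) = hmat x $ 1 $ 1"
    unfolding hmat_def hess_block_def vector_3
    by (intro ** rr_eq[of "x $ 1", OF interior_polytope_M(1,2)[OF x], unfolded LA LC] p)
  have "hessian \<Phi> x $ i $ j = hmat x $ i $ j" for i j
  proof -
    have "(\<Sum>r\<in>UNIV. nvec r $ i * nvec r $ j / (nvec r \<bullet> x + lvec r)) / 2 + (if i = 1 \<and> j = 1 then rr (x $ 1) else 0) = hmat x $ i $ j"
      using exhaust_3[of i] exhaust_3[of j] 11
      unfolding sum_3_bool facet_values
      by (auto simp: nvec_def normals_def hmat_def hess_block_def add_divide_distrib)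
    then show ?thesis using pot.hessian_pot[OF x, of i j] unfolding pot_eq by simp
  qed
  then show ?thesis by (simp add: vec_eq_iff)
qed

lemma matrix_inv_hessian:
  assumes x: "x \<in> U"
  shows "matrix_inv (hessian \<Phi> x) = gmat x"
  unfolding hessian_eq[OF x] hmat_def gmat_def
  by (intro matrix_inv_eqI hess_block_inverse U_pos[OF x])

lemma toric_potential_\<Phi>: "toric_potential U \<Phi>"
proof
  show "open U" by simp
  have LA: "smooth_on U (\<lambda>x. LA (x $ 1))" unfolding LA_def by (intro smooth_intros) simp_all
  have LC: "smooth_on U (\<lambda>x. LC (x $ 1))" unfolding LC_def by (intro smooth_intros) simp_all
  have nz: "LA (x $ 1) * LC (x $ 1) \<noteq> 0" if "x \<in> U" for x
    using LA_pos[of "x $ 1"] LC_pos[of "x $ 1"] interior_polytope_M[OF that] by simp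
  have hh: "smooth_on U (\<lambda>x. hh (x $ 1))"
    unfolding hh_def PP_def by (intro smooth_intros LA LC open_interior nz)
  have "smooth_on U (\<lambda>x. hmat x $ i $ j)" for i j
    unfolding hmat_def by (intro smooth_hess_block smooth_intros hh open_interior conjI U_pos)
  then show "smooth_on U (\<lambda>x. hessian \<Phi> x $ i $ j)" for i j
    by (rule smooth_on_cong[rotated 2]) (simp_all add: hessian_eq)
  have "smooth_on U (\<lambda>x. gmat x $ i $ j)" for i j
    unfolding gmat_def by (intro smooth_hess_block smooth_intros hh open_interior conjI U_pos)
  then show "smooth_on U (\<lambda>x. matrix_inv (hessian \<Phi> x) $ i $ j)" for i j
    by (rule smooth_on_cong[rotated 2]) (simp_all add: matrix_inv_hessian)
  fix x assume x: "x \<in> U"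
  show "hessian \<Phi> x ** matrix_inv (hessian \<Phi> x) = mat 1"
    unfolding matrix_inv_hessian[OF x] unfolding hessian_eq[OF x] hmat_def gmat_def
    by (intro hess_block_inverse U_pos[OF x])
  show "0 < v \<bullet> (hessian \<Phi> x *v v)" if "v \<noteq> 0" for v
    unfolding hessian_eq[OF x] hmat_def by (intro hess_block_pos U_pos[OF x] that)
  show "hessian \<Phi> x $ i $ j = hessian \<Phi> x $ j $ i" for i j
    using pot.hessian_pot_sym[OF x] unfolding pot_eq .
  show "partial i (\<lambda>y. hessian \<Phi> y $ j $ k) x = partial j (\<lambda>y. hessian \<Phi> y $ i $ k) x" for i j k
    using pot.partial_hessian_pot_sym[OF x] unfolding pot_eq .
qed

text \<open>Every entry becomes polynomial in \<open>1 + x $ 2\<close> and \<open>1 + x $ 3\<close>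
  with coefficients depending on \<open>x $ 1\<close>, so the partial derivatives separate.\<close>

lemma gmat_entries:
  assumes x: "x \<in> U"
  shows "gmat x $ 1 $ 1 = hh (x $ 1)"
    "gmat x $ 1 $ 2 = - (hh (x $ 1) / LA (x $ 1)) * (1 + x $ 2)"
    "gmat x $ 2 $ 1 = - (hh (x $ 1) / LA (x $ 1)) * (1 + x $ 2)"
    "gmat x $ 1 $ 3 = hh (x $ 1) / LC (x $ 1) * (1 + x $ 3)"
    "gmat x $ 3 $ 1 = hh (x $ 1) / LC (x $ 1) * (1 + x $ 3)"
    "gmat x $ 2 $ 2 = 2 * (1 + x $ 2) + (hh (x $ 1) / (LA (x $ 1))\<^sup>2 - 2 / LA (x $ 1)) * (1 + x $ 2)\<^sup>2"
    "gmat x $ 2 $ 3 = - (hh (x $ 1) / (LA (x $ 1) * LC (x $ 1))) * (1 + x $ 2) * (1 + x $ 3)"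
    "gmat x $ 3 $ 2 = - (hh (x $ 1) / (LA (x $ 1) * LC (x $ 1))) * (1 + x $ 2) * (1 + x $ 3)"
    "gmat x $ 3 $ 3 = 2 * (1 + x $ 3) + (hh (x $ 1) / (LC (x $ 1))\<^sup>2 - 2 / LC (x $ 1)) * (1 + x $ 3)\<^sup>2"
proof -
  have e: "1 + x $ 2 + (a - x $ 1 - x $ 2) = LA (x $ 1)" "1 + x $ 3 + (c + x $ 1 - x $ 3) = LC (x $ 1)"
    "a - x $ 1 - x $ 2 = LA (x $ 1) - (1 + x $ 2)" "c + x $ 1 - x $ 3 = LC (x $ 1) - (1 + x $ 3)"
    by (simp_all add: LA_def LC_def)
  have pos: "LA (x $ 1) \<noteq> 0" "LC (x $ 1) \<noteq> 0"
    using interior_polytope_M[OF x] LA_pos[of "x $ 1"] LC_pos[of "x $ 1"] by auto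
  have d: "2 * p * (L - p) / L + h * p\<^sup>2 / L\<^sup>2 = 2 * p + (h / L\<^sup>2 - 2 / L) * p\<^sup>2" if "L \<noteq> 0" for p L h :: real
    using that by (simp add: divide_simps) (simp add: algebra_simps power2_eq_square)
  note g = gmat_def hess_inv_block_def vector_3
  show "gmat x $ 1 $ 1 = hh (x $ 1)" unfolding g ..
  show "gmat x $ 1 $ 2 = - (hh (x $ 1) / LA (x $ 1)) * (1 + x $ 2)" "gmat x $ 2 $ 1 = - (hh (x $ 1) / LA (x $ 1)) * (1 + x $ 2)"
    "gmat x $ 1 $ 3 = hh (x $ 1) / LC (x $ 1) * (1 + x $ 3)" "gmat x $ 3 $ 1 = hh (x $ 1) / LC (x $ 1) * (1 + x $ 3)"
    "gmat x $ 2 $ 3 = - (hh (x $ 1) / (LA (x $ 1) * LC (x $ 1))) * (1 + x $ 2) * (1 + x $ 3)"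
    "gmat x $ 3 $ 2 = - (hh (x $ 1) / (LA (x $ 1) * LC (x $ 1))) * (1 + x $ 2) * (1 + x $ 3)"
    unfolding g e(1,2) by simp_all
  show "gmat x $ 2 $ 2 = 2 * (1 + x $ 2) + (hh (x $ 1) / (LA (x $ 1))\<^sup>2 - 2 / LA (x $ 1)) * (1 + x $ 2)\<^sup>2"
    unfolding g e(1,2) unfolding e(3) by (rule d[OF pos(1)])
  show "gmat x $ 3 $ 3 = 2 * (1 + x $ 3) + (hh (x $ 1) / (LC (x $ 1))\<^sup>2 - 2 / LC (x $ 1)) * (1 + x $ 3)\<^sup>2"
    unfolding g e(1,2) unfolding e(4) by (rule d[OF pos(2)])
qed

text \<open>The first derivative of \<open>LA * LC * hh\<close>.\<close>

definition "F1 s = - 2 * s * PP s + (1 - s\<^sup>2) * (LA s - LC s - 2 * \<mu> * s)"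

lemma profile_derivs:
  shows "(LA has_real_derivative -1) (at s)" "(LC has_real_derivative 1) (at s)"
    "(PP has_real_derivative (LA s - LC s - 2 * \<mu> * s)) (at s)"
    "(F1 has_real_derivative - 2 * PP s - 4 * s * (LA s - LC s - 2 * \<mu> * s) - 2 * (1 + \<mu>) * (1 - s\<^sup>2)) (at s)"
proof -
  show A: "(LA has_real_derivative -1) (at s)" unfolding LA_def[abs_def] by (auto intro!: derivative_eq_intros)
  show C: "(LC has_real_derivative 1) (at s)" unfolding LC_def[abs_def] by (auto intro!: derivative_eq_intros)
  show P: "(PP has_real_derivative (LA s - LC s - 2 * \<mu> * s)) (at s)"
    unfolding PP_def[abs_def] by (auto intro!: derivative_eq_intros A C)
  show "(F1 has_real_derivative - 2 * PP s - 4 * s * (LA s - LC s - 2 * \<mu> * s) - 2 * (1 + \<mu>) * (1 - s\<^sup>2)) (at s)"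
    unfolding F1_def[abs_def] by (auto intro!: derivative_eq_intros A C P simp: algebra_simps)
qed

lemma hh_deriv:
  assumes "-1 < s" "s < 1"
  shows "(hh has_real_derivative F1 s / (LA s * LC s) - hh s * (LA s - LC s) / (LA s * LC s)) (at s)"
proof -
  have nz: "LA s \<noteq> 0" "LC s \<noteq> 0" using assms LA_pos[of s] LC_pos[of s] by auto
  have N: "((\<lambda>s. (1 - s\<^sup>2) * PP s) has_real_derivative F1 s) (at s)"
    unfolding F1_def by (auto intro!: derivative_eq_intros profile_derivs)
  have D: "((\<lambda>s. LA s * LC s) has_real_derivative LA s - LC s) (at s)"
    by (auto intro!: derivative_eq_intros profile_derivs)
  show ?thesis unfolding hh_def[abs_def]
  proof (rule DERIV_cong[OF DERIV_divide[OF N D]])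
    show "LA s * LC s \<noteq> 0" using nz by simp
    show "(F1 s * (LA s * LC s) - (1 - s\<^sup>2) * PP s * (LA s - LC s)) / (LA s * LC s * (LA s * LC s))
      = F1 s / (LA s * LC s) - (1 - s\<^sup>2) * PP s / (LA s * LC s) * (LA s - LC s) / (LA s * LC s)"
      using nz by (simp add: diff_divide_distrib)
  qed
qed

text \<open>Undifferentiated \<open>hh\<close> cancels in every row. The divergence sees the profile
  through \<open>F1\<close> only, which makes \<open>LA * LC * hh\<close> the natural
  unknown.\<close>

lemma divergence_gmat:
  assumes x: "x \<in> U"
  shows "(\<Sum>j\<in>UNIV. partial j (\<lambda>z. matrix_inv (hessian \<Phi> z) $ 1 $ j) x) = F1 (x $ 1) / (LA (x $ 1) * LC (x $ 1))"
    "(\<Sum>j\<in>UNIV. partial j (\<lambda>z. matrix_inv (hessian \<Phi> z) $ 2 $ j) x)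
       = 2 - (F1 (x $ 1) / ((LA (x $ 1))\<^sup>2 * LC (x $ 1)) + 4 / LA (x $ 1)) * (1 + x $ 2)"
    "(\<Sum>j\<in>UNIV. partial j (\<lambda>z. matrix_inv (hessian \<Phi> z) $ 3 $ j) x)
       = 2 + (F1 (x $ 1) / (LA (x $ 1) * (LC (x $ 1))\<^sup>2) - 4 / LC (x $ 1)) * (1 + x $ 3)"
proof -
  define s where "s = x $ 1"
  define A where "A = LA s"
  define C where "C = LC s"
  define h where "h = hh s"
  define h1 where "h1 = F1 s / (A * C) - h * (A - C) / (A * C)"
  have s: "-1 < s" "s < 1" using interior_polytope_M[OF x] by (simp_all add: s_def)
  have nz: "A \<noteq> 0" "C \<noteq> 0" using s LA_pos[of s] LC_pos[of s] by (auto simp: A_def C_def)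
  note fold = s_def[symmetric] A_def[symmetric] C_def[symmetric] h_def[symmetric]
  have dh: "(hh has_real_derivative h1) (at s)" using hh_deriv[OF s] by (simp add: h1_def h_def A_def C_def)
  have dA: "((\<lambda>s. - (hh s / LA s)) has_real_derivative - ((h1 * A + h) / A\<^sup>2)) (at s)"
    by (rule DERIV_cong[OF DERIV_minus[OF DERIV_divide[OF dh profile_derivs(1)]]])
      (use nz in \<open>simp_all add: A_def h_def power2_eq_square\<close>)
  have dC: "((\<lambda>s. hh s / LC s) has_real_derivative (h1 * C - h) / C\<^sup>2) (at s)"
    by (rule DERIV_cong[OF DERIV_divide[OF dh profile_derivs(2)]])
      (use nz in \<open>simp_all add: C_def h_def power2_eq_square\<close>)
  have c: "partial j (\<lambda>z. matrix_inv (hessian \<Phi> z) $ i $ k) x = partial j (\<lambda>z. gmat z $ i $ k) x" for i j k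
    by (rule partial_cong[OF open_interior x]) (simp add: matrix_inv_hessian)
  note pc = partial_cong[OF open_interior x]
  have comp: "has_partial i (\<lambda>x. x $ j) (if i = j then 1 else 0) x" for i j
    by (rule has_partial_of_component) (rule DERIV_ident)
  have y: "has_partial 2 (\<lambda>x. 1 + x $ 2) 1 x" "has_partial 3 (\<lambda>x. 1 + x $ 3) 1 x"
    using DERIV_add[OF DERIV_const comp[of 2 2]] DERIV_add[OF DERIV_const comp[of 3 3]] by simp_all
  note dh' = dh[unfolded s_def] and dA' = dA[unfolded s_def] and dC' = dC[unfolded s_def]
  have p: "partial 1 (\<lambda>z. gmat z $ 1 $ 1) x = h1"
    "partial 1 (\<lambda>z. gmat z $ 2 $ 1) x = - ((h1 * A + h) / A\<^sup>2) * (1 + x $ 2)"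
    "partial 1 (\<lambda>z. gmat z $ 3 $ 1) x = (h1 * C - h) / C\<^sup>2 * (1 + x $ 3)"
    "partial 2 (\<lambda>z. gmat z $ 1 $ 2) x = - (h / A)"
    "partial 3 (\<lambda>z. gmat z $ 1 $ 3) x = h / C"
    "partial 2 (\<lambda>z. gmat z $ 2 $ 2) x = 2 + (h / A\<^sup>2 - 2 / A) * (2 * (1 + x $ 2))"
    "partial 3 (\<lambda>z. gmat z $ 3 $ 3) x = 2 + (h / C\<^sup>2 - 2 / C) * (2 * (1 + x $ 3))"
    "partial 3 (\<lambda>z. gmat z $ 2 $ 3) x = - (h / (A * C)) * (1 + x $ 2)"
    "partial 2 (\<lambda>z. gmat z $ 3 $ 2) x = - (h / (A * C)) * (1 + x $ 3)"
  proof -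
    show "partial 1 (\<lambda>z. gmat z $ 1 $ 1) x = h1"
      using has_partial_of_component[OF dh', of 1]
      by (subst pc[OF gmat_entries(1)]) (auto intro!: partial_eqI)
    show "partial 1 (\<lambda>z. gmat z $ 2 $ 1) x = - ((h1 * A + h) / A\<^sup>2) * (1 + x $ 2)"
      using DERIV_cmult_right[OF has_partial_of_component[OF dA', of 1], of "1 + x $ 2"]
      by (subst pc[OF gmat_entries(3)]) (auto intro!: partial_eqI simp: axis_def)
    show "partial 1 (\<lambda>z. gmat z $ 3 $ 1) x = (h1 * C - h) / C\<^sup>2 * (1 + x $ 3)"
      using DERIV_cmult_right[OF has_partial_of_component[OF dC', of 1], of "1 + x $ 3"]
      by (subst pc[OF gmat_entries(5)]) (auto intro!: partial_eqI simp: axis_def)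
    show "partial 2 (\<lambda>z. gmat z $ 1 $ 2) x = - (h / A)"
      by (subst pc[OF gmat_entries(2)]) (auto intro!: partial_eqI derivative_eq_intros simp: axis_def fold nz)
    show "partial 3 (\<lambda>z. gmat z $ 1 $ 3) x = h / C"
      by (subst pc[OF gmat_entries(4)]) (auto intro!: partial_eqI derivative_eq_intros simp: axis_def fold nz)
    show "partial 2 (\<lambda>z. gmat z $ 2 $ 2) x = 2 + (h / A\<^sup>2 - 2 / A) * (2 * (1 + x $ 2))"
      by (subst pc[OF gmat_entries(6)]) (auto intro!: partial_eqI derivative_eq_intros simp: axis_def fold nz)
    show "partial 3 (\<lambda>z. gmat z $ 3 $ 3) x = 2 + (h / C\<^sup>2 - 2 / C) * (2 * (1 + x $ 3))"
      by (subst pc[OF gmat_entries(9)]) (auto intro!: partial_eqI derivative_eq_intros simp: axis_def fold nz)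
    show "partial 3 (\<lambda>z. gmat z $ 2 $ 3) x = - (h / (A * C)) * (1 + x $ 2)"
      by (subst pc[OF gmat_entries(7)]) (auto intro!: partial_eqI derivative_eq_intros simp: axis_def fold nz)
    show "partial 2 (\<lambda>z. gmat z $ 3 $ 2) x = - (h / (A * C)) * (1 + x $ 3)"
      by (subst pc[OF gmat_entries(8)]) (auto intro!: partial_eqI derivative_eq_intros simp: axis_def fold nz)
  qed
  show "(\<Sum>j\<in>UNIV. partial j (\<lambda>z. matrix_inv (hessian \<Phi> z) $ 1 $ j) x) = F1 (x $ 1) / (LA (x $ 1) * LC (x $ 1))"
    unfolding c sum_3 p fold using nz by (simp add: h1_def divide_simps) (simp add: algebra_simps)
  show "(\<Sum>j\<in>UNIV. partial j (\<lambda>z. matrix_inv (hessian \<Phi> z) $ 2 $ j) x)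
       = 2 - (F1 (x $ 1) / ((LA (x $ 1))\<^sup>2 * LC (x $ 1)) + 4 / LA (x $ 1)) * (1 + x $ 2)"
    unfolding c sum_3 p fold using nz by (simp add: h1_def divide_simps) (simp add: algebra_simps power2_eq_square)
  show "(\<Sum>j\<in>UNIV. partial j (\<lambda>z. matrix_inv (hessian \<Phi> z) $ 3 $ j) x)
       = 2 + (F1 (x $ 1) / (LA (x $ 1) * (LC (x $ 1))\<^sup>2) - 4 / LC (x $ 1)) * (1 + x $ 3)"
    unfolding c sum_3 p fold using nz by (simp add: h1_def divide_simps) (simp add: algebra_simps power2_eq_square)
qed

text \<open>The two equations are the coefficients of \<open>x\<close> and \<open>1\<close> in the differential equation for \<open>A C h\<close>.\<close>

lemma scalar_curvature_\<Phi>: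
  assumes csc: "a = c \<or> \<mu> = - 1 / 2"
    and mu_eq: "\<mu> * (12 * ((a + 1) * (c + 1)) - 4) = 4 * (a + c + 2) - 10 * ((a + 1) * (c + 1)) + 2"
    and X: "moment_part X \<in> U"
  shows "scalar_curvature (toric_metric \<Phi>) X = 12 * (1 + \<mu>)"
proof -
  interpret toric_potential U \<Phi> by (rule toric_potential_\<Phi>)
  define x where "x = moment_part X"
  have x: "x \<in> U" using X by (simp add: x_def)
  define s where "s = x $ 1"
  define A where "A = LA s"
  define C where "C = LC s"
  have s: "-1 < s" "s < 1" using interior_polytope_M[OF x] by (simp_all add: s_def)
  have nz: "A \<noteq> 0" "C \<noteq> 0" using s LA_pos[of s] LC_pos[of s] by (auto simp: A_def C_def)
  \<comment> \<open>The second derivative of \<open>LA * LC * hh\<close> at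
    \<open>s\<close>.\<close>
  define F2 where "F2 = - 2 * PP s - 4 * s * (A - C - 2 * \<mu> * s) - 2 * (1 + \<mu>) * (1 - s\<^sup>2)"
  have "((\<lambda>s. F1 s / (LA s * LC s)) has_real_derivative (F2 * (A * C) - F1 s * (A - C)) / (A * C)\<^sup>2) (at s)"
  proof -
    have D: "((\<lambda>s. LA s * LC s) has_real_derivative A - C) (at s)"
      unfolding A_def C_def by (auto intro!: derivative_eq_intros profile_derivs)
    show ?thesis
      by (rule DERIV_cong[OF DERIV_divide[OF profile_derivs(4) D]])
         (use nz in \<open>simp_all add: A_def C_def F2_def power2_eq_square\<close>)
  qed
  from has_partial_of_component[OF this[unfolded s_def], of 1]
  have 1: "partial 1 (\<lambda>y. F1 (y $ 1) / (LA (y $ 1) * LC (y $ 1))) x = (F2 * (A * C) - F1 s * (A - C)) / (A * C)\<^sup>2"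
    by (intro partial_eqI) (simp add: s_def)
  have 2: "partial 2 (\<lambda>y. 2 - (F1 (y $ 1) / ((LA (y $ 1))\<^sup>2 * LC (y $ 1)) + 4 / LA (y $ 1)) * (1 + y $ 2)) x
      = - (F1 s / (A\<^sup>2 * C) + 4 / A)"
    unfolding A_def C_def s_def by (rule partial_eqI) (auto intro!: derivative_eq_intros simp: axis_def)
  have 3: "partial 3 (\<lambda>y. 2 + (F1 (y $ 1) / (LA (y $ 1) * (LC (y $ 1))\<^sup>2) - 4 / LC (y $ 1)) * (1 + y $ 3)) x
      = F1 s / (A * C\<^sup>2) - 4 / C"
    unfolding A_def C_def s_def by (rule partial_eqI) (auto intro!: derivative_eq_intros simp: axis_def)
  have F2: "F2 - 4 * (A + C) = - 12 * (1 + \<mu>) * (A * C)"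
  proof -
    \<comment> \<open>Both sides are quadratic in \<open>s\<close>. Their leading coefficients agree
      for every \<open>\<mu>\<close>, which is what selects the value
      \<open>12 * (1 + \<mu>)\<close>.\<close>
    have "(a - c) * (1 + 2 * \<mu>) = 0" using csc by auto
    then show ?thesis using mu_eq unfolding F2_def PP_def A_def C_def LA_def LC_def by algebra
  qed
  have "scalar_curvature (toric_metric \<Phi>) X = - ((F2 * (A * C) - F1 s * (A - C)) / (A * C)\<^sup>2
     + (- (F1 s / (A\<^sup>2 * C) + 4 / A)) + (F1 s / (A * C\<^sup>2) - 4 / C))"
    using X unfolding scalar_curvature_toric[OF CollectI, OF X] x_def[symmetric]
      sum_3[of "\<lambda>i. partial i (\<lambda>y. \<Sum>j\<in>UNIV. partial j (\<lambda>z. matrix_inv (hessian \<Phi> z) $ i $ j) y) x"]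
    by (simp only: partial_cong[OF open_interior x divergence_gmat(1)]
      partial_cong[OF open_interior x divergence_gmat(2)] partial_cong[OF open_interior x divergence_gmat(3)] 1 2 3)
  \<comment> \<open>The three terms with \<open>F1 s\<close> cancel.\<close>
  also have "\<dots> = - ((F2 - 4 * (A + C)) / (A * C))"
    using nz by (simp add: divide_simps) (simp add: algebra_simps power2_eq_square)
  also have "\<dots> = 12 * (1 + \<mu>)" unfolding F2 using nz by simp
  finally show ?thesis .
qed

end

section \<open>Vertex charts\<close>

lemma has_derivative_vecI:
  fixes f :: "'a::real_normed_vector \<Rightarrow> real^'n"
  assumes "\<And>i. ((\<lambda>x. f x $ i) has_derivative (\<lambda>h. f' h $ i)) (at x within S)"
  shows "(f has_derivative f') (at x within S)"
  by (subst has_derivative_componentwise_within)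
     (auto simp: Basis_vec_def inner_axis assms)

text \<open>Polarization. It turns the pull-back formula, a product of three six by six matrices,
  into an identity between sums of squares.\<close>

lemma symmetric_matrix_eqI:
  fixes A B :: "real^'n^'n"
  assumes "transpose A = A" "transpose B = B" "\<And>v. v \<bullet> (A *v v) = v \<bullet> (B *v v)"
  shows "A = B"
proof -
  have ent: "axis i 1 \<bullet> (M *v axis j 1) = M $ i $ j" for M :: "real^'n^'n" and i j
    by (simp add: inner_axis' matrix_vector_mul_component inner_axis)
  have pol: "(axis i 1 + axis j 1) \<bullet> (M *v (axis i 1 + axis j 1)) = M $ i $ i + 2 * M $ i $ j + M $ j $ j"
    if "transpose M = M" for M :: "real^'n^'n" and i j
  proof -
    have "transpose M $ i $ j = M $ i $ j" using that by simp
    then have "M $ j $ i = M $ i $ j" by (simp add: transpose_def)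
    then show ?thesis by (simp add: matrix_vector_right_distrib inner_add_left inner_add_right ent)
  qed
  have "A $ i $ j = B $ i $ j" for i j
    using pol[OF assms(1), of i j] pol[OF assms(2), of i j] assms(3)[of "axis i 1 + axis j 1"]
      assms(3)[of "axis i 1"] assms(3)[of "axis j 1"] by (simp add: ent)
  then show ?thesis by (simp add: vec_eq_iff)
qed

definition sym_prod :: "real^'n \<Rightarrow> real^'n \<Rightarrow> real^'n^'n" where
  "sym_prod u w = (\<chi> i j. (u $ i * w $ j + w $ i * u $ j) / 2)"

lemma sym_prod_form: "v \<bullet> (sym_prod u w *v v) = (u \<bullet> v) * (w \<bullet> v)"
proof -
  have "v \<bullet> (sym_prod u w *v v) = (\<Sum>i\<in>UNIV. \<Sum>j\<in>UNIV. v $ i * (u $ i * w $ j * v $ j) / 2) + (\<Sum>i\<in>UNIV. \<Sum>j\<in>UNIV. v $ i * (w $ i * u $ j * v $ j) / 2)"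
    unfolding sym_prod_def inner_vec_def matrix_vector_mult_def
    by (simp add: sum_distrib_left sum.distrib[symmetric] field_simps)
  also have "\<dots> = (u \<bullet> v) * (w \<bullet> v) / 2 + (w \<bullet> v) * (u \<bullet> v) / 2"
    unfolding inner_vec_def sum_product sum_divide_distrib by (simp add: mult_ac)
  finally show ?thesis by simp
qed

lemma transpose_sym_prod: "transpose (sym_prod u w) = sym_prod u w"
  by (simp add: sym_prod_def transpose_def vec_eq_iff add.commute)

lemma transpose_add: "transpose (A + B) = transpose A + transpose (B :: real^'n^'m)"
  by (simp add: transpose_def vec_eq_iff)

lemma transpose_scaleR: "transpose (k *\<^sub>R A) = k *\<^sub>R transpose (A :: real^'n^'m)"
  by (simp add: transpose_def vec_eq_iff)

text \<open>The right side is the metric as it appears over the orbit, the left side the same form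
  without a pole at \<open>u = 0\<close>. The relation defining \<open>n\<close> is what cancels the
  pole.\<close>

lemma base_block_square:
  fixes P Q p q k n \<tau> \<epsilon> :: real
  assumes "u = (p\<^sup>2 + q\<^sup>2) / 2" "u \<noteq> 0" "k \<noteq> 0" "k - 1 / k = 2 * u * n" "\<epsilon>\<^sup>2 = 1"
  shows "(P\<^sup>2 + Q\<^sup>2) / k + n * (p * Q - q * P)\<^sup>2 + 2 * \<epsilon> * k * (p * Q - q * P) * \<tau> + 2 * u * k * \<tau>\<^sup>2
    = (p * P + q * Q)\<^sup>2 / (2 * u * k) + k / (2 * u) * ((p * Q - q * P) + 2 * u * \<epsilon> * \<tau>)\<^sup>2"
proof -
  define U where "U = p * P + q * Q"
  define S where "S = p * Q - q * P"
  \<comment> \<open>Two-squares identity: \<open>(p, q)\<close> and \<open>(- q, p)\<close> are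
    orthogonal and both have squared length \<open>2 * u\<close>.\<close>
  have US: "P\<^sup>2 + Q\<^sup>2 = (U\<^sup>2 + S\<^sup>2) / (2 * u)"
  proof -
    have "U\<^sup>2 + S\<^sup>2 = (p\<^sup>2 + q\<^sup>2) * (P\<^sup>2 + Q\<^sup>2)" unfolding U_def S_def by algebra
    then have "U\<^sup>2 + S\<^sup>2 = 2 * u * (P\<^sup>2 + Q\<^sup>2)" using assms(1) by simp
    then show ?thesis using assms(2) by simp
  qed
  have n: "n = (k - 1 / k) / (2 * u)" using assms(2,4) by simp
  have "2 * u * (2 * u * k) * (\<epsilon>\<^sup>2 * \<tau>\<^sup>2) = 2 * u * (2 * u * k) * \<tau>\<^sup>2" using assms(5) by simp
  have "(U\<^sup>2 + S\<^sup>2) / (2 * u) / k + (k - 1 / k) / (2 * u) * S\<^sup>2 + 2 * \<epsilon> * k * S * \<tau> + 2 * u * k * (\<epsilon>\<^sup>2 * \<tau>\<^sup>2)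
    = U\<^sup>2 / (2 * u * k) + k / (2 * u) * (S + 2 * u * \<epsilon> * \<tau>)\<^sup>2"
    using assms(2,3) by (simp add: divide_simps) (simp add: algebra_simps power2_eq_square)
  then show ?thesis unfolding U_def[symmetric] S_def[symmetric] US n using assms(5) by simp
qed

text \<open>The counterpart for one sphere. \<open>W\<close> stands for the differential of the
  first facet coordinate; it enters because the length \<open>L\<close> varies with that
  coordinate.\<close>

lemma fibre_block_square:
  fixes P Q p q L W \<delta> :: real
  assumes "u = (p\<^sup>2 + q\<^sup>2) / 2" "u \<noteq> 0" "L \<noteq> 0" "L - u \<noteq> 0" "\<delta>\<^sup>2 = 1"
  shows "L / (L - u) * (P\<^sup>2 + Q\<^sup>2) - (2 * L - u) / (2 * L * (L - u)) * (p * Q - q * P)\<^sup>2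
      + \<delta> / (L - u) * W * (p * P + q * Q) + u / (2 * L * (L - u)) * W\<^sup>2
    = L / (2 * u * (L - u)) * (p * P + q * Q + \<delta> * u / L * W)\<^sup>2 + (L - u) / (2 * u * L) * (p * Q - q * P)\<^sup>2"
proof -
  define U where "U = p * P + q * Q"
  define S where "S = p * Q - q * P"
  have US: "P\<^sup>2 + Q\<^sup>2 = (U\<^sup>2 + S\<^sup>2) / (2 * u)"
  proof -
    have "U\<^sup>2 + S\<^sup>2 = (p\<^sup>2 + q\<^sup>2) * (P\<^sup>2 + Q\<^sup>2)" unfolding U_def S_def by algebra
    then have "U\<^sup>2 + S\<^sup>2 = 2 * u * (P\<^sup>2 + Q\<^sup>2)" using assms(1) by simp
    then show ?thesis using assms(2) by simp
  qed
  define M where "M = L - u"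
  have L: "L = M + u" and M: "M \<noteq> 0" "M + u \<noteq> 0" using assms by (simp_all add: M_def)
  have "L / M * ((U\<^sup>2 + S\<^sup>2) / (2 * u)) - (2 * L - u) / (2 * L * M) * S\<^sup>2 + \<delta> / M * W * U + u / (2 * L * M) * (\<delta>\<^sup>2 * W\<^sup>2)
    = L / (2 * u * M) * (U + \<delta> * u / L * W)\<^sup>2 + M / (2 * u * L) * S\<^sup>2"
    unfolding L using assms(2) M by (simp add: divide_simps) (simp add: algebra_simps power2_eq_square)
  then show ?thesis unfolding U_def[symmetric] S_def[symmetric] US M_def[symmetric] using assms(5) by simp
qed

section \<open>The metric in a vertex chart\<close>

locale chart = profile +
  fixes b :: "3 \<Rightarrow> bool"
begin

text \<open>\<open>eps\<close> is the diagonal of \<open>normals b\<close>; \<open>bet\<close>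
  switches on the off-diagonal entries in rows 2 and 3.\<close>

definition "eps k = (if b k then -1 else 1 :: real)"
definition "bet k = (if b k then 1 else 0 :: real)"

lemma eps_sq [simp]: "(eps k)\<^sup>2 = 1" "eps k * eps k = 1" by (simp_all add: eps_def)

lemma normals_mult:
  "(normals b *v w) $ 1 = eps 1 * w $ 1"
  "(normals b *v w) $ 2 = - bet 2 * w $ 1 + eps 2 * w $ 2"
  "(normals b *v w) $ 3 = bet 3 * w $ 1 + eps 3 * w $ 3"
  by (simp_all add: normals_def matrix_vector_mult_def sum_3 eps_def bet_def)

lemma normals_transpose_mult:
  "(transpose (normals b) *v w) $ 1 = eps 1 * w $ 1 - bet 2 * w $ 2 + bet 3 * w $ 3"
  "(transpose (normals b) *v w) $ 2 = eps 2 * w $ 2"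
  "(transpose (normals b) *v w) $ 3 = eps 3 * w $ 3"
  by (simp_all add: normals_def matrix_vector_mult_def transpose_def sum_3 eps_def bet_def)

lemma normals_transpose_inv:
  "transpose (normals b) *v (matrix_inv (transpose (normals b)) *v w) = w"
proof -
  have "det (normals b) = eps 1 * eps 2 * eps 3"
    by (simp add: det_3 normals_def eps_def)
  then have "det (transpose (normals b)) \<noteq> 0" by (simp add: det_transpose eps_def)
  then have "invertible (transpose (normals b))" by (simp add: invertible_det_nz)
  then obtain B where "transpose (normals b) ** B = mat 1" unfolding invertible_def by blast
  then have "transpose (normals b) ** matrix_inv (transpose (normals b)) = mat 1"
    using matrix_inv_eqI by metis
  then show ?thesis by (simp add: matrix_vector_mul_assoc)
qed

lemma facets_b:
  "facets a c b x $ 1 = 1 + eps 1 * x $ 1"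
  "facets a c b x $ 2 = (if b 2 then a - x $ 1 - x $ 2 else 1 + x $ 2)"
  "facets a c b x $ 3 = (if b 3 then c + x $ 1 - x $ 3 else 1 + x $ 3)"
  by (simp_all add: facets_def normals_mult eps_def bet_def)

lemma facets_opp:
  "facets a c (\<lambda>k. \<not> b k) x $ 1 = 2 - facets a c b x $ 1"
  "facets a c (\<lambda>k. \<not> b k) x $ 2 = LA (x $ 1) - facets a c b x $ 2"
  "facets a c (\<lambda>k. \<not> b k) x $ 3 = LC (x $ 1) - facets a c b x $ 3"
  by (simp_all add: facets_def normals_def matrix_vector_mult_def sum_3 LA_def LC_def)

text \<open>\<open>kk = h / (2 u\<^sub>1)\<close> equals \<open>1\<close> on the divisor \<open>u\<^sub>1 = 0\<close>. The quotients \<open>mm = (kk - 1) / u\<^sub>1\<close> and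
  \<open>nn = (kk - 1 / kk) / (2 u\<^sub>1)\<close> are written with the factor \<open>u\<^sub>1\<close> cancelled, so that they are
  meaningful on the divisor.\<close>

definition "uu k Z = ((Z $ Inl k)\<^sup>2 + (Z $ Inr k)\<^sup>2) / (2::real)" for Z :: "real^(3+3)"
definition "xx Z = eps 1 * (uu 1 Z - 1)" 
definition "LZ Z = LA (xx Z)"
definition "CZ Z = LC (xx Z)"
definition "kk Z = (2 - uu 1 Z) * PP (xx Z) / (2 * LZ Z * CZ Z)"
definition "mm Z = - 1 / 2 + \<mu> * (2 - uu 1 Z)\<^sup>2 / (2 * LZ Z * CZ Z)"
definition "nn Z = mm Z * (kk Z + 1) / (2 * kk Z)"

abbreviation "D \<equiv> chart_domain a c b"

text \<open>Trades the existential over the polytope for inequalities in \<open>Z\<close>, from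
  which openness of the domain and the signs of all denominators follow.\<close>

lemma chart_domain_eq: "D = {Z. uu 1 Z < 2 \<and> uu 2 Z < LZ Z \<and> uu 3 Z < CZ Z}"
proof (intro set_eqI iffI)
  fix Z assume "Z \<in> D"
  then obtain x where x: "facets a c b x = (\<chi> i. uu i Z)" "\<And>i. 0 < facets a c (\<lambda>k. \<not> b k) x $ i"
    unfolding chart_domain_def uu_def by auto
  have u: "facets a c b x $ i = uu i Z" for i by (simp add: x(1))
  have "xx Z = x $ 1" unfolding xx_def u[of 1, symmetric] facets_b by (simp add: eps_def)
  then show "Z \<in> {Z. uu 1 Z < 2 \<and> uu 2 Z < LZ Z \<and> uu 3 Z < CZ Z}"
    using x(2)[of 1] x(2)[of 2] x(2)[of 3] unfolding facets_opp u LZ_def CZ_def by simp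
next
  fix Z assume "Z \<in> {Z. uu 1 Z < 2 \<and> uu 2 Z < LZ Z \<and> uu 3 Z < CZ Z}"
  then have lt: "uu 1 Z < 2" "uu 2 Z < LZ Z" "uu 3 Z < CZ Z" by auto
  have ge: "0 \<le> uu k Z" for k by (simp add: uu_def)
  \<comment> \<open>The facet equations at the chosen vertex, solved for the point of the
    polytope.\<close>
  define x :: "real^3" where "x = vector [xx Z, if b 2 then a - xx Z - uu 2 Z else uu 2 Z - 1,
     if b 3 then c + xx Z - uu 3 Z else uu 3 Z - 1]"
  have x: "x $ 1 = xx Z" "x $ 2 = (if b 2 then a - xx Z - uu 2 Z else uu 2 Z - 1)"
    "x $ 3 = (if b 3 then c + xx Z - uu 3 Z else uu 3 Z - 1)" by (simp_all add: x_def)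
  have f: "facets a c b x $ i = uu i Z" for i
    using exhaust_3[of i] by (auto simp: facets_b x) (simp add: xx_def mult.assoc[symmetric])
  then have "facets a c b x = (\<chi> i. uu i Z)" by (simp add: vec_eq_iff)
  moreover have "0 < facets a c (\<lambda>k. \<not> b k) x $ i" for i
    using exhaust_3[of i] lt by (auto simp: facets_opp f x LZ_def CZ_def)
  moreover have "x \<in> polytope_M a c"
  proof -
    have "-1 \<le> xx Z" "xx Z \<le> 1" using lt(1) ge[of 1] by (auto simp: xx_def eps_def)
    then show ?thesis using lt ge[of 2] ge[of 3]
      by (auto simp: polytope_M_def x LZ_def CZ_def LA_def LC_def)
  qed
  ultimately show "Z \<in> D" unfolding chart_domain_def uu_def by blast
qed

lemma domain_pos:
  assumes "Z \<in> D"
  shows "0 \<le> uu k Z" "0 < 2 - uu 1 Z" "0 < LZ Z" "0 < CZ Z" "0 < PP (xx Z)" "0 < kk Z"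
    "0 < LZ Z - uu 2 Z" "0 < CZ Z - uu 3 Z"
proof -
  have ge: "0 \<le> uu k Z" for k by (simp add: uu_def)
  show "0 \<le> uu k Z" by (rule ge)
  show 1: "0 < 2 - uu 1 Z" "0 < LZ Z - uu 2 Z" "0 < CZ Z - uu 3 Z" using assms by (auto simp: chart_domain_eq)
  have x: "-1 \<le> xx Z" "xx Z \<le> 1" using 1 ge[of 1] by (auto simp: xx_def eps_def)
  show 2: "0 < LZ Z" "0 < CZ Z" "0 < PP (xx Z)"
    using x LA_pos LC_pos PP_pos by (auto simp: LZ_def CZ_def)
  show "0 < kk Z" unfolding kk_def using 1 2 by simp
qed

lemma kk_nn:
  assumes "Z \<in> D"
  shows "kk Z - 1 / kk Z = 2 * uu 1 Z * nn Z"
proof -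
  note p = domain_pos[OF assms]
  \<comment> \<open>\<open>xx\<close> is \<open>uu 1 - 1\<close> up to sign, so both ends of the
    interval give the same expression. Inserted into \<open>PP\<close> it exhibits the factor
    \<open>uu 1\<close> of \<open>kk - 1\<close>.\<close>
  have "1 - (xx Z)\<^sup>2 = uu 1 Z * (2 - uu 1 Z)"
    by (simp add: xx_def power_mult_distrib) (simp add: power2_eq_square algebra_simps)
  then have "PP (xx Z) = LZ Z * CZ Z + \<mu> * (uu 1 Z * (2 - uu 1 Z))" by (simp add: PP_def LZ_def CZ_def)
  then have "kk Z - 1 = uu 1 Z * mm Z" unfolding kk_def mm_def using p
    by (simp add: divide_simps) (simp add: algebra_simps power2_eq_square)
  then have "kk Z * kk Z - 1 = uu 1 Z * mm Z * (kk Z + 1)" by (simp add: algebra_simps)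
  then show ?thesis unfolding nn_def using p by (simp add: divide_simps)
qed

text \<open>In the chart coordinates \<open>u\<^sub>k = (p\<^sub>k\<^sup>2 + q\<^sub>k\<^sup>2) / 2\<close>, and \<open>form_sig k = p\<^sub>k dq\<^sub>k - q\<^sub>k dp\<^sub>k = 2 u\<^sub>k d\<psi>\<^sub>k\<close>.
  The metric over the orbit is \<open>dx\<^sup>2 / h + h (\<epsilon>\<^sub>1 d\<psi>\<^sub>1 + \<tau>)\<^sup>2\<close> plus, for each of the two projective lines with
  \<open>t = u\<^sub>k / L\<close>, the term \<open>L dt\<^sup>2 / (2 t (1 - t)) + 2 L t (1 - t) d\<psi>\<^sub>k\<^sup>2\<close>. The blocks below are these
  expressions with the poles at \<open>u\<^sub>k = 0\<close> removed by \<open>du\<^sub>k\<^sup>2 + \<sigma>\<^sub>k\<^sup>2 = 2 u\<^sub>k (dp\<^sub>k\<^sup>2 + dq\<^sub>k\<^sup>2)\<close>; the sign \<open>\<delta>\<close> records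
  that \<open>A\<close> decreases and \<open>C\<close> increases with \<open>x\<close>.\<close>

definition form_dp :: "3 \<Rightarrow> real^(3+3)" where "form_dp k = axis (Inl k) 1"
definition form_dq :: "3 \<Rightarrow> real^(3+3)" where "form_dq k = axis (Inr k) 1"
definition form_du :: "3 \<Rightarrow> real^(3+3) \<Rightarrow> real^(3+3)" where
  "form_du k Z = (Z $ Inl k) *\<^sub>R axis (Inl k) 1 + (Z $ Inr k) *\<^sub>R axis (Inr k) 1"
definition form_sig :: "3 \<Rightarrow> real^(3+3) \<Rightarrow> real^(3+3)" where
  "form_sig k Z = (Z $ Inl k) *\<^sub>R axis (Inr k) 1 - (Z $ Inr k) *\<^sub>R axis (Inl k) 1"
definition form_tau :: "real^(3+3) \<Rightarrow> real^(3+3)" where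
  "form_tau Z = (- 1 / (2 * LZ Z)) *\<^sub>R form_sig 2 Z + (1 / (2 * CZ Z)) *\<^sub>R form_sig 3 Z"

definition base_block :: "real^(3+3) \<Rightarrow> real^(3+3)^(3+3)" where
  "base_block Z = (1 / kk Z) *\<^sub>R (sym_prod (form_dp 1) (form_dp 1) + sym_prod (form_dq 1) (form_dq 1))
    + nn Z *\<^sub>R sym_prod (form_sig 1 Z) (form_sig 1 Z)
    + (2 * eps 1 * kk Z) *\<^sub>R sym_prod (form_sig 1 Z) (form_tau Z)
    + (2 * uu 1 Z * kk Z) *\<^sub>R sym_prod (form_tau Z) (form_tau Z)"

definition fibre_block :: "3 \<Rightarrow> real \<Rightarrow> (real^(3+3) \<Rightarrow> real) \<Rightarrow> real^(3+3) \<Rightarrow> real^(3+3)^(3+3)" where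
  "fibre_block k \<delta> L Z = (L Z / (L Z - uu k Z)) *\<^sub>R (sym_prod (form_dp k) (form_dp k) + sym_prod (form_dq k) (form_dq k))
    + (- ((2 * L Z - uu k Z) / (2 * L Z * (L Z - uu k Z)))) *\<^sub>R sym_prod (form_sig k Z) (form_sig k Z)
    + (\<delta> / (L Z - uu k Z)) *\<^sub>R sym_prod (form_du 1 Z) (form_du k Z)
    + (uu k Z / (2 * L Z * (L Z - uu k Z))) *\<^sub>R sym_prod (form_du 1 Z) (form_du 1 Z)"

definition chart_metric :: "real^(3+3) \<Rightarrow> real^(3+3)^(3+3)" where
  "chart_metric Z = base_block Z + fibre_block 2 (eps 1) LZ Z + fibre_block 3 (- eps 1) CZ Z"

lemma smooth_uu: "open S \<Longrightarrow> smooth_on S (uu k)"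
  unfolding uu_def[abs_def] by (intro smooth_intros) simp_all

lemma smooth_xx: "open S \<Longrightarrow> smooth_on S xx"
  unfolding xx_def[abs_def] by (intro smooth_intros smooth_uu)

lemma smooth_LZ: "open S \<Longrightarrow> smooth_on S LZ"
  unfolding LZ_def[abs_def] LA_def by (intro smooth_intros smooth_xx)

lemma smooth_CZ: "open S \<Longrightarrow> smooth_on S CZ"
  unfolding CZ_def[abs_def] LC_def by (intro smooth_intros smooth_xx)

lemma open_D: "open D"
proof -
  have "continuous_on UNIV f" if "smooth_on UNIV f" for f :: "real^(3+3) \<Rightarrow> real"
    using that unfolding smooth_on_def by (metis Ck_on.simps(1))
  then have "continuous_on UNIV (uu k)" "continuous_on UNIV LZ" "continuous_on UNIV CZ" for k
    using smooth_uu smooth_LZ smooth_CZ by auto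
  then show ?thesis unfolding chart_domain_eq
    by (intro open_Collect_conj open_Collect_less continuous_intros) auto
qed

lemma smooth_chart_metric: "smooth_on D (\<lambda>Z. chart_metric Z $ i $ j)"
proof -
  note S = open_D
  have nz: "LZ Z \<noteq> 0" "CZ Z \<noteq> 0" "kk Z \<noteq> 0" "LZ Z - uu 2 Z \<noteq> 0" "CZ Z - uu 3 Z \<noteq> 0"
    if "Z \<in> D" for Z using domain_pos[OF that] by auto
  have kk: "smooth_on D kk"
    unfolding kk_def[abs_def] PP_def LZ_def[symmetric] CZ_def[symmetric]
    by (intro smooth_intros S smooth_uu smooth_xx smooth_LZ smooth_CZ) (simp add: nz)
  have nn: "smooth_on D nn"
    unfolding nn_def[abs_def] mm_def by (intro smooth_intros S kk smooth_uu smooth_LZ smooth_CZ) (simp_all add: nz)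
  have form: "smooth_on D (\<lambda>Z. form_dp k $ i)" "smooth_on D (\<lambda>Z. form_dq k $ i)"
    "smooth_on D (\<lambda>Z. form_du k Z $ i)" "smooth_on D (\<lambda>Z. form_sig k Z $ i)" for k i
    unfolding form_du_def form_sig_def vector_add_component vector_minus_component vector_scaleR_component real_scaleR_def
    by (intro smooth_intros S)+
  have tau: "smooth_on D (\<lambda>Z. form_tau Z $ i)" for i
    unfolding form_tau_def vector_add_component vector_scaleR_component real_scaleR_def
    by (intro smooth_intros S form smooth_LZ smooth_CZ) (simp_all add: nz)
  have bb: "smooth_on D (\<lambda>Z. base_block Z $ i $ j)"
    unfolding base_block_def sym_prod_def vector_add_component vector_scaleR_component real_scaleR_def vec_lambda_beta
    by (intro smooth_intros S form tau kk nn smooth_uu) (simp_all add: nz)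
  have fb: "smooth_on D (\<lambda>Z. fibre_block k \<delta> L Z $ i $ j)"
    if "smooth_on D L" "\<And>Z. Z \<in> D \<Longrightarrow> L Z \<noteq> 0" "\<And>Z. Z \<in> D \<Longrightarrow> L Z - uu k Z \<noteq> 0" for k \<delta> L
    unfolding fibre_block_def sym_prod_def vector_add_component vector_scaleR_component real_scaleR_def vec_lambda_beta
    by (intro smooth_intros S form that(1) smooth_uu) (use that(2,3) in auto)
  show ?thesis unfolding chart_metric_def vector_add_component
    by (intro smooth_intros S bb fb smooth_LZ smooth_CZ nz)
qed

lemma transpose_chart_metric: "transpose (chart_metric Z) = chart_metric Z"
  unfolding chart_metric_def base_block_def fibre_block_def
  by (simp only: transpose_add transpose_scaleR transpose_sym_prod)

lemma form_eval:
  "form_dp k \<bullet> v = v $ Inl k" "form_dq k \<bullet> v = v $ Inr k"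
  "form_du k Z \<bullet> v = Z $ Inl k * v $ Inl k + Z $ Inr k * v $ Inr k"
  "form_sig k Z \<bullet> v = Z $ Inl k * v $ Inr k - Z $ Inr k * v $ Inl k"
  by (simp_all add: form_dp_def form_dq_def form_du_def form_sig_def inner_add_left inner_diff_left inner_axis')

lemma base_block_form:
  "v \<bullet> (base_block Z *v v) = ((v $ Inl 1)\<^sup>2 + (v $ Inr 1)\<^sup>2) / kk Z + nn Z * (form_sig 1 Z \<bullet> v)\<^sup>2
    + 2 * eps 1 * kk Z * (form_sig 1 Z \<bullet> v) * (form_tau Z \<bullet> v) + 2 * uu 1 Z * kk Z * (form_tau Z \<bullet> v)\<^sup>2"
  unfolding base_block_def
  by (simp add: matrix_vector_mult_add_rdistrib scaleR_matrix_vector_assoc[symmetric] inner_add_right sym_prod_form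
      form_eval(1,2) power2_eq_square add_divide_distrib)

lemma fibre_block_form:
  "v \<bullet> (fibre_block k \<delta> L Z *v v) = L Z / (L Z - uu k Z) * ((v $ Inl k)\<^sup>2 + (v $ Inr k)\<^sup>2)
    - (2 * L Z - uu k Z) / (2 * L Z * (L Z - uu k Z)) * (form_sig k Z \<bullet> v)\<^sup>2
    + \<delta> / (L Z - uu k Z) * (form_du 1 Z \<bullet> v) * (form_du k Z \<bullet> v)
    + uu k Z / (2 * L Z * (L Z - uu k Z)) * (form_du 1 Z \<bullet> v)\<^sup>2"
  unfolding fibre_block_def
    matrix_vector_mult_add_rdistrib scaleR_matrix_vector_assoc[symmetric] inner_add_right inner_scaleR_right sym_prod_form
    form_eval(1,2) by (simp add: power2_eq_square)

lemma base_block_square':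
  assumes "Z \<in> D" "uu 1 Z \<noteq> 0"
  shows "v \<bullet> (base_block Z *v v) = (form_du 1 Z \<bullet> v)\<^sup>2 / (2 * uu 1 Z * kk Z)
     + kk Z / (2 * uu 1 Z) * (form_sig 1 Z \<bullet> v + 2 * uu 1 Z * eps 1 * (form_tau Z \<bullet> v))\<^sup>2"
  unfolding base_block_form form_eval
  by (rule base_block_square[OF uu_def assms(2) _ kk_nn[OF assms(1)] eps_sq(1)])
     (use domain_pos[OF assms(1)] in simp)

lemma fibre_block_square':
  assumes "uu k Z \<noteq> 0" "0 < L Z" "0 < L Z - uu k Z" "\<delta>\<^sup>2 = 1"
  shows "v \<bullet> (fibre_block k \<delta> L Z *v v)
    = L Z / (2 * uu k Z * (L Z - uu k Z)) * (form_du k Z \<bullet> v + \<delta> * uu k Z / L Z * (form_du 1 Z \<bullet> v))\<^sup>2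
     + (L Z - uu k Z) / (2 * uu k Z * L Z) * (form_sig k Z \<bullet> v)\<^sup>2"
  unfolding fibre_block_form form_eval
  by (rule fibre_block_square[OF uu_def assms(1) _ _ assms(4)]) (use assms(2,3) in simp_all)

lemma uu_zero:
  assumes "uu k Z = 0" shows "Z $ Inl k = 0" "Z $ Inr k = 0"
  using assms by (simp_all add: uu_def sum_power2_eq_zero_iff)

text \<open>By the two-squares identity the radial and the rotational covector are independent
  wherever \<open>uu k\<close> is nonzero.\<close>

lemma forms_zero:
  assumes "uu k Z \<noteq> 0" "form_du k Z \<bullet> v = 0" "form_sig k Z \<bullet> v = 0"
  shows "v $ Inl k = 0 \<and> v $ Inr k = 0"
proof -
  have "(form_du k Z \<bullet> v)\<^sup>2 + (form_sig k Z \<bullet> v)\<^sup>2 = 2 * uu k Z * ((v $ Inl k)\<^sup>2 + (v $ Inr k)\<^sup>2)"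
    unfolding form_eval uu_def by (simp add: power2_eq_square) algebra
  then have "(v $ Inl k)\<^sup>2 + (v $ Inr k)\<^sup>2 = 0" using assms by simp
  then show ?thesis by (simp add: sum_power2_eq_zero_iff)
qed

text \<open>On the divisor \<open>form_du 1\<close> and \<open>form_sig 1\<close> vanish and the
  pole-free expression is evaluated; elsewhere the sum of squares applies. The last two clauses
  describe the null vectors in two stages, as the proof of definiteness uses them.\<close>

lemma base_block_nonneg:
  assumes Z: "Z \<in> D"
  shows "0 \<le> v \<bullet> (base_block Z *v v)"
    and "v \<bullet> (base_block Z *v v) = 0 \<Longrightarrow> form_du 1 Z \<bullet> v = 0"
    and "v \<bullet> (base_block Z *v v) = 0 \<Longrightarrow> form_tau Z \<bullet> v = 0 \<Longrightarrow> v $ Inl 1 = 0 \<and> v $ Inr 1 = 0"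
proof -
  note p = domain_pos[OF Z]
  have "0 \<le> v \<bullet> (base_block Z *v v) \<and> (v \<bullet> (base_block Z *v v) = 0 \<longrightarrow> form_du 1 Z \<bullet> v = 0 \<and>
     (form_tau Z \<bullet> v = 0 \<longrightarrow> v $ Inl 1 = 0 \<and> v $ Inr 1 = 0))"
  proof (cases "uu 1 Z = 0")
    case True
    then have "form_sig 1 Z \<bullet> v = 0" "form_du 1 Z \<bullet> v = 0" unfolding form_eval using uu_zero[of 1 Z] by auto
    then show ?thesis using True p(6) unfolding base_block_form
      by (auto simp: sum_power2_eq_zero_iff)
  next
    case False
    then have u: "0 < uu 1 Z" using p(1)[of 1] by simp
    let ?a = "(form_du 1 Z \<bullet> v)\<^sup>2 / (2 * uu 1 Z * kk Z)"
    let ?b = "kk Z / (2 * uu 1 Z) * (form_sig 1 Z \<bullet> v + 2 * uu 1 Z * eps 1 * (form_tau Z \<bullet> v))\<^sup>2"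
    have nn: "0 \<le> ?a" "0 \<le> ?b" using u p(6) by auto
    have "form_du 1 Z \<bullet> v = 0 \<and> (form_tau Z \<bullet> v = 0 \<longrightarrow> form_sig 1 Z \<bullet> v = 0)" if "?a + ?b = 0"
    proof -
      have "?a = 0" "?b = 0" using nn that by linarith+
      then show ?thesis using u p(6) by auto
    qed
    then show ?thesis using nn forms_zero[OF False] unfolding base_block_square'[OF Z False] by auto
  qed
  then show "0 \<le> v \<bullet> (base_block Z *v v)"
    and "v \<bullet> (base_block Z *v v) = 0 \<Longrightarrow> form_du 1 Z \<bullet> v = 0"
    and "v \<bullet> (base_block Z *v v) = 0 \<Longrightarrow> form_tau Z \<bullet> v = 0 \<Longrightarrow> v $ Inl 1 = 0 \<and> v $ Inr 1 = 0"
    by auto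
qed

lemma fibre_block_nonneg:
  assumes "0 < L Z" "0 < L Z - uu k Z" "\<delta>\<^sup>2 = 1"
  shows "0 \<le> v \<bullet> (fibre_block k \<delta> L Z *v v)"
    and "v \<bullet> (fibre_block k \<delta> L Z *v v) = 0 \<Longrightarrow> form_du 1 Z \<bullet> v = 0 \<Longrightarrow> v $ Inl k = 0 \<and> v $ Inr k = 0"
proof -
  have "0 \<le> v \<bullet> (fibre_block k \<delta> L Z *v v) \<and> (v \<bullet> (fibre_block k \<delta> L Z *v v) = 0 \<longrightarrow> form_du 1 Z \<bullet> v = 0 \<longrightarrow>
     v $ Inl k = 0 \<and> v $ Inr k = 0)"
  proof (cases "uu k Z = 0")
    case True
    then have "form_sig k Z \<bullet> v = 0" "form_du k Z \<bullet> v = 0" unfolding form_eval using uu_zero[of k Z] by auto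
    then show ?thesis using True assms(1) unfolding fibre_block_form
      by (auto simp: sum_power2_eq_zero_iff)
  next
    case False
    then have u: "0 < uu k Z" unfolding uu_def by (simp add: sum_power2_gt_zero_iff sum_power2_eq_zero_iff)
    let ?a = "L Z / (2 * uu k Z * (L Z - uu k Z)) * (form_du k Z \<bullet> v + \<delta> * uu k Z / L Z * (form_du 1 Z \<bullet> v))\<^sup>2"
    let ?b = "(L Z - uu k Z) / (2 * uu k Z * L Z) * (form_sig k Z \<bullet> v)\<^sup>2"
    have nn: "0 \<le> ?a" "0 \<le> ?b" using u assms by auto
    have "form_du k Z \<bullet> v = 0 \<and> form_sig k Z \<bullet> v = 0" if "?a + ?b = 0" "form_du 1 Z \<bullet> v = 0"
    proof -
      have "?a = 0" "?b = 0" using nn that by linarith+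
      then show ?thesis using u assms that(2) by auto
    qed
    then show ?thesis using nn forms_zero[OF False] unfolding fibre_block_square'[of k Z L \<delta> v, OF False assms] by auto
  qed
  then show "0 \<le> v \<bullet> (fibre_block k \<delta> L Z *v v)"
    and "v \<bullet> (fibre_block k \<delta> L Z *v v) = 0 \<Longrightarrow> form_du 1 Z \<bullet> v = 0 \<Longrightarrow> v $ Inl k = 0 \<and> v $ Inr k = 0"
    by auto
qed

text \<open>No block is definite alone. For a null vector the base block gives
  \<open>form_du 1 = 0\<close>, the fibre blocks then kill components 2 and 3, hence
  \<open>form_tau = 0\<close>, and the base block kills component 1.\<close>

lemma riemannian_chart_metric: "riemannian_metric_on D chart_metric"
  unfolding riemannian_metric_on_def
proof (intro conjI allI ballI impI smooth_chart_metric transpose_chart_metric)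
  fix Z and v :: "real^(3+3)" assume Z: "Z \<in> D" and v: "v \<noteq> 0"
  note p = domain_pos[OF Z]
  note f2 = fibre_block_nonneg[of LZ Z 2 "eps 1" v, OF p(3,7) eps_sq(1)]
  note f3 = fibre_block_nonneg[of CZ Z 3 "- eps 1" v, OF p(4,8), simplified power2_minus, OF eps_sq(1)]
  note f1 = base_block_nonneg[OF Z, of v]
  have eq: "v \<bullet> (chart_metric Z *v v) = v \<bullet> (base_block Z *v v) + v \<bullet> (fibre_block 2 (eps 1) LZ Z *v v)
      + v \<bullet> (fibre_block 3 (- eps 1) CZ Z *v v)"
    unfolding chart_metric_def by (simp add: matrix_vector_mult_add_rdistrib inner_add_right)
  show "0 < v \<bullet> (chart_metric Z *v v)"
  proof (rule ccontr)
    assume "\<not> ?thesis"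
    then have z: "v \<bullet> (base_block Z *v v) = 0" "v \<bullet> (fibre_block 2 (eps 1) LZ Z *v v) = 0"
      "v \<bullet> (fibre_block 3 (- eps 1) CZ Z *v v) = 0"
      using f1(1) f2(1) f3(1) unfolding eq by linarith+
    have v23: "v $ Inl 2 = 0" "v $ Inr 2 = 0" "v $ Inl 3 = 0" "v $ Inr 3 = 0"
      using f2(2) f3(2) z f1(2) by auto
    then have "form_tau Z \<bullet> v = 0"
      unfolding form_tau_def inner_add_left inner_scaleR_left form_eval by simp
    then have "v $ Inl 1 = 0" "v $ Inr 1 = 0" using f1(3) z by auto
    then have "v = 0" using v23 by (simp add: vec_eq_iff split_sum_all forall_3)
    then show False using v by simp
  qed
qed

lemma chart_metric_form:
  assumes Z: "Z \<in> D" and u: "uu 1 Z \<noteq> 0" "uu 2 Z \<noteq> 0" "uu 3 Z \<noteq> 0"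
  shows "v \<bullet> (chart_metric Z *v v) = (form_du 1 Z \<bullet> v)\<^sup>2 / (2 * uu 1 Z * kk Z)
      + kk Z / (2 * uu 1 Z) * (form_sig 1 Z \<bullet> v + 2 * uu 1 Z * eps 1 * (form_tau Z \<bullet> v))\<^sup>2
      + (LZ Z / (2 * uu 2 Z * (LZ Z - uu 2 Z)) * (form_du 2 Z \<bullet> v + eps 1 * uu 2 Z / LZ Z * (form_du 1 Z \<bullet> v))\<^sup>2
        + (LZ Z - uu 2 Z) / (2 * uu 2 Z * LZ Z) * (form_sig 2 Z \<bullet> v)\<^sup>2)
      + (CZ Z / (2 * uu 3 Z * (CZ Z - uu 3 Z)) * (form_du 3 Z \<bullet> v - eps 1 * uu 3 Z / CZ Z * (form_du 1 Z \<bullet> v))\<^sup>2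
        + (CZ Z - uu 3 Z) / (2 * uu 3 Z * CZ Z) * (form_sig 3 Z \<bullet> v)\<^sup>2)"
proof -
  note p = domain_pos[OF Z]
  have eq: "v \<bullet> (chart_metric Z *v v) = v \<bullet> (base_block Z *v v) + v \<bullet> (fibre_block 2 (eps 1) LZ Z *v v)
      + v \<bullet> (fibre_block 3 (- eps 1) CZ Z *v v)"
    unfolding chart_metric_def by (simp add: matrix_vector_mult_add_rdistrib inner_add_right)
  show ?thesis unfolding eq
    unfolding base_block_square'[OF Z u(1)] fibre_block_square'[of 2 Z LZ "eps 1" v, OF u(2) p(3,7) eps_sq(1)]
      fibre_block_square'[of 3 Z CZ "- eps 1" v, OF u(3) p(4,8), simplified power2_minus, OF eps_sq(1)] by simp
qed

end

section \<open>Pull-back of the chart metric to the open orbit\<close>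

lemma has_derivative_polar:
  fixes u t :: "'a::real_normed_vector \<Rightarrow> real"
  assumes "(u has_derivative u') (at x)" "(t has_derivative t') (at x)" "0 < u x"
  shows "((\<lambda>x. sqrt (2 * u x) * cos (t x)) has_derivative
      (\<lambda>w. u' w / sqrt (2 * u x) * cos (t x) - sqrt (2 * u x) * sin (t x) * t' w)) (at x)" (is ?c)
    and "((\<lambda>x. sqrt (2 * u x) * sin (t x)) has_derivative
      (\<lambda>w. u' w / sqrt (2 * u x) * sin (t x) + sqrt (2 * u x) * cos (t x) * t' w)) (at x)" (is ?s)
proof -
  have d: "((\<lambda>x. 2 * u x) has_derivative (\<lambda>w. 2 * u' w)) (at x)"
    by (intro has_derivative_mult_right assms(1))
  have "(sqrt has_real_derivative inverse (sqrt (2 * u x)) / 2) (at (2 * u x))"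
    using assms(3) by (intro DERIV_real_sqrt) simp
  from DERIV_compose_FDERIV[where g = "\<lambda>x. 2 * u x", OF this d]
  have s: "((\<lambda>x. sqrt (2 * u x)) has_derivative (\<lambda>w. u' w / sqrt (2 * u x))) (at x)"
    by (simp add: inverse_eq_divide)
  show ?c
    by (rule has_derivative_eq_rhs[OF has_derivative_mult[OF s has_derivative_cos[OF assms(2)]]])
       (simp add: fun_eq_iff algebra_simps)
  show ?s
    by (rule has_derivative_eq_rhs[OF has_derivative_mult[OF s has_derivative_sin[OF assms(2)]]])
       (simp add: fun_eq_iff algebra_simps)
qed

lemma inner_pullback:
  fixes J G :: "real^'n^'n"
  shows "w \<bullet> ((transpose J ** G ** J) *v w) = (J *v w) \<bullet> (G *v (J *v w))"
proof -
  have "w \<bullet> (transpose J *v y) = (J *v w) \<bullet> y" for y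
    by (metis dot_lmul_matrix inner_commute transpose_matrix_vector transpose_transpose)
  then show ?thesis by (simp add: matrix_vector_mul_assoc[symmetric])
qed

context chart
begin

definition "uc X = facets a c b (moment_part X)"
definition "ang X = matrix_inv (transpose (normals b)) *v angle_part X"

lemma vertex_chart_component:
  "vertex_chart a c b X $ Inl i = sqrt (2 * uc X $ i) * cos (ang X $ i)"
  "vertex_chart a c b X $ Inr i = sqrt (2 * uc X $ i) * sin (ang X $ i)"
  by (simp_all add: vertex_chart_def uc_def ang_def Let_def)

definition dchart :: "real^(3+3) \<Rightarrow> real^(3+3) \<Rightarrow> real^(3+3)" where
  "dchart X w = (\<chi> s. case s of
      Inl i \<Rightarrow> (normals b *v moment_part w) $ i / sqrt (2 * uc X $ i) * cos (ang X $ i) - sqrt (2 * uc X $ i) * sin (ang X $ i) * ang w $ i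
    | Inr i \<Rightarrow> (normals b *v moment_part w) $ i / sqrt (2 * uc X $ i) * sin (ang X $ i) + sqrt (2 * uc X $ i) * cos (ang X $ i) * ang w $ i)"

lemma uc_deriv: "((\<lambda>X. uc X $ i) has_derivative (\<lambda>w. (normals b *v moment_part w) $ i)) (at X)"
proof -
  have "linear (\<lambda>w. (normals b *v moment_part w) $ i)"
    by (auto simp: linear_iff moment_part_def matrix_vector_mult_def sum_3 algebra_simps)
  then have "((\<lambda>w. (normals b *v moment_part w) $ i) has_derivative (\<lambda>w. (normals b *v moment_part w) $ i)) (at X)"
    by (intro bounded_linear_imp_has_derivative linear_conv_bounded_linear[THEN iffD1])
  from has_derivative_add[OF this has_derivative_const[of "vector [1, if b 2 then a else 1, if b 3 then c else 1] $ i"]]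
  show ?thesis unfolding uc_def facets_def by simp
qed

lemma ang_deriv: "((\<lambda>X. ang X $ i) has_derivative (\<lambda>w. ang w $ i)) (at X)"
proof -
  have "linear (\<lambda>w. ang w $ i)"
    by (auto simp: linear_iff ang_def angle_part_def matrix_vector_mult_def sum_3 algebra_simps)
  then show ?thesis
    by (intro bounded_linear_imp_has_derivative linear_conv_bounded_linear[THEN iffD1])
qed

lemma vertex_chart_deriv:
  assumes "\<And>i. 0 < uc X $ i"
  shows "(vertex_chart a c b has_derivative dchart X) (at X)"
proof (rule has_derivative_vecI)
  fix s :: "3 + 3"
  show "((\<lambda>X. vertex_chart a c b X $ s) has_derivative (\<lambda>w. dchart X w $ s)) (at X)"
    by (cases s) (simp only: vertex_chart_component dchart_def vec_lambda_beta sum.case,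
      rule has_derivative_polar[OF uc_deriv ang_deriv assms])+
qed

lemma jacobian_vertex_chart:
  assumes "\<And>i. 0 < uc X $ i"
  shows "jacobian (vertex_chart a c b) (at X) *v w = dchart X w"
proof -
  note d = vertex_chart_deriv[OF assms]
  have "frechet_derivative (vertex_chart a c b) (at X) = dchart X"
    using frechet_derivative_at[OF d] by simp
  moreover have "linear (dchart X)" using d by (rule has_derivative_linear)
  ultimately show ?thesis by (simp add: jacobian_def matrix_works)
qed

text \<open>Polar coordinates with squared radius \<open>2 u\<close> turn \<open>p dp + q dq\<close>
  into \<open>du\<close> and \<open>p dq - q dp\<close> into \<open>2 u d\<psi>\<close>, so the
  forms building the chart metric have simple pull-backs.\<close>

lemma forms_dchart:
  assumes "\<And>i. 0 < uc X $ i"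
  shows "uu k (vertex_chart a c b X) = uc X $ k"
    "form_du k (vertex_chart a c b X) \<bullet> dchart X w = (normals b *v moment_part w) $ k"
    "form_sig k (vertex_chart a c b X) \<bullet> dchart X w = 2 * uc X $ k * ang w $ k"
proof -
  define r where "r = sqrt (2 * uc X $ k)"
  have r: "r \<noteq> 0" "r * r = 2 * uc X $ k" using assms[of k] by (simp_all add: r_def)
  define sn cs where "sn = sin (ang X $ k)" and "cs = cos (ang X $ k)"
  have sc: "sn * sn + cs * cs = 1"
    using sin_cos_squared_add[of "ang X $ k"] by (simp add: sn_def cs_def power2_eq_square)
  let ?V = "(normals b *v moment_part w) $ k" and ?T = "ang w $ k"
  note vc = vertex_chart_component[of X k, folded r_def sn_def cs_def]
  have dc: "dchart X w $ Inl k = ?V / r * cs - r * sn * ?T" "dchart X w $ Inr k = ?V / r * sn + r * cs * ?T"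
    by (simp_all add: dchart_def r_def sn_def cs_def)
  have "uu k (vertex_chart a c b X) = r * r * (sn * sn + cs * cs) / 2"
    unfolding uu_def vc by (simp add: power2_eq_square algebra_simps)
  then show "uu k (vertex_chart a c b X) = uc X $ k" using r sc by simp
  have "form_du k (vertex_chart a c b X) \<bullet> dchart X w = ?V * (sn * sn + cs * cs)"
    unfolding form_eval vc dc using r(1) by (simp add: field_simps)
  then show "form_du k (vertex_chart a c b X) \<bullet> dchart X w = ?V" using sc by simp
  have "form_sig k (vertex_chart a c b X) \<bullet> dchart X w = r * r * ?T * (sn * sn + cs * cs)"
    unfolding form_eval vc dc using r(1) by (simp add: field_simps)
  then show "form_sig k (vertex_chart a c b X) \<bullet> dchart X w = 2 * uc X $ k * ?T" using sc r by simp
qed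

lemma angle_part_eq: "angle_part w = transpose (normals b) *v ang w"
  unfolding ang_def normals_transpose_inv ..

end

locale chart_potential = profile_potential a c \<mu> f f1 + chart a c \<mu> b
  for a c \<mu> f f1 b
begin

text \<open>Both quadratic forms are sums of six squares, a moment and an angular one for each of
  the three directions; \<open>t1\<close> to \<open>t6\<close> match them one by one.\<close>

lemma pullback_chart_metric:
  assumes X: "moment_part X \<in> U"
  shows "toric_metric \<Phi> X = transpose (jacobian (vertex_chart a c b) (at X)) ** chart_metric (vertex_chart a c b X)
      ** jacobian (vertex_chart a c b) (at X)"
proof (rule symmetric_matrix_eqI)
  interpret tp: toric_potential U \<Phi> by (rule toric_potential_\<Phi>)
  define x where "x = moment_part X"
  define Z where "Z = vertex_chart a c b X"
  let ?J = "jacobian (vertex_chart a c b) (at X)"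
  have x: "x \<in> U" using X by (simp add: x_def)
  note i = interior_polytope_M[OF x]
  show "transpose (toric_metric \<Phi> X) = toric_metric \<Phi> X"
    using tp.riemannian_toric X unfolding riemannian_metric_on_def by simp
  show "transpose (transpose ?J ** chart_metric (vertex_chart a c b X) ** ?J) = transpose ?J ** chart_metric (vertex_chart a c b X) ** ?J"
    by (simp add: matrix_transpose_mul transpose_chart_metric matrix_mul_assoc)
  have uc: "uc X = facets a c b x" by (simp add: uc_def x_def)
  have u: "0 < uc X $ k" for k
    using exhaust_3[of k] i unfolding uc by (auto simp: facets_b eps_def)
  note fd = forms_dchart[OF u, folded Z_def]
  have uZ: "uu k Z = facets a c b x $ k" for k by (simp add: fd uc)
  have xx: "xx Z = x $ 1" unfolding xx_def uZ facets_b by (simp add: eps_def)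
  have LZ: "LZ Z = LA (x $ 1)" and CZ: "CZ Z = LC (x $ 1)" by (simp_all add: LZ_def CZ_def xx)
  have LA: "LA (x $ 1) = 1 + x $ 2 + (a - x $ 1 - x $ 2)" and LC: "LC (x $ 1) = 1 + x $ 3 + (c + x $ 1 - x $ 3)"
    by (simp_all add: LA_def LC_def)
  have Z: "Z \<in> D"
  proof -
    have "0 < facets a c (\<lambda>k. \<not> b k) x $ k" for k
      using exhaust_3[of k] i by (auto simp: facets_opp facets_b LA_def LC_def eps_def)
    then show ?thesis using interior_subset x uZ
      unfolding chart_domain_def by (auto simp: vec_eq_iff uu_def intro!: bexI[of _ x])
  qed
  have nz: "uu k Z \<noteq> 0" for k using u[of k] by (simp add: uZ uc)
  have hk: "2 * uu 1 Z * kk Z = hh (x $ 1)"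
  proof -
    have "1 - (xx Z)\<^sup>2 = uu 1 Z * (2 - uu 1 Z)"
      by (simp add: xx_def power_mult_distrib) (simp add: power2_eq_square algebra_simps)
    then show ?thesis unfolding kk_def hh_def LZ CZ xx[symmetric] by simp
  qed
  fix w
  let ?v = "dchart X w"
  let ?m = "moment_part w" and ?n = "angle_part w" and ?T = "ang w"
  let ?A = "LA (x $ 1)" and ?C = "LC (x $ 1)" and ?h = "hh (x $ 1)"
  let ?p = "1 + x $ 2" and ?p' = "a - x $ 1 - x $ 2" and ?q = "1 + x $ 3" and ?q' = "c + x $ 1 - x $ 3"
  note pos = U_pos[OF x]
  have AC: "?A \<noteq> 0" "?C \<noteq> 0" using pos unfolding LA LC by auto
  have tau: "form_tau Z \<bullet> ?v = - (uu 2 Z / ?A) * ?T $ 2 + uu 3 Z / ?C * ?T $ 3"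
    unfolding form_tau_def inner_add_left inner_scaleR_left fd LZ CZ using AC by (simp add: uZ uc)
  have L: "w \<bullet> (toric_metric \<Phi> X *v w) =
      ((?m $ 1)\<^sup>2 / ?h + ?A / (2 * ?p * ?p') * (?m $ 2 + ?p / ?A * ?m $ 1)\<^sup>2 + ?C / (2 * ?q * ?q') * (?m $ 3 - ?q / ?C * ?m $ 1)\<^sup>2)
    + (?h * (?n $ 1 - ?p / ?A * ?n $ 2 + ?q / ?C * ?n $ 3)\<^sup>2 + 2 * ?p * ?p' / ?A * (?n $ 2)\<^sup>2 + 2 * ?q * ?q' / ?C * (?n $ 3)\<^sup>2)"
    unfolding tp.g_quadratic_form x_def[symmetric] matrix_inv_hessian[OF x] unfolding hessian_eq[OF x] hmat_def gmat_def
      LA LC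
    by (subst hess_block_form[OF pos(1-5)], subst hess_inv_block_form) (use pos in simp_all)
  have R: "w \<bullet> (transpose ?J ** chart_metric (vertex_chart a c b X) ** ?J *v w) = ?v \<bullet> (chart_metric Z *v ?v)"
    unfolding inner_pullback jacobian_vertex_chart[OF u] Z_def ..
  have n: "?n $ 1 = eps 1 * ?T $ 1 - bet 2 * ?T $ 2 + bet 3 * ?T $ 3" "?n $ 2 = eps 2 * ?T $ 2" "?n $ 3 = eps 3 * ?T $ 3"
    unfolding angle_part_eq normals_transpose_mult by simp_all
  have u2: "uu 2 Z = (if b 2 then ?p' else ?p)" and u3: "uu 3 Z = (if b 3 then ?q' else ?q)"
    unfolding uZ facets_b by simp_all
  \<comment> \<open>The fraction belonging to the chosen facet is \<open>p / A\<close> or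
    \<open>1 - p / A\<close>; \<open>bet\<close> and \<open>eps\<close> cover both choices at
    once.\<close>
  have s2: "bet 2 + eps 2 * (?p / ?A) = uu 2 Z / ?A" 
    using AC unfolding u2 by (simp add: bet_def eps_def field_simps) (simp add: LA_def)
  have s3: "bet 3 + eps 3 * (?q / ?C) = uu 3 Z / ?C" 
    using AC unfolding u3 by (simp add: bet_def eps_def field_simps) (simp add: LC_def)
  have t1: "(form_du 1 Z \<bullet> ?v)\<^sup>2 / (2 * uu 1 Z * kk Z) = (?m $ 1)\<^sup>2 / ?h"
    unfolding hk fd(2) normals_mult by (simp add: power_mult_distrib)
  \<comment> \<open>The connection form: the change of angles replaces the fractions
    \<open>p / A\<close> and \<open>q / C\<close> by those of the chosen facets.\<close>
  have th: "?n $ 1 - ?p / ?A * ?n $ 2 + ?q / ?C * ?n $ 3 = eps 1 * ?T $ 1 + (form_tau Z \<bullet> ?v)"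
    unfolding tau n s2[symmetric] s3[symmetric] by (simp add: algebra_simps)
  have t2: "kk Z / (2 * uu 1 Z) * (form_sig 1 Z \<bullet> ?v + 2 * uu 1 Z * eps 1 * (form_tau Z \<bullet> ?v))\<^sup>2
      = ?h * (?n $ 1 - ?p / ?A * ?n $ 2 + ?q / ?C * ?n $ 3)\<^sup>2"
  proof -
    have "form_sig 1 Z \<bullet> ?v + 2 * uu 1 Z * eps 1 * (form_tau Z \<bullet> ?v) = 2 * uu 1 Z * (eps 1 * (eps 1 * ?T $ 1 + (form_tau Z \<bullet> ?v)))"
      unfolding fd(3) fd(1)[symmetric] by (simp add: distrib_left mult.assoc[symmetric])
    then show ?thesis unfolding th hk[symmetric] using nz[of 1] by (simp add: power_mult_distrib power2_eq_square[of "uu 1 Z"])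
  qed
  have t3: "LZ Z / (2 * uu 2 Z * (LZ Z - uu 2 Z)) * (form_du 2 Z \<bullet> ?v + eps 1 * uu 2 Z / LZ Z * (form_du 1 Z \<bullet> ?v))\<^sup>2
     = ?A / (2 * ?p * ?p') * (?m $ 2 + ?p / ?A * ?m $ 1)\<^sup>2"
  proof -
    have "form_du 2 Z \<bullet> ?v + eps 1 * uu 2 Z / LZ Z * (form_du 1 Z \<bullet> ?v) = - bet 2 * ?m $ 1 + eps 2 * ?m $ 2 + uu 2 Z / ?A * ?m $ 1"
      unfolding fd normals_mult LZ by (simp add: mult.assoc[symmetric])
    also have "\<dots> = eps 2 * (?m $ 2 + ?p / ?A * ?m $ 1)"
      unfolding s2[symmetric] by (simp add: algebra_simps)
    finally have e: "form_du 2 Z \<bullet> ?v + eps 1 * uu 2 Z / LZ Z * (form_du 1 Z \<bullet> ?v) = eps 2 * (?m $ 2 + ?p / ?A * ?m $ 1)" .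
    have "2 * uu 2 Z * (LZ Z - uu 2 Z) = 2 * ?p * ?p'" unfolding u2 LZ LA by (cases "b 2") (simp_all add: algebra_simps)
    then show ?thesis unfolding e by (simp add: power_mult_distrib LZ)
  qed
  have t4: "(LZ Z - uu 2 Z) / (2 * uu 2 Z * LZ Z) * (form_sig 2 Z \<bullet> ?v)\<^sup>2 = 2 * ?p * ?p' / ?A * (?n $ 2)\<^sup>2"
  proof -
    have e: "2 * ?p * ?p' = 2 * uu 2 Z * (?A - uu 2 Z)" unfolding u2 LA by (cases "b 2") (simp_all add: algebra_simps)
    show ?thesis unfolding e n fd(3) fd(1)[symmetric] LZ using nz[of 2] AC by (simp add: power_mult_distrib) (simp add: power2_eq_square field_simps)
  qed
  have t5: "CZ Z / (2 * uu 3 Z * (CZ Z - uu 3 Z)) * (form_du 3 Z \<bullet> ?v - eps 1 * uu 3 Z / CZ Z * (form_du 1 Z \<bullet> ?v))\<^sup>2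
     = ?C / (2 * ?q * ?q') * (?m $ 3 - ?q / ?C * ?m $ 1)\<^sup>2"
  proof -
    have "form_du 3 Z \<bullet> ?v - eps 1 * uu 3 Z / CZ Z * (form_du 1 Z \<bullet> ?v) = bet 3 * ?m $ 1 + eps 3 * ?m $ 3 - uu 3 Z / ?C * ?m $ 1"
      unfolding fd normals_mult CZ by (simp add: mult.assoc[symmetric])
    also have "\<dots> = eps 3 * (?m $ 3 - ?q / ?C * ?m $ 1)"
      unfolding s3[symmetric] by (simp add: algebra_simps)
    finally have e: "form_du 3 Z \<bullet> ?v - eps 1 * uu 3 Z / CZ Z * (form_du 1 Z \<bullet> ?v) = eps 3 * (?m $ 3 - ?q / ?C * ?m $ 1)" .
    have "2 * uu 3 Z * (CZ Z - uu 3 Z) = 2 * ?q * ?q'" unfolding u3 CZ LC by (cases "b 3") (simp_all add: algebra_simps)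
    then show ?thesis unfolding e by (simp add: power_mult_distrib CZ)
  qed
  have t6: "(CZ Z - uu 3 Z) / (2 * uu 3 Z * CZ Z) * (form_sig 3 Z \<bullet> ?v)\<^sup>2 = 2 * ?q * ?q' / ?C * (?n $ 3)\<^sup>2"
  proof -
    have e: "2 * ?q * ?q' = 2 * uu 3 Z * (?C - uu 3 Z)" unfolding u3 LC by (cases "b 3") (simp_all add: algebra_simps)
    show ?thesis unfolding e n fd(3) fd(1)[symmetric] CZ using nz[of 3] AC by (simp add: power_mult_distrib) (simp add: power2_eq_square field_simps)
  qed
  show "w \<bullet> (toric_metric \<Phi> X *v w) = w \<bullet> (transpose ?J ** chart_metric (vertex_chart a c b X) ** ?J *v w)"
    unfolding L R chart_metric_form[OF Z nz nz nz] t1 t2 t3 t4 t5 t6 by simp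
qed

end

context profile_potential
begin

lemma extends_\<Phi>: "extends_to_M a c (toric_metric \<Phi>)"
  unfolding extends_to_M_def
proof
  fix b
  interpret chart_potential a c \<mu> f f1 b ..
  show "\<exists>G. riemannian_metric_on (chart_domain a c b) G \<and> (\<forall>X\<in>open_orbit a c.
      toric_metric \<Phi> X = transpose (jacobian (vertex_chart a c b) (at X)) ** G (vertex_chart a c b X)
         ** jacobian (vertex_chart a c b) (at X))"
    using riemannian_chart_metric pullback_chart_metric by (auto simp: open_orbit_def)
qed

lemma kaehler_\<Phi>: "kaehler_metric_on_M a c (toric_metric \<Phi>)"
  using toric_potential.kaehler_toric[OF toric_potential_\<Phi>] extends_\<Phi>
  by (simp add: kaehler_metric_on_M_def open_orbit_def)

end

section \<open>Smoothness of the correction term, and existence\<close>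

text \<open>Used twice, to pass from the rational function \<open>rr\<close> to its integrals
  \<open>f1\<close> and \<open>f\<close>.\<close>

lemma smooth_on_of_component:
  assumes S: "open S" and f: "\<And>x. x \<in> S \<Longrightarrow> (f has_real_derivative f1 (x $ j)) (at (x $ j))"
    and f1: "smooth_on S (\<lambda>x. f1 (x $ j))"
  shows "smooth_on S (\<lambda>x :: real^'n::finite. f (x $ j))"
proof (rule smooth_onI)
  have "(\<lambda>x. f (x $ j)) differentiable (at x)" if "x \<in> S" for x
  proof -
    have "((\<lambda>x. f (x $ j)) has_derivative (\<lambda>h. h $ j * f1 (x $ j))) (at x)"
      by (rule DERIV_compose_FDERIV[where g = "\<lambda>x. x $ j", OF f[OF that]
            bounded_linear_imp_has_derivative[OF bounded_linear_vec_nth]])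
    then show ?thesis by (auto simp: differentiable_def)
  qed
  then show "(\<lambda>x. f (x $ j)) differentiable_on S"
    by (intro differentiable_at_imp_differentiable_on)
  have "partial i (\<lambda>x. f (x $ j)) x = (if i = j then f1 (x $ j) else 0)" if "x \<in> S" for i x
    by (rule partial_eqI, rule has_partial_of_component, rule f[OF that])
  moreover have "smooth_on S (\<lambda>x. if i = j then f1 (x $ j) else 0)" for i
    using f1 smooth_on_const by (cases "i = j") auto
  ultimately show "smooth_on S (partial i (\<lambda>x. f (x $ j)))" for i
    by (rule smooth_on_cong[OF S])
qed

context profile_potential
begin

lemma smooth_rr:
  assumes "open S" "\<And>x. x \<in> S \<Longrightarrow> PP (x $ 1) \<noteq> 0 \<and> LA (x $ 1) \<noteq> 0 \<and> LC (x $ 1) \<noteq> 0"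
  shows "smooth_on S (\<lambda>x::real^3. rr (x $ 1))"
proof -
  have LA: "smooth_on S (\<lambda>x. LA (x $ 1))" and LC: "smooth_on S (\<lambda>x. LC (x $ 1))"
    unfolding LA_def LC_def by (intro smooth_intros assms(1))+
  show ?thesis unfolding rr_def unfolding PP_def
    by (intro smooth_intros assms(1) LA LC) (use assms(2) PP_def in auto)
qed

lemma smooth_second_derivatives_f: "smooth_second_derivatives (polytope_M a c) (\<lambda>x. f (x $ 1))"
  unfolding smooth_second_derivatives_def
proof (intro conjI allI)
  note i = interior_polytope_M
  have rrU: "smooth_on U (\<lambda>x. rr (x $ 1))"
  proof (rule smooth_rr)
    show "PP (x $ 1) \<noteq> 0 \<and> LA (x $ 1) \<noteq> 0 \<and> LC (x $ 1) \<noteq> 0" if "x \<in> U" for x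
      using i(1,2)[OF that] PP_pos[of "x $ 1"] LA_pos[of "x $ 1"] LC_pos[of "x $ 1"] by simp
  qed simp
  have f1U: "smooth_on U (\<lambda>x. f1 (x $ 1))"
    by (intro smooth_on_of_component[OF open_interior _ rrU] f1_deriv i)
  show "smooth_on U (\<lambda>x. f (x $ 1))"
    by (intro smooth_on_of_component[OF open_interior _ f1U] f_deriv i)
  fix k l :: 3
  \<comment> \<open>An open neighbourhood of the polytope on which no denominator of
    \<open>rr\<close> vanishes. Only the entry (1, 1) needs an extension, and \<open>rr\<close>
    itself provides it.\<close>
  let ?V = "{x :: real^3. PP (x $ 1) \<noteq> 0 \<and> LA (x $ 1) \<noteq> 0 \<and> LC (x $ 1) \<noteq> 0}"
  let ?h = "\<lambda>x :: real^3. if k = 1 \<and> l = 1 then rr (x $ 1) else 0"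
  have V: "open ?V" unfolding PP_def LA_def LC_def
    by (intro open_Collect_conj open_Collect_neq continuous_intros)
  have "polytope_M a c \<subseteq> ?V"
  proof
    fix x assume "x \<in> polytope_M a c"
    then have "-1 \<le> x $ 1" "x $ 1 \<le> 1" by (simp_all add: polytope_M_def)
    then show "x \<in> ?V" using PP_pos[of "x $ 1"] LA_pos[of "x $ 1"] LC_pos[of "x $ 1"] by simp
  qed
  moreover have "smooth_on ?V ?h"
    using smooth_rr[OF V] smooth_on_const by (cases "k = 1 \<and> l = 1") auto
  moreover have "hessian (\<lambda>x. f (x $ 1)) x $ k $ l = ?h x" if x: "x \<in> U" for x
  proof -
    have p: "partial l (\<lambda>x. f (x $ 1)) y = (if l = 1 then f1 (y $ 1) else 0)" if "y \<in> U" for y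
      by (rule partial_eqI, rule has_partial_of_component, rule f_deriv) (rule i[OF that])+
    have "has_partial k (\<lambda>y. if l = 1 then f1 (y $ 1) else 0) (?h x) x"
      using has_partial_of_component[OF f1_deriv[OF i(1,2)[OF x]], of k] by (cases "l = 1") auto
    then have "partial k (partial l (\<lambda>x. f (x $ 1))) x = ?h x"
      using partial_cong[OF open_interior x p] by (simp add: partial_eqI)
    then show ?thesis by (simp add: hessian_def)
  qed
  ultimately show "\<exists>W h. open W \<and> polytope_M a c \<subseteq> W \<and> smooth_on W h \<and>
      (\<forall>x\<in>U. hessian (\<lambda>x. f (x $ 1)) x $ k $ l = h x)"
    using V by blast
qed

end

lemma (in profile) continuous_rr: "continuous_on {-1..1} rr"
proof -
  have "PP s \<noteq> 0" "LA s \<noteq> 0" "LC s \<noteq> 0" if "s \<in> {-1..1}" for s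
    using that PP_pos[of s] LA_pos[of s] LC_pos[of s] by auto
  moreover have LA: "continuous_on {-1..1} LA" and LC: "continuous_on {-1..1} LC"
    unfolding LA_def[abs_def] LC_def[abs_def] by (intro continuous_intros)+
  moreover have "continuous_on {-1..1} PP"
    unfolding PP_def[abs_def] by (intro continuous_intros LA LC)
  ultimately show ?thesis unfolding rr_def[abs_def]
    by (intro continuous_intros) auto
qed

theorem proposition6p9:
  fixes a c :: real
  assumes "a > 0" and "c > 0" and "a = c \<or> a = 1 / c"
  shows "\<exists>f :: real \<Rightarrow> real.
           smooth_second_derivatives (polytope_M a c) (\<lambda>x. f (x $ 1)) \<and>
           kaehler_metric_on_M a c (toric_metric (\<lambda>x. Phi0 a c x + f (x $ 1))) \<and>
           constant_scalar_curvature_on (open_orbit a c)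
             (toric_metric (\<lambda>x. Phi0 a c x + f (x $ 1)))"
proof -
  define e where "e = (a + 1) * (c + 1)"
  \<comment> \<open>The solution of the constant coefficient of the equation for
    \<open>A C h\<close>; \<open>e\<close> is the constant term of \<open>A C\<close>.\<close>
  define \<mu> where "\<mu> = (4 * (a + c + 2) - 10 * e + 2) / (12 * e - 4)"
  have e: "1 < e" using assms(1,2) by (simp add: e_def algebra_simps add_pos_pos)
  then have mu_eq: "\<mu> * (12 * e - 4) = 4 * (a + c + 2) - 10 * e + 2" by (simp add: \<mu>_def)
  \<comment> \<open>The product equals \<open>4 * (a + c + 2) + 2 * e - 2\<close>.\<close>
  have "0 < (1 + \<mu>) * (12 * e - 4)"
    using mu_eq e assms(1,2) by (simp add: algebra_simps)
  then have mu: "-1 < \<mu>" using e by (simp add: zero_less_mult_iff)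
  have csc: "a = c \<or> \<mu> = - 1 / 2"
  proof (cases "a = c")
    case False
    then have "a * c = 1" using assms by auto
    \<comment> \<open>With this value the numerator of \<open>\<mu>\<close> is
      \<open>2 - 6 * e\<close>, minus one half of the denominator.\<close>
    then have "e = a + c + 2" by (simp add: e_def algebra_simps)
    then have "(2 * \<mu> + 1) * (12 * e - 4) = 0" using mu_eq by (simp add: algebra_simps)
    then show ?thesis using e by auto
  qed simp
  interpret profile a c \<mu> using assms(1,2) mu by unfold_locales
  obtain f f1 where "\<And>s. -1 < s \<Longrightarrow> s < 1 \<Longrightarrow> (f has_real_derivative f1 s) (at s)"
    "\<And>s. -1 < s \<Longrightarrow> s < 1 \<Longrightarrow> (f1 has_real_derivative rr s) (at s)"
    using real_second_antiderivative[OF continuous_rr] by blast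
  then interpret profile_potential a c \<mu> f f1 by unfold_locales
  have "constant_scalar_curvature_on (open_orbit a c) (toric_metric \<Phi>)"
    using scalar_curvature_\<Phi>[OF csc mu_eq[unfolded e_def]]
    by (auto simp: constant_scalar_curvature_on_def open_orbit_def)
  then show ?thesis
    using smooth_second_derivatives_f kaehler_\<Phi> unfolding \<Phi>_def by blast
qed

end
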